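(* Every finite amalgamation pattern $\mathbb H/\mathbb I$ admits finite realisations by natural reduced products $\mathbb H\otimes\mathbb G/{\approx}$ based on a direct product $\mathbb H\otimes\mathbb G$ of $\mathbb H$ with a suitable finite groupoid $\mathbb G/\mathbb I$, such that $\mathbb H\otimes\mathbb G$ itself is a simple, strongly coherent covering of $\mathbb H$. Such realisations can be chosen to be fully symmetric over the given amalgamation pattern $\mathbb H/\mathbb I$, and $\mathbb G/\mathbb I$ can be chosen to be $N$-acyclic for any given $N\geq 2$.
   Context: **Conventions.** $\sigma$ is a finite relational signature; substructures are induced ($\mathcal A\restriction A_0$). A partial isomorphism from $\mathcal A$ to $\mathcal A'$ is a (possibly empty) partial map $p$ from $A$ to $A'$ that is an isomorphism $\mathcal A\restriction\mathrm{dom}(p)\simeq\mathcal A'\restriction\mathrm{image}(p)$. For partial maps, $p\subseteq q$ means that $q$ extends $p$. **Incidence and amalgamation patterns.** An incidence pattern $\mathbb I=(S,E,\iota,\cdot^{-1})$ is a finite two-sorted structure with sorts $S$ (sites) and $E$ (links), a map $\iota=(\iota_1,\iota_2)\colon E\to S^2$ and a map $e\mapsto e^{-1}$ on $E$ with $(e^{-1})^{-1}=e$ and $\iota_1(e^{-1})=\iota_2(e)$. An amalgamation pattern $\mathbb H/\mathbb I$ consists of $\mathbb I$, a $\sigma$-structure $\mathcal H$ with a map $\delta\colon H\to S$ such that $\mathcal H=\dot\bigcup_{s\in S}\mathcal A_s$ is the disjoint union of the non-empty $\sigma$-structures $\mathcal A_s=\mathcal H\restriction\delta^{-1}(s)$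 (universe $A_s$), and a family $(\rho_e)_{e\in E}$ of partial isomorphisms $\rho_e$ from $\mathcal A_{\iota_1(e)}$ to $\mathcal A_{\iota_2(e)}$ with $\rho_{e^{-1}}=\rho_e^{-1}$. It is finite if $H$ is finite. A walk $w=e_1\cdots e_n$ in $\mathbb I$ satisfies $\iota_2(e_i)=\iota_1(e_{i+1})$; it leads from $\iota_1(w)=\iota_1(e_1)$ to $\iota_2(w)=\iota_2(e_n)$, and $\rho_w:=\rho_{e_n}\circ\cdots\circ\rho_{e_1}$ (partial composition). The empty walk $\lambda_s$ at $s$ has $\iota(\lambda_s)=(s,s)$ and $\rho_{\lambda_s}=\mathrm{id}_{A_s}$. $\mathbb I^\ast$ is the set of all walks. A symmetry of $\mathbb I$ is a pair of permutations $(\pi_S,\pi_E)$ of $S$, $E$ compatible with $\iota$ and $\cdot^{-1}$. A symmetry of $\mathbb H/\mathbb I$ is a triple $(\pi_S,\pi_E,\pi_H)$ with $(\pi_S,\pi_E)$ a symmetry of $\mathbb I$, $\pi_H$ an automorphism of $\mathcal H$, $\delta\circ\pi_H=\pi_S\circ\delta$ and $\pi_H\circ\rho_e\circ\pi_H^{-1}=\rho_{\pi_E(e)}$. **Consistency.** $\mathbb H/\mathbb I$ is *simple* if for each $e\in E$ with $\iota(e)=(s,s')$, $\rho_e\supseteq\rho_w$ for every walk $w$ from $s$ to $s'$; *strongly coherent* if for any two walks $w_1,w_2$ from $s$ to $s'$ there is a walk $w$ from $s$ to $s'$ with $\rho_w\supseteq\rho_{w_1}$ and $\rho_w\supseteq\rho_{w_2}$.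 The equivalence relation $\approx$ on $H$ is the one generated by $a\approx\rho_e(a)$ for $e\in E$, $a\in\mathrm{dom}(\rho_e)$; $[a]$ is the class of $a$. **Realisations.** An atlas $(\mathcal A,U,(U_s)_{s\in S},(\pi_{u,s})_{u\in U_s})$ for a $\sigma$-structure $\mathcal A$ with co-ordinate structures $(\mathcal A_s)_{s\in S}$ consists of a set $U=\bigcup_{s\in S}U_s$ of subsets $u\subseteq A$ (co-ordinate domains) and, for each $s\in S$ and $u\in U_s$, one chart $\pi_{u,s}$, an isomorphism $\pi_{u,s}\colon\mathcal A\restriction u\simeq\mathcal A_s$ (the sets $U_s$ need not be disjoint, so the same $u$ may carry charts into distinct co-ordinate structures); it is required that every element of $A$ and every tuple in every relation of $\mathcal A$ is contained in some $u\in U$. A realisation $\mathbb A/\mathbb H$ of $\mathbb H/\mathbb I$ is a $\sigma$-structure $\mathcal A$ with such an atlas, with $U_s\neq\emptyset$ for all $s\in S$, such that: (i) for every $u\in U_s$ and $e\in E$ with $\iota(e)=(s,s')$ there is some $u'\in U_{s'}$ such that $\mathrm{dom}(\rho_e)=\pi_{u,s}(u\cap u')$ and $\rho_e=\pi_{u',s'}\circ\pi_{u,s}^{-1}$ (partial composition); (ii) for any $u\in U_s$, $u'\in U_{s'}$ with $u\cap u'\neq\emptyset$ there is some walk $w$ in $\mathbb I$ such that $\mathrm{dom}(\rho_w)=\pi_{u,s}(u\cap u')$ and $\rho_w=\pi_{u',s'}\circ\pi_{u,s}^{-1}$. A symmetry of $\mathbb A/\mathbb H$ is an automorphism of the multi-sorted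 structure linking $\mathcal A$ to $\mathbb H/\mathbb I$ through its atlas, i.e. an automorphism $f$ of $\mathcal A$ together with a symmetry $(\pi_S,\pi_E,\pi_H)$ of $\mathbb H/\mathbb I$ such that, for every $s$, $f$ maps $U_s$ (as a set of subsets) bijectively onto $U_{\pi_S(s)}$ and $\pi_{f(u),\pi_S(s)}=\pi_H\circ\pi_{u,s}\circ f^{-1}$ for all $u\in U_s$. It is $\mathbb H$-rigid if it fixes $\mathbb H/\mathbb I$ pointwise. $\mathbb A/\mathbb H$ is fully symmetric over $\mathbb H/\mathbb I$ if every symmetry of $\mathbb H/\mathbb I$ extends to a symmetry of $\mathbb A/\mathbb H$ and the group of $\mathbb H$-rigid symmetries acts transitively on $U_s$, for every $s\in S$. **Coverings.** A homomorphism $\pi\colon\mathbb H^{(2)}\to\mathbb H^{(1)}$ between amalgamation patterns over $\mathbb I^{(2)},\mathbb I^{(1)}$ consists of maps $H^{(2)}\to H^{(1)}$, $S^{(2)}\to S^{(1)}$, $E^{(2)}\to E^{(1)}$ (all denoted $\pi$) compatible with $\delta$, $\iota$, $\cdot^{-1}$, restricting to isomorphisms $\mathcal A^{(2)}_s\simeq\mathcal A^{(1)}_{\pi(s)}$ such that $\rho^{(1)}_{\pi(e)}=\pi\circ\rho^{(2)}_e\circ(\pi\restriction A^{(2)}_{\iota_1(e)})^{-1}$. It is a covering if it is surjective on each sort and for every $s\in S^{(2)}$ and $e\in E^{(1)}$ with $\iota_1(e)=\pi(s)$ there is $e'\in E^{(2)}$ with $\iota_1(e')=s$ and $\pi(e')=e$.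 **Groupoids.** A groupoid $\mathbb G/\mathbb I$ consists of a set $G$ with $\iota=(\iota_1,\iota_2)\colon G\to S^2$, $G[s,s']:=\iota^{-1}(s,s')$, an associative composition $G[s,s']\times G[s',s'']\to G[s,s'']$ with units $1_s\in G[s,s]$ and inverses $g^{-1}\in G[s',s]$ for $g\in G[s,s']$, and elements $e^{\mathbb G}\in G[\iota_1(e),\iota_2(e)]$ for $e\in E$ with $(e^{-1})^{\mathbb G}=(e^{\mathbb G})^{-1}$, such that every $g\in G$ is of the form $w^{\mathbb G}:=e_1^{\mathbb G}\cdots e_n^{\mathbb G}$ for some walk $w=e_1\cdots e_n$ in $\mathbb I$ ($\lambda_s^{\mathbb G}=1_s$). $G[\ast,s]:=\bigcup_{s'}G[s',s]$. $\mathbb G/\mathbb I$ is compatible with $\mathbb H/\mathbb I$ if $w^{\mathbb G}=1_s$ implies $\rho_w\subseteq\mathrm{id}_{A_s}$, for all $w\in\mathbb I^\ast$. For $\alpha=\alpha^{-1}\subseteq E$, $\mathbb G[\alpha]$ is the sub-groupoid of all $w^{\mathbb G}$ for walks $w$ using only links in $\alpha$ (including all $1_s$), and $g\mathbb G[\alpha]=\{gh\colon h\in\mathbb G[\alpha],\iota_1(h)=\iota_2(g)\}$. A coset cycle of length $n\geq2$ is a tuple $(g_i,g_i\mathbb G[\alpha_i])_{i\in\mathbb Z_n}$ with $\alpha_i=\alpha_i^{-1}\subseteq E$ such that for all $i$: $g_{i+1}\in g_i\mathbb G[\alpha_i]$ and $g_i\mathbb G[\alpha_i\cap\alpha_{i-1}]\cap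 g_{i+1}\mathbb G[\alpha_i\cap\alpha_{i+1}]=\emptyset$. $\mathbb G/\mathbb I$ is $N$-acyclic ($N\geq2$) if it has no coset cycles of lengths $2\leq n\leq N$. **Direct and reduced products.** $\hat{\mathbb I}$ is the incidence pattern with sites $G$ and links $\hat E=\{e[g]\colon e\in E,g\in G,\iota_2(g)=\iota_1(e)\}$, $\iota(e[g])=(g,ge^{\mathbb G})$, $e[g]^{-1}=e^{-1}[ge^{\mathbb G}]$. The direct product $\mathbb H\otimes\mathbb G$ is the amalgamation pattern over $\hat{\mathbb I}$ whose universe is $\{(a,g)\in H\times G\colon\delta(a)=\iota_2(g)\}$, with sites $\mathcal A_g:=\mathcal A_{\iota_2(g)}\times\{g\}$ (copies of $\mathcal A_{\iota_2(g)}$) and partial isomorphisms $\rho_{e[g]}\colon(a,g)\mapsto(\rho_e(a),ge^{\mathbb G})$ for $a\in\mathrm{dom}(\rho_e)$. It is regarded as a covering of $\mathbb H$ via the natural projection $(a,g)\mapsto a$, $g\mapsto\iota_2(g)$, $e[g]\mapsto e$. For $\mathbb G/\mathbb I$ compatible with $\mathbb H/\mathbb I$, the reduced product $\mathbb H\otimes\mathbb G/{\approx}$ is (whenever well-defined, in particular if $\mathbb H\otimes\mathbb G$ is strongly coherent) the quotient of the relational structure of $\mathbb H\otimes\mathbb G$ w.r.t. its relation $\approx$, with the atlas given by $U_s=\{u[g]\colon g\in G[\ast,s]\}$, $u[g]=\{[(a,g)]\colon a\in A_{\iota_2(g)}\}$, and the charts $\pi_{u,s}\colon[(a,g)]\mapsto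 a$ from $u=u[g]\in U_s$ onto $\mathcal A_s$.
   Formalization: A co-ordinate domain u in U_s may carry several charts into A_s (with one chart each the claim fails, e.g. one site, two points, ρ_e their swap); charts are unique whenever every closed walk w at s with dom(ρ_w)=A_s has ρ_w=id, which is necessary. Rigid symmetries act transitively on charts. *)

theory Defs
  imports Main
begin

text \<open>
  Partial maps are represented by their graphs, i.e. as relations. Hence extension of partial maps
  is inclusion, inversion is converse, and \<open>q \<circ> p\<close> is the relation composition \<open>p O q\<close> (in this
  order). The graph of \<open>h \<circ> p \<circ> f\<inverse>\<close>, for maps \<open>f\<close> and \<open>h\<close>, is \<open>map_prod f h ` p\<close>.
  Total maps between carrier sets are HOL functions; their values off the carrier never matter.
\<close>

section \<open>Relational structures\<close>

record 'r signature =
  syms :: "'r set"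
  arity :: "'r \<Rightarrow> nat"

record ('a, 'r) struct =
  univ :: "'a set"
  rel :: "'r \<Rightarrow> 'a list set"

definition is_structure :: "'r signature \<Rightarrow> ('a, 'r) struct \<Rightarrow> bool" where
  "is_structure \<sigma> A \<longleftrightarrow>
     (\<forall>R\<in>syms \<sigma>. \<forall>t\<in>rel A R. length t = arity \<sigma> R \<and> set t \<subseteq> univ A)"

definition induced :: "('a, 'r) struct \<Rightarrow> 'a set \<Rightarrow> ('a, 'r) struct" where
  "induced A X = \<lparr>univ = univ A \<inter> X, rel = (\<lambda>R. {t \<in> rel A R. set t \<subseteq> X})\<rparr>"

definition graph_on :: "('a \<Rightarrow> 'b) \<Rightarrow> 'a set \<Rightarrow> ('a \<times> 'b) set" where
  "graph_on f X = {(x, f x) | x. x \<in> X}"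

definition isomorphism ::
    "'r signature \<Rightarrow> ('a \<times> 'b) set \<Rightarrow> ('a, 'r) struct \<Rightarrow> ('b, 'r) struct \<Rightarrow> bool" where
  "isomorphism \<sigma> p A B \<longleftrightarrow>
     Domain p = univ A \<and> Range p = univ B \<and> single_valued p \<and> single_valued (p\<inverse>) \<and>
     (\<forall>R\<in>syms \<sigma>. \<forall>xs ys. list_all2 (\<lambda>x y. (x, y) \<in> p) xs ys \<longrightarrow>
        (xs \<in> rel A R \<longleftrightarrow> ys \<in> rel B R))"

definition partial_isomorphism ::
    "'r signature \<Rightarrow> ('a \<times> 'b) set \<Rightarrow> ('a, 'r) struct \<Rightarrow> ('b, 'r) struct \<Rightarrow> bool" where
  "partial_isomorphism \<sigma> p A B \<longleftrightarrow>
     p \<subseteq> univ A \<times> univ B \<and> isomorphism \<sigma> p (induced A (Domain p)) (induced B (Range p))"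

section \<open>Incidence patterns and amalgamation patterns\<close>

record ('s, 'e) incidence =
  sites :: "'s set"
  links :: "'e set"
  src :: "'e \<Rightarrow> 's"
  tgt :: "'e \<Rightarrow> 's"
  linv :: "'e \<Rightarrow> 'e"

definition incidence_pattern :: "('s, 'e) incidence \<Rightarrow> bool" where
  "incidence_pattern I \<longleftrightarrow>
     finite (sites I) \<and> finite (links I) \<and>
     (\<forall>e\<in>links I. src I e \<in> sites I \<and> tgt I e \<in> sites I \<and>
        linv I e \<in> links I \<and> linv I (linv I e) = e \<and> src I (linv I e) = tgt I e)"

text \<open>A walk is a list of links; both end points are recorded, because of the empty walks.\<close>

fun walk :: "('s, 'e) incidence \<Rightarrow> 's \<Rightarrow> 'e list \<Rightarrow> 's \<Rightarrow> bool" where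
  "walk I s [] s' \<longleftrightarrow> s \<in> sites I \<and> s = s'"
| "walk I s (e # w) s' \<longleftrightarrow> e \<in> links I \<and> src I e = s \<and> walk I (tgt I e) w s'"

record ('h, 's, 'e, 'r) pattern =
  inc :: "('s, 'e) incidence"
  str :: "('h, 'r) struct"
  delta :: "'h \<Rightarrow> 's"
  rho :: "'e \<Rightarrow> ('h \<times> 'h) set"

definition part :: "('h, 's, 'e, 'r) pattern \<Rightarrow> 's \<Rightarrow> ('h, 'r) struct" where
  "part P s = induced (str P) {a. delta P a = s}"

definition amalgamation_pattern :: "'r signature \<Rightarrow> ('h, 's, 'e, 'r) pattern \<Rightarrow> bool" where
  "amalgamation_pattern \<sigma> P \<longleftrightarrow>
     incidence_pattern (inc P) \<and>
     is_structure \<sigma> (str P) \<and>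
     (\<forall>a\<in>univ (str P). delta P a \<in> sites (inc P)) \<and>
     (\<forall>s\<in>sites (inc P). univ (part P s) \<noteq> {}) \<and>
     (\<forall>R\<in>syms \<sigma>. \<forall>t\<in>rel (str P) R. \<exists>s\<in>sites (inc P). t \<in> rel (part P s) R) \<and>
     (\<forall>e\<in>links (inc P).
        partial_isomorphism \<sigma> (rho P e) (part P (src (inc P) e)) (part P (tgt (inc P) e)) \<and>
        rho P (linv (inc P) e) = (rho P e)\<inverse>)"

definition finite_pattern :: "('h, 's, 'e, 'r) pattern \<Rightarrow> bool" where
  "finite_pattern P \<longleftrightarrow> finite (univ (str P))"

text \<open>The first argument is the site at which the walk starts.\<close>

fun rho_walk :: "('h, 's, 'e, 'r) pattern \<Rightarrow> 's \<Rightarrow> 'e list \<Rightarrow> ('h \<times> 'h) set" where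
  "rho_walk P s [] = Id_on (univ (part P s))"
| "rho_walk P s (e # w) = rho P e O rho_walk P (tgt (inc P) e) w"

definition incidence_symmetry :: "('s, 'e) incidence \<Rightarrow> ('s \<Rightarrow> 's) \<Rightarrow> ('e \<Rightarrow> 'e) \<Rightarrow> bool" where
  "incidence_symmetry I \<pi>S \<pi>E \<longleftrightarrow>
     bij_betw \<pi>S (sites I) (sites I) \<and> bij_betw \<pi>E (links I) (links I) \<and>
     (\<forall>e\<in>links I. src I (\<pi>E e) = \<pi>S (src I e) \<and> tgt I (\<pi>E e) = \<pi>S (tgt I e) \<and>
        linv I (\<pi>E e) = \<pi>E (linv I e))"

definition pattern_symmetry ::
    "'r signature \<Rightarrow> ('h, 's, 'e, 'r) pattern \<Rightarrow>
     ('s \<Rightarrow> 's) \<Rightarrow> ('e \<Rightarrow> 'e) \<Rightarrow> ('h \<Rightarrow> 'h) \<Rightarrow> bool" where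
  "pattern_symmetry \<sigma> P \<pi>S \<pi>E \<pi>H \<longleftrightarrow>
     incidence_symmetry (inc P) \<pi>S \<pi>E \<and>
     isomorphism \<sigma> (graph_on \<pi>H (univ (str P))) (str P) (str P) \<and>
     (\<forall>a\<in>univ (str P). delta P (\<pi>H a) = \<pi>S (delta P a)) \<and>
     (\<forall>e\<in>links (inc P). map_prod \<pi>H \<pi>H ` rho P e = rho P (\<pi>E e))"

section \<open>Consistency\<close>

definition simple_pattern :: "('h, 's, 'e, 'r) pattern \<Rightarrow> bool" where
  "simple_pattern P \<longleftrightarrow>
     (\<forall>e\<in>links (inc P). \<forall>w. walk (inc P) (src (inc P) e) w (tgt (inc P) e) \<longrightarrow>
        rho_walk P (src (inc P) e) w \<subseteq> rho P e)"

definition strongly_coherent :: "('h, 's, 'e, 'r) pattern \<Rightarrow> bool" where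
  "strongly_coherent P \<longleftrightarrow>
     (\<forall>s s' w1 w2. walk (inc P) s w1 s' \<and> walk (inc P) s w2 s' \<longrightarrow>
        (\<exists>w. walk (inc P) s w s' \<and>
           rho_walk P s w1 \<subseteq> rho_walk P s w \<and> rho_walk P s w2 \<subseteq> rho_walk P s w))"

definition approx :: "('h, 's, 'e, 'r) pattern \<Rightarrow> ('h \<times> 'h) set" where
  "approx P =
     Id_on (univ (str P)) \<union>
     ((\<Union>e\<in>links (inc P). rho P e) \<union> (\<Union>e\<in>links (inc P). rho P e)\<inverse>)\<^sup>+"

section \<open>Atlases and realisations\<close>

text \<open>
  \<open>dom_sets \<AA> s\<close> is $U_s$, a set of subsets, and \<open>charts \<AA> u s\<close> is the set of the charts which
  the co-ordinate domain \<open>u\<close> carries into the co-ordinate structure at \<open>s\<close>. It is required to be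
  non-empty; the predicate \<open>single_charted\<close> below says that there is exactly one such chart
  $\pi_{u,s}$, in which case all notions are literally those for a family $(\pi_{u,s})$.

  More than one chart has to be admitted because a finite pattern for which \<open>\<rho>\<^sub>w\<close>, for some closed
  walk \<open>w\<close> at \<open>s\<close>, is a non-trivial automorphism of the co-ordinate structure at \<open>s\<close> has no
  single-charted realisation at all (lemma \<open>single_charted_realisation_total_walks\<close>). In a reduced
  product this corresponds to $u[g] = u[g']$ with $g \neq g'$ inducing different charts. An example
  is one site, two elements, no relations, and one link $e = e^{-1}$ whose $\rho_e$ swaps them.
\<close>

record ('a, 's, 'h, 'r) atlas =
  atl_str :: "('a, 'r) struct"
  dom_sets :: "'s \<Rightarrow> 'a set set"
  charts :: "'a set \<Rightarrow> 's \<Rightarrow> ('a \<times> 'h) set set"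

definition is_atlas ::
    "'r signature \<Rightarrow> 's set \<Rightarrow> ('s \<Rightarrow> ('h, 'r) struct) \<Rightarrow> ('a, 's, 'h, 'r) atlas \<Rightarrow> bool" where
  "is_atlas \<sigma> S C \<AA> \<longleftrightarrow>
     is_structure \<sigma> (atl_str \<AA>) \<and>
     (\<forall>s\<in>S. \<forall>u\<in>dom_sets \<AA> s.
        u \<subseteq> univ (atl_str \<AA>) \<and> charts \<AA> u s \<noteq> {} \<and>
        (\<forall>p\<in>charts \<AA> u s. isomorphism \<sigma> p (induced (atl_str \<AA>) u) (C s))) \<and>
     (\<forall>a\<in>univ (atl_str \<AA>). \<exists>s\<in>S. \<exists>u\<in>dom_sets \<AA> s. a \<in> u) \<and>
     (\<forall>R\<in>syms \<sigma>. \<forall>t\<in>rel (atl_str \<AA>) R. \<exists>s\<in>S. \<exists>u\<in>dom_sets \<AA> s. set t \<subseteq> u)"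

definition single_charted :: "'s set \<Rightarrow> ('a, 's, 'h, 'r) atlas \<Rightarrow> bool" where
  "single_charted S \<AA> \<longleftrightarrow> (\<forall>s\<in>S. \<forall>u\<in>dom_sets \<AA> s. \<exists>!p. p \<in> charts \<AA> u s)"

definition realisation ::
    "'r signature \<Rightarrow> ('h, 's, 'e, 'r) pattern \<Rightarrow> ('a, 's, 'h, 'r) atlas \<Rightarrow> bool" where
  "realisation \<sigma> P \<AA> \<longleftrightarrow>
     is_atlas \<sigma> (sites (inc P)) (part P) \<AA> \<and>
     (\<forall>s\<in>sites (inc P). dom_sets \<AA> s \<noteq> {}) \<and>
     (\<forall>e\<in>links (inc P). \<forall>u\<in>dom_sets \<AA> (src (inc P) e). \<forall>p\<in>charts \<AA> u (src (inc P) e).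
        \<exists>u'\<in>dom_sets \<AA> (tgt (inc P) e). \<exists>p'\<in>charts \<AA> u' (tgt (inc P) e).
          Domain (rho P e) = p `` (u \<inter> u') \<and> rho P e = p\<inverse> O p') \<and>
     (\<forall>s\<in>sites (inc P). \<forall>s'\<in>sites (inc P).
        \<forall>u\<in>dom_sets \<AA> s. \<forall>p\<in>charts \<AA> u s. \<forall>u'\<in>dom_sets \<AA> s'. \<forall>p'\<in>charts \<AA> u' s'.
          u \<inter> u' \<noteq> {} \<longrightarrow>
          (\<exists>w. walk (inc P) s w s' \<and>
             Domain (rho_walk P s w) = p `` (u \<inter> u') \<and> rho_walk P s w = p\<inverse> O p'))"

definition total_closed_walks_trivial :: "('h, 's, 'e, 'r) pattern \<Rightarrow> bool" where
  "total_closed_walks_trivial P \<longleftrightarrow>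
     (\<forall>s w. walk (inc P) s w s \<and> Domain (rho_walk P s w) = univ (part P s) \<longrightarrow>
        rho_walk P s w \<subseteq> Id)"

lemma realisation_chart:
  assumes "realisation \<sigma> P \<AA>" "s \<in> sites (inc P)" "u \<in> dom_sets \<AA> s" "p \<in> charts \<AA> u s"
  shows "u \<subseteq> univ (atl_str \<AA>)" "isomorphism \<sigma> p (induced (atl_str \<AA>) u) (part P s)"
  using assms by (simp_all add: realisation_def is_atlas_def)

lemma realisation_walk:
  assumes P: "amalgamation_pattern \<sigma> P" and R: "realisation \<sigma> P \<AA>"
  shows "walk (inc P) s w s' \<Longrightarrow> s \<in> sites (inc P) \<Longrightarrow> u \<in> dom_sets \<AA> s \<Longrightarrow> p \<in> charts \<AA> u s \<Longrightarrow>
    \<exists>u'\<in>dom_sets \<AA> s'. \<exists>p'\<in>charts \<AA> u' s'. rho_walk P s w \<subseteq> p\<inverse> O p'"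
proof (induction w arbitrary: s u p)
  case Nil
  from realisation_chart(2)[OF R Nil.prems(2-4)]
  have "Range p = univ (part P s)"
    by (simp add: isomorphism_def)
  then have "Id_on (univ (part P s)) \<subseteq> p\<inverse> O p"
    by blast
  with Nil show ?case by auto
next
  case (Cons e w)
  then have e: "e \<in> links (inc P)" "src (inc P) e = s" "walk (inc P) (tgt (inc P) e) w s'"
    by auto
  with P have t: "tgt (inc P) e \<in> sites (inc P)"
    by (simp add: amalgamation_pattern_def incidence_pattern_def)
  have "\<exists>u'\<in>dom_sets \<AA> (tgt (inc P) e). \<exists>p'\<in>charts \<AA> u' (tgt (inc P) e).
      Domain (rho P e) = p `` (u \<inter> u') \<and> rho P e = p\<inverse> O p'"
    using R e(1,2) Cons.prems(3,4) by (simp add: realisation_def)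
  then obtain u1 p1 where 1: "u1 \<in> dom_sets \<AA> (tgt (inc P) e)"
      "p1 \<in> charts \<AA> u1 (tgt (inc P) e)" "rho P e = p\<inverse> O p1"
    by (elim bexE conjE)
  from Cons.IH[OF e(3) t 1(1,2)] obtain u' p' where 2: "u' \<in> dom_sets \<AA> s'" "p' \<in> charts \<AA> u' s'"
      "rho_walk P (tgt (inc P) e) w \<subseteq> p1\<inverse> O p'" by blast
  from realisation_chart(2)[OF R t 1(1,2)] have "single_valued (p1\<inverse>)"
    by (simp add: isomorphism_def)
  then have "p1 O p1\<inverse> \<subseteq> Id"
    unfolding single_valued_def by blast
  have "rho_walk P s (e # w) \<subseteq> (p\<inverse> O p1) O (p1\<inverse> O p')"
    using 1(3) 2(3) by (simp add: relcomp_mono)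
  also have "\<dots> = p\<inverse> O (p1 O p1\<inverse>) O p'"
    by (simp add: O_assoc)
  also have "\<dots> \<subseteq> p\<inverse> O Id O p'"
    by (intro relcomp_mono order_refl) fact
  also have "\<dots> = p\<inverse> O p'"
    by simp
  finally have "rho_walk P s (e # w) \<subseteq> p\<inverse> O p'" .
  with 2 show ?case by blast
qed

lemma single_charted_realisation_total_walks:
  assumes P: "amalgamation_pattern \<sigma> P" "finite_pattern P"
    and R: "realisation \<sigma> P \<AA>" and S: "single_charted (sites (inc P)) \<AA>"
  shows "total_closed_walks_trivial P"
  unfolding total_closed_walks_trivial_def
proof (intro allI impI, elim conjE)
  fix s w
  assume w: "walk (inc P) s w s" and D: "Domain (rho_walk P s w) = univ (part P s)"
  from P(1) have "\<forall>e\<in>links (inc P). src (inc P) e \<in> sites (inc P)"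
    by (simp add: amalgamation_pattern_def incidence_pattern_def)
  with w have s: "s \<in> sites (inc P)"
    by (cases w) auto
  with R have "dom_sets \<AA> s \<noteq> {}"
    by (simp add: realisation_def)
  then obtain u where u: "u \<in> dom_sets \<AA> s"
    by blast
  with S s obtain p where p: "p \<in> charts \<AA> u s"
    unfolding single_charted_def by blast
  from realisation_walk[OF P(1) R w s u p] obtain u' p' where
    u': "u' \<in> dom_sets \<AA> s" "p' \<in> charts \<AA> u' s" "rho_walk P s w \<subseteq> p\<inverse> O p'" by blast
  have dom: "Domain q = v" "Range q = univ (part P s)" "single_valued q" "single_valued (q\<inverse>)"
    if "v \<in> dom_sets \<AA> s" "q \<in> charts \<AA> v s" for v q
    using realisation_chart[OF R s that] by (simp_all add: isomorphism_def induced_def Int_absorb1)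
  have fin: "finite (univ (part P s))"
    using P(2) by (simp add: finite_pattern_def part_def induced_def)
  have card: "finite v \<and> card v = card (univ (part P s))"
    if "v \<in> dom_sets \<AA> s" "q \<in> charts \<AA> v s" for v q
  proof -
    note d = dom[OF that]
    have "inj_on fst q" "inj_on snd q"
      using d(3,4) by (auto simp: inj_on_def single_valued_def)
    moreover have "fst ` q = v" "snd ` q = univ (part P s)"
      using d(1,2) by (auto simp: Domain_fst Range_snd)
    ultimately show ?thesis
      using fin by (metis card_image finite_imageD finite_imageI)
  qed
  have "u \<subseteq> u'"
  proof
    fix x assume "x \<in> u"
    then obtain a where a: "(x, a) \<in> p" using dom(1)[OF u p] by blast
    then have "a \<in> Domain (rho_walk P s w)" using D dom(2)[OF u p] by blast
    then obtain y b where "(y, a) \<in> p" "(y, b) \<in> p'" using u'(3) by blast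
    with a show "x \<in> u'"
      using dom(4)[OF u p] dom(1)[OF u'(1,2)] by (auto simp: single_valued_def)
  qed
  with card[OF u p] card[OF u'(1,2)] have "u = u'"
    by (simp add: card_subset_eq)
  with S s u p u' have "p = p'"
    unfolding single_charted_def by blast
  moreover have "p\<inverse> O p \<subseteq> Id"
    using dom(3)[OF u p] unfolding single_valued_def by blast
  ultimately show "rho_walk P s w \<subseteq> Id"
    using u'(3) by blast
qed

text \<open>
  The condition linking charts, $\pi_{f(u)} = \pi_H \circ \pi_u \circ f^{-1}$, is imposed on sets of
  charts. \<open>H\<close>-rigid symmetries act transitively on charts; for a single-charted atlas this is
  transitivity on $U_s$, and in general it is at least as strong.
\<close>

definition atlas_symmetry ::
    "'r signature \<Rightarrow> ('h, 's, 'e, 'r) pattern \<Rightarrow> ('a, 's, 'h, 'r) atlas \<Rightarrow>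
     ('a \<Rightarrow> 'a) \<Rightarrow> ('s \<Rightarrow> 's) \<Rightarrow> ('e \<Rightarrow> 'e) \<Rightarrow> ('h \<Rightarrow> 'h) \<Rightarrow> bool" where
  "atlas_symmetry \<sigma> P \<AA> f \<pi>S \<pi>E \<pi>H \<longleftrightarrow>
     isomorphism \<sigma> (graph_on f (univ (atl_str \<AA>))) (atl_str \<AA>) (atl_str \<AA>) \<and>
     pattern_symmetry \<sigma> P \<pi>S \<pi>E \<pi>H \<and>
     (\<forall>s\<in>sites (inc P).
        bij_betw ((`) f) (dom_sets \<AA> s) (dom_sets \<AA> (\<pi>S s)) \<and>
        (\<forall>u\<in>dom_sets \<AA> s.
           charts \<AA> (f ` u) (\<pi>S s) = (\<lambda>p. map_prod f \<pi>H ` p) ` charts \<AA> u s))"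

definition rigid_symmetry ::
    "'r signature \<Rightarrow> ('h, 's, 'e, 'r) pattern \<Rightarrow> ('a, 's, 'h, 'r) atlas \<Rightarrow> ('a \<Rightarrow> 'a) \<Rightarrow> bool" where
  "rigid_symmetry \<sigma> P \<AA> f \<longleftrightarrow> atlas_symmetry \<sigma> P \<AA> f id id id"

definition fully_symmetric ::
    "'r signature \<Rightarrow> ('h, 's, 'e, 'r) pattern \<Rightarrow> ('a, 's, 'h, 'r) atlas \<Rightarrow> bool" where
  "fully_symmetric \<sigma> P \<AA> \<longleftrightarrow>
     (\<forall>\<pi>S \<pi>E \<pi>H. pattern_symmetry \<sigma> P \<pi>S \<pi>E \<pi>H \<longrightarrow> (\<exists>f. atlas_symmetry \<sigma> P \<AA> f \<pi>S \<pi>E \<pi>H)) \<and>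
     (\<forall>s\<in>sites (inc P).
        \<forall>u\<in>dom_sets \<AA> s. \<forall>p\<in>charts \<AA> u s. \<forall>u'\<in>dom_sets \<AA> s. \<forall>p'\<in>charts \<AA> u' s.
          \<exists>f. rigid_symmetry \<sigma> P \<AA> f \<and> f ` u = u' \<and> map_prod f id ` p = p')"

section \<open>Coverings\<close>

definition pattern_hom ::
    "'r signature \<Rightarrow> ('h2, 's2, 'e2, 'r) pattern \<Rightarrow> ('h1, 's1, 'e1, 'r) pattern \<Rightarrow>
     ('s2 \<Rightarrow> 's1) \<Rightarrow> ('e2 \<Rightarrow> 'e1) \<Rightarrow> ('h2 \<Rightarrow> 'h1) \<Rightarrow> bool" where
  "pattern_hom \<sigma> P2 P1 \<pi>S \<pi>E \<pi>H \<longleftrightarrow>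
     amalgamation_pattern \<sigma> P2 \<and> amalgamation_pattern \<sigma> P1 \<and>
     \<pi>S ` sites (inc P2) \<subseteq> sites (inc P1) \<and>
     \<pi>E ` links (inc P2) \<subseteq> links (inc P1) \<and>
     \<pi>H ` univ (str P2) \<subseteq> univ (str P1) \<and>
     (\<forall>a\<in>univ (str P2). delta P1 (\<pi>H a) = \<pi>S (delta P2 a)) \<and>
     (\<forall>e\<in>links (inc P2).
        src (inc P1) (\<pi>E e) = \<pi>S (src (inc P2) e) \<and>
        tgt (inc P1) (\<pi>E e) = \<pi>S (tgt (inc P2) e) \<and>
        linv (inc P1) (\<pi>E e) = \<pi>E (linv (inc P2) e)) \<and>
     (\<forall>s\<in>sites (inc P2).
        isomorphism \<sigma> (graph_on \<pi>H (univ (part P2 s))) (part P2 s) (part P1 (\<pi>S s))) \<and>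
     (\<forall>e\<in>links (inc P2). rho P1 (\<pi>E e) = map_prod \<pi>H \<pi>H ` rho P2 e)"

definition covering ::
    "'r signature \<Rightarrow> ('h2, 's2, 'e2, 'r) pattern \<Rightarrow> ('h1, 's1, 'e1, 'r) pattern \<Rightarrow>
     ('s2 \<Rightarrow> 's1) \<Rightarrow> ('e2 \<Rightarrow> 'e1) \<Rightarrow> ('h2 \<Rightarrow> 'h1) \<Rightarrow> bool" where
  "covering \<sigma> P2 P1 \<pi>S \<pi>E \<pi>H \<longleftrightarrow>
     pattern_hom \<sigma> P2 P1 \<pi>S \<pi>E \<pi>H \<and>
     \<pi>S ` sites (inc P2) = sites (inc P1) \<and>
     \<pi>E ` links (inc P2) = links (inc P1) \<and>
     \<pi>H ` univ (str P2) = univ (str P1) \<and>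
     (\<forall>s\<in>sites (inc P2). \<forall>e\<in>links (inc P1). src (inc P1) e = \<pi>S s \<longrightarrow>
        (\<exists>e'\<in>links (inc P2). src (inc P2) e' = s \<and> \<pi>E e' = e))"

section \<open>Groupoids\<close>

record ('g, 's, 'e) groupoid =
  arrows :: "'g set"
  gsrc :: "'g \<Rightarrow> 's"
  gtgt :: "'g \<Rightarrow> 's"
  gcomp :: "'g \<Rightarrow> 'g \<Rightarrow> 'g"
  gunit :: "'s \<Rightarrow> 'g"
  ginv :: "'g \<Rightarrow> 'g"
  gen :: "'e \<Rightarrow> 'g"

definition hom_set :: "('g, 's, 'e) groupoid \<Rightarrow> 's \<Rightarrow> 's \<Rightarrow> 'g set" where
  "hom_set G s s' = {g \<in> arrows G. gsrc G g = s \<and> gtgt G g = s'}"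

text \<open>The second argument is the site at which the walk starts.\<close>

fun walk_val :: "('s, 'e) incidence \<Rightarrow> ('g, 's, 'e) groupoid \<Rightarrow> 's \<Rightarrow> 'e list \<Rightarrow> 'g" where
  "walk_val I G s [] = gunit G s"
| "walk_val I G s (e # w) = gcomp G (gen G e) (walk_val I G (tgt I e) w)"

definition is_groupoid :: "('s, 'e) incidence \<Rightarrow> ('g, 's, 'e) groupoid \<Rightarrow> bool" where
  "is_groupoid I G \<longleftrightarrow>
     (\<forall>g\<in>arrows G. gsrc G g \<in> sites I \<and> gtgt G g \<in> sites I) \<and>
     (\<forall>g\<in>arrows G. \<forall>h\<in>arrows G. gtgt G g = gsrc G h \<longrightarrow>
        gcomp G g h \<in> hom_set G (gsrc G g) (gtgt G h)) \<and>
     (\<forall>g\<in>arrows G. \<forall>h\<in>arrows G. \<forall>k\<in>arrows G. gtgt G g = gsrc G h \<and> gtgt G h = gsrc G k \<longrightarrow>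
        gcomp G (gcomp G g h) k = gcomp G g (gcomp G h k)) \<and>
     (\<forall>s\<in>sites I. gunit G s \<in> hom_set G s s) \<and>
     (\<forall>g\<in>arrows G. gcomp G (gunit G (gsrc G g)) g = g \<and> gcomp G g (gunit G (gtgt G g)) = g) \<and>
     (\<forall>g\<in>arrows G. ginv G g \<in> hom_set G (gtgt G g) (gsrc G g) \<and>
        gcomp G g (ginv G g) = gunit G (gsrc G g) \<and>
        gcomp G (ginv G g) g = gunit G (gtgt G g)) \<and>
     (\<forall>e\<in>links I. gen G e \<in> hom_set G (src I e) (tgt I e) \<and>
        gen G (linv I e) = ginv G (gen G e)) \<and>
     (\<forall>g\<in>arrows G. \<exists>s w s'. walk I s w s' \<and> g = walk_val I G s w)"

text \<open>A walk whose value is \<open>1\<^sub>s\<close> necessarily leads from \<open>s\<close> to \<open>s\<close>.\<close>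

definition compatible :: "('g, 's, 'e) groupoid \<Rightarrow> ('h, 's, 'e, 'r) pattern \<Rightarrow> bool" where
  "compatible G P \<longleftrightarrow>
     (\<forall>s w. walk (inc P) s w s \<and> walk_val (inc P) G s w = gunit G s \<longrightarrow>
        rho_walk P s w \<subseteq> Id_on (univ (part P s)))"

definition link_closed :: "('s, 'e) incidence \<Rightarrow> 'e set \<Rightarrow> bool" where
  "link_closed I \<alpha> \<longleftrightarrow> \<alpha> \<subseteq> links I \<and> linv I ` \<alpha> = \<alpha>"

definition subgroupoid :: "('s, 'e) incidence \<Rightarrow> ('g, 's, 'e) groupoid \<Rightarrow> 'e set \<Rightarrow> 'g set" where
  "subgroupoid I G \<alpha> = {walk_val I G s w | s w. (\<exists>s'. walk I s w s') \<and> set w \<subseteq> \<alpha>}"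

definition gcoset ::
    "('s, 'e) incidence \<Rightarrow> ('g, 's, 'e) groupoid \<Rightarrow> 'g \<Rightarrow> 'e set \<Rightarrow> 'g set" where
  "gcoset I G g \<alpha> = {gcomp G g h | h. h \<in> subgroupoid I G \<alpha> \<and> gsrc G h = gtgt G g}"

text \<open>
  The index set \<open>\<int>\<^sub>n\<close> is \<open>{..<n}\<close>, where \<open>(i + 1) mod n\<close> and \<open>(i + n - 1) mod n\<close> are the successor
  and the predecessor of \<open>i\<close>.
\<close>

definition coset_cycle ::
    "('s, 'e) incidence \<Rightarrow> ('g, 's, 'e) groupoid \<Rightarrow> nat \<Rightarrow> (nat \<Rightarrow> 'g) \<Rightarrow> (nat \<Rightarrow> 'e set) \<Rightarrow> bool" where
  "coset_cycle I G n g \<alpha> \<longleftrightarrow>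
     2 \<le> n \<and>
     (\<forall>i<n. g i \<in> arrows G \<and> link_closed I (\<alpha> i) \<and>
        g ((i + 1) mod n) \<in> gcoset I G (g i) (\<alpha> i) \<and>
        gcoset I G (g i) (\<alpha> i \<inter> \<alpha> ((i + n - 1) mod n)) \<inter>
        gcoset I G (g ((i + 1) mod n)) (\<alpha> i \<inter> \<alpha> ((i + 1) mod n)) = {})"

definition acyclic_up_to :: "nat \<Rightarrow> ('s, 'e) incidence \<Rightarrow> ('g, 's, 'e) groupoid \<Rightarrow> bool" where
  "acyclic_up_to N I G \<longleftrightarrow> (\<forall>n g \<alpha>. 2 \<le> n \<and> n \<le> N \<longrightarrow> \<not> coset_cycle I G n g \<alpha>)"

section \<open>Direct and reduced products\<close>

text \<open>The link \<open>e[g]\<close> is the pair \<open>(e, g)\<close>.\<close>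

definition product_incidence ::
    "('s, 'e) incidence \<Rightarrow> ('g, 's, 'e) groupoid \<Rightarrow> ('g, 'e \<times> 'g) incidence" where
  "product_incidence I G =
     \<lparr>sites = arrows G,
      links = {(e, g). e \<in> links I \<and> g \<in> arrows G \<and> gtgt G g = src I e},
      src = (\<lambda>(e, g). g),
      tgt = (\<lambda>(e, g). gcomp G g (gen G e)),
      linv = (\<lambda>(e, g). (linv I e, gcomp G g (gen G e)))\<rparr>"

definition direct_product ::
    "('h, 's, 'e, 'r) pattern \<Rightarrow> ('g, 's, 'e) groupoid \<Rightarrow> ('h \<times> 'g, 'g, 'e \<times> 'g, 'r) pattern" where
  "direct_product P G =
     \<lparr>inc = product_incidence (inc P) G,
      str =
        \<lparr>univ = {(a, g). a \<in> univ (str P) \<and> g \<in> arrows G \<and> delta P a = gtgt G g},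
         rel = (\<lambda>R. {map (\<lambda>a. (a, g)) t | t g. g \<in> arrows G \<and> t \<in> rel (part P (gtgt G g)) R})\<rparr>,
      delta = snd,
      rho = (\<lambda>(e, g). {((a, g), (b, gcomp G g (gen G e))) | a b. (a, b) \<in> rho P e})\<rparr>"

definition cls ::
    "('h, 's, 'e, 'r) pattern \<Rightarrow> ('g, 's, 'e) groupoid \<Rightarrow> 'h \<times> 'g \<Rightarrow> ('h \<times> 'g) set" where
  "cls P G x = approx (direct_product P G) `` {x}"

definition red_dom ::
    "('h, 's, 'e, 'r) pattern \<Rightarrow> ('g, 's, 'e) groupoid \<Rightarrow> 'g \<Rightarrow> ('h \<times> 'g) set set" where
  "red_dom P G g = {cls P G (a, g) | a. a \<in> univ (part P (gtgt G g))}"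

definition red_chart ::
    "('h, 's, 'e, 'r) pattern \<Rightarrow> ('g, 's, 'e) groupoid \<Rightarrow> 'g \<Rightarrow> (('h \<times> 'g) set \<times> 'h) set" where
  "red_chart P G g = {(cls P G (a, g), a) | a. a \<in> univ (part P (gtgt G g))}"

definition reduced_product ::
    "('h, 's, 'e, 'r) pattern \<Rightarrow> ('g, 's, 'e) groupoid \<Rightarrow> (('h \<times> 'g) set, 's, 'h, 'r) atlas" where
  "reduced_product P G =
     \<lparr>atl_str =
        \<lparr>univ = univ (str (direct_product P G)) // approx (direct_product P G),
         rel = (\<lambda>R. map (cls P G) ` rel (str (direct_product P G)) R)\<rparr>,
      dom_sets = (\<lambda>s. {red_dom P G g | g. g \<in> arrows G \<and> gtgt G g = s}),
      charts = (\<lambda>u s. {red_chart P G g | g. g \<in> arrows G \<and> gtgt G g = s \<and> red_dom P G g = u})\<rparr>"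

end

theory Submission
  imports Defs "HOL-Combinatorics.Permutations"
begin

text \<open>
  Words over a finite set of involutive letters are taken modulo kernels which are built in stages:
  the kernel of stage \<open>k + 1\<close> consists of the words which act trivially in all actions on a
  sufficiently large finite set that respect the relations of stage \<open>k\<close> between words with at most
  \<open>k\<close> letters. The quotient group is finite, it admits all permutations of the letters, and
  deleting letters is a retraction, so that subgroups generated by sets of letters intersect as
  they should. Any sufficiently small action passes as soon as it does so for words over few
  letters. For a chain of cosets glued along its overlaps this yields \<open>N\<close>-acyclicity; for a graph
  whose edges are letters, with one component replaced by a Schreier graph, it shows that
  a walk whose value is also the value of a word over a set \<open>\<gamma>\<close> of letters can be replaced by a
  walk over \<open>\<gamma>\<close>.

  Letters are the links of a finite cover of \<open>\<I>\<close>, in which the end point of the lift of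
  a walk \<open>w\<close> determines the values of \<open>\<rho>\<^sub>w\<close>. The groupoid consists of the walks of \<open>\<I>\<close> modulo the
  values of their lifts. Whether \<open>\<rho>\<^sub>w\<close> is defined at \<open>a\<close> only depends on the set of letters
  of the lift of \<open>w\<close>; hence two walks of the same value can be replaced by a walk over the
  intersection of the corresponding sets of letters, which is strong coherence. Simplicity is the
  case of a single letter.
\<close>

section \<open>Words modulo a kernel\<close>

text \<open>A test whose size is measured by the group cannot be imposed on that group without
  enlarging it. The stages break this circle. Subgroups on at most \<open>k\<close> letters are
  frozen from stage \<open>k\<close> on; a test glued from at most \<open>c\<close> pieces of such
  subgroups therefore has at most \<open>c\<close> times as many classes as stage \<open>k\<close>
  has group elements, and precisely the actions of this degree enter stage \<open>k + 1\<close>. The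
  constant allows for \<open>N\<close> cosets in a chain and for all vertices of the cover as
  starting points of Schreier graphs. Links of the given pattern would be too coarse as letters:
  whether a link can be crossed depends on where along the walk it is used. At a vertex of the cover
  the image of an element, if there is one, is fixed, so that being crossed is a property of the
  letter and the element. Full symmetry forbids arbitrary choices. The kernels depend on the set of
  letters and on \<open>c\<close> only, and the partial isomorphisms are extended to permutations
  canonically; hence symmetries of the pattern act on the cover, on its letters and on the quotient
  group.\<close>

definition eqw :: "'l list set \<Rightarrow> ('l list \<times> 'l list) set" where
  "eqw K = {(u, v). u @ rev v \<in> K}"

text \<open>\<open>K\<close> is the set of words with value 1 in a finite group generated by
  involutions; \<open>ins\<close> stands for normality and closure under products. Letters outside
  of \<open>L\<close> have value 1, so that words need not be restricted to \<open>L\<close>. By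
  \<open>retract\<close>, killing a set of letters is an endomorphism of the group.\<close>

locale word_kernel =
  fixes L :: "'l set" and K :: "'l list set"
  assumes finite_letters: "finite L"
    and nil: "[] \<in> K"
    and ins: "v \<in> K \<Longrightarrow> u @ v @ w \<in> K \<longleftrightarrow> u @ w \<in> K"
    and square: "[x, x] \<in> K"
    and out: "x \<notin> L \<Longrightarrow> [x] \<in> K"
    and retract: "u \<in> K \<Longrightarrow> filter (\<lambda>x. x \<in> \<eta>) u \<in> K"
    and perm: "u \<in> K \<Longrightarrow> set u \<subseteq> L \<Longrightarrow> bij_betw \<pi> L L \<Longrightarrow> map \<pi> u \<in> K"
    and finite_index: "finite (UNIV // eqw K)"
begin

text \<open>Letters are their own inverses, hence \<open>rev v\<close> is the inverse of
  \<open>v\<close>.\<close>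

definition eqv :: "'l list \<Rightarrow> 'l list \<Rightarrow> bool" (infix "\<approx>" 50) where
  "u \<approx> v \<longleftrightarrow> u @ rev v \<in> K"

lemma ins1: "v \<in> K \<Longrightarrow> v @ w \<in> K \<longleftrightarrow> w \<in> K"
  using ins[of v "[]" w] by simp

lemma app_rev: "u @ rev u \<in> K"
proof (induction u rule: rev_induct)
  case (snoc x u)
  then show ?case using ins[OF square[of x], of u "rev u"] by simp
qed (simp add: nil)

lemma rev_app: "rev u @ u \<in> K"
  using app_rev[of "rev u"] by simp

lemma rev_in: "u \<in> K \<Longrightarrow> rev u \<in> K"
  using app_rev ins1 by blast

lemma eqv_refl [simp]: "u \<approx> u"
  by (simp add: eqv_def app_rev)

lemma eqv_sym: "u \<approx> v \<Longrightarrow> v \<approx> u"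
  unfolding eqv_def using rev_in by fastforce

lemma eqv_trans [trans]: "u \<approx> v \<Longrightarrow> v \<approx> w \<Longrightarrow> u \<approx> w"
  unfolding eqv_def
proof -
  assume 1: "u @ rev v \<in> K" and 2: "v @ rev w \<in> K"
  have "u @ (rev v @ v) @ rev w \<in> K" using 1 2 ins1[OF 1, of "v @ rev w"] by simp
  then show "u @ rev w \<in> K" using ins[OF rev_app[of v], of u "rev w"] by simp
qed

lemma eqv_nil: "u \<approx> [] \<longleftrightarrow> u \<in> K"
  by (simp add: eqv_def)

lemma eqv_app: "u \<approx> u' \<Longrightarrow> v \<approx> v' \<Longrightarrow> u @ v \<approx> u' @ v'"
proof -
  assume 1: "u \<approx> u'" and 2: "v \<approx> v'"
  have "u @ v \<approx> u @ v'"
    using 2 ins[of "v @ rev v'" u "rev u"] app_rev[of u] by (simp add: eqv_def)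
  also have "u @ v' \<approx> u' @ v'"
    using 1 ins[of "v' @ rev v'" u "rev u'"] app_rev[of v'] by (simp add: eqv_def)
  finally show ?thesis .
qed

lemma eqv_app1: "u \<approx> u' \<Longrightarrow> u @ v \<approx> u' @ v"
  by (simp add: eqv_app)

lemma eqv_app2: "v \<approx> v' \<Longrightarrow> u @ v \<approx> u @ v'"
  by (simp add: eqv_app)

lemma eqv_cancel_left: "u @ v \<approx> u @ v' \<longleftrightarrow> v \<approx> v'"
proof
  assume "u @ v \<approx> u @ v'"
  then have "rev u @ u @ v \<approx> rev u @ u @ v'" by (rule eqv_app2)
  moreover have "rev u @ u @ x \<approx> x" for x
    using eqv_app1[of "rev u @ u" "[]" x] by (simp add: eqv_nil rev_app)
  ultimately show "v \<approx> v'" by (meson eqv_sym eqv_trans)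
qed (rule eqv_app2)

lemma eqv_move_left: "u @ v \<approx> w \<longleftrightarrow> v \<approx> rev u @ w"
proof -
  have "u @ rev u @ w \<approx> w"
    using eqv_app1[of "u @ rev u" "[]" w] by (simp add: eqv_nil app_rev)
  then have "u @ v \<approx> w \<longleftrightarrow> u @ v \<approx> u @ rev u @ w" by (meson eqv_sym eqv_trans)
  then show ?thesis by (simp add: eqv_cancel_left)
qed

lemma eqv_cancel_right: "v @ u \<approx> v' @ u \<longleftrightarrow> v \<approx> v'"
proof
  assume "v @ u \<approx> v' @ u"
  then have "(v @ u) @ rev u \<approx> (v' @ u) @ rev u" by (rule eqv_app1)
  moreover have "(x @ u) @ rev u \<approx> x" for x
    using eqv_app2[of "u @ rev u" "[]" x] by (simp add: eqv_nil app_rev)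
  ultimately show "v \<approx> v'" by (meson eqv_sym eqv_trans)
qed (rule eqv_app1)

lemma eqv_move_right: "v @ u \<approx> w \<longleftrightarrow> v \<approx> w @ rev u"
proof -
  have "(w @ rev u) @ u \<approx> w"
    using eqv_app2[of "rev u @ u" "[]" w] by (simp add: eqv_nil rev_app)
  then have "v @ u \<approx> w \<longleftrightarrow> v @ u \<approx> (w @ rev u) @ u" by (meson eqv_sym eqv_trans)
  then show ?thesis by (simp only: eqv_cancel_right)
qed

lemma eqv_filter: "u \<approx> v \<Longrightarrow> filter (\<lambda>x. x \<in> \<eta>) u \<approx> filter (\<lambda>x. x \<in> \<eta>) v"
  unfolding eqv_def using retract[of "u @ rev v" \<eta>] by (simp add: rev_filter)

lemma eqv_map: "u \<approx> v \<Longrightarrow> set u \<subseteq> L \<Longrightarrow> set v \<subseteq> L \<Longrightarrow> bij_betw \<pi> L L \<Longrightarrow> map \<pi> u \<approx> map \<pi> v"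
  unfolding eqv_def using perm[of "u @ rev v" \<pi>] by (simp add: rev_map)

text \<open>The retraction to \<beta> fixes \<open>v\<close>, hence up to equivalence also
  \<open>u\<close>, and it turns \<open>u\<close> into a word over the common letters. So subgroups
  generated by letters intersect in the subgroup generated by the common letters.\<close>

lemma eqv_inter:
  assumes "u \<approx> v" "set u \<subseteq> \<alpha>" "set v \<subseteq> \<beta>"
  shows "\<exists>w. set w \<subseteq> \<alpha> \<inter> \<beta> \<and> w \<approx> u"
proof -
  have "filter (\<lambda>x. x \<in> \<beta>) v = v" using assms(3) by (auto simp: filter_id_conv)
  then have "filter (\<lambda>x. x \<in> \<beta>) u \<approx> v" using eqv_filter[OF assms(1), of \<beta>] by simp
  then have "filter (\<lambda>x. x \<in> \<beta>) u \<approx> u" using assms(1) eqv_sym eqv_trans by blast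
  moreover have "set (filter (\<lambda>x. x \<in> \<beta>) u) \<subseteq> \<alpha> \<inter> \<beta>" using assms(2) by auto
  ultimately show ?thesis by blast
qed

lemma eqw_iff: "(u, v) \<in> eqw K \<longleftrightarrow> u \<approx> v"
  by (simp add: eqw_def eqv_def)

lemma equiv_eqw: "equiv UNIV (eqw K)"
  by (auto simp: equiv_def refl_on_def sym_def trans_def eqw_iff intro: eqv_sym eqv_trans)

end

section \<open>Finite actions by involutions and their kernels\<close>

definition involutive_action :: "'l set \<Rightarrow> nat \<Rightarrow> ('l \<Rightarrow> nat \<Rightarrow> nat) \<Rightarrow> bool" where
  "involutive_action L M a \<longleftrightarrow>
     (\<forall>x. \<forall>i<M. a x i < M \<and> a x (a x i) = i \<and> (x \<notin> L \<longrightarrow> a x i = i))"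

lemma fold_action_less:
  "involutive_action L M a \<Longrightarrow> i < M \<Longrightarrow> fold a w i < M"
  by (induction w arbitrary: i) (auto simp: involutive_action_def)

lemma fold_action_involutive:
  assumes "involutive_action L M a" "i < M"
  shows "fold a (rev w) (fold a w i) = i"
  using assms
proof (induction w arbitrary: i)
  case (Cons x w)
  then have "a x i < M" by (auto simp: involutive_action_def)
  then have "fold a (rev w) (fold a w (a x i)) = a x i" using Cons by blast
  then show ?case using Cons.prems by (auto simp: involutive_action_def)
qed simp

lemma finite_range_factor:
  assumes "finite (range f)" "\<And>u v. f u = f v \<Longrightarrow> h u = h v"
  shows "finite (range h)"
proof -
  have "range h \<subseteq> (\<lambda>y. h (SOME u. f u = y)) ` range f"
  proof
    fix z assume "z \<in> range h"
    then obtain u where u: "z = h u" by blast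
    have "f (SOME v. f v = f u) = f u" by (rule someI) (rule refl)
    then have "h (SOME v. f v = f u) = h u" by (rule assms(2))
    then show "z \<in> (\<lambda>y. h (SOME u. f u = y)) ` range f" using u by (metis image_eqI rangeI)
  qed
  then show ?thesis using assms(1) finite_subset by blast
qed

definition kernel_of :: "nat \<Rightarrow> ('l \<Rightarrow> nat \<Rightarrow> nat) set \<Rightarrow> 'l list set" where
  "kernel_of M A = {w. \<forall>a\<in>A. \<forall>i<M. fold a w i = i}"

lemma eqw_kernel_of:
  assumes "\<And>a. a \<in> A \<Longrightarrow> involutive_action L M a"
  shows "(u, v) \<in> eqw (kernel_of M A) \<longleftrightarrow> (\<forall>a\<in>A. \<forall>i<M. fold a u i = fold a v i)"
proof -
  have "fold a (u @ rev v) i = i \<longleftrightarrow> fold a u i = fold a v i" if "a \<in> A" "i < M" for a i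
  proof -
    have 1: "fold a (rev v) (fold a v i) = i" and
      2: "fold a v (fold a (rev v) (fold a u i)) = fold a u i"
      using fold_action_involutive[OF assms[OF that(1)], of i v]
        fold_action_involutive[OF assms[OF that(1)], of "fold a u i" "rev v"]
        fold_action_less[OF assms[OF that(1)], of i u] that(2) by auto
    show ?thesis using 1 2 by auto
  qed
  then show ?thesis by (auto simp: eqw_def kernel_of_def)
qed

text \<open>There are only finitely many actions on \<open>{..<M}\<close>, so that the kernel has finite index.\<close>

lemma finite_index_kernel_of:
  assumes L: "finite L" and A: "\<And>a. a \<in> A \<Longrightarrow> involutive_action L M a"
  shows "finite (UNIV // eqw (kernel_of M A))"
proof -
  \<comment> \<open>Off the relevant arguments the values are set to 0, which leaves only the finite
    set \<open>F\<close> of tables; \<open>den\<close> turns a table back into an action that agrees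
    with the original one below \<open>M\<close>.\<close>
  define nrm where "nrm a = (\<lambda>(x, i). if x \<in> L \<and> i < M then a x i else 0)"
    for a :: "'a \<Rightarrow> nat \<Rightarrow> nat"
  define F where "F = {f. (\<forall>p. (p \<in> L \<times> {..<M} \<longrightarrow> f p \<in> {..<M}) \<and> (p \<notin> L \<times> {..<M} \<longrightarrow> f p = (0::nat)))}"
  have F: "finite F"
    unfolding F_def by (rule finite_set_of_finite_funs) (use L in auto)
  define den where "den f x i = (if x \<in> L then f (x, i) else i)" for f :: "'a \<times> nat \<Rightarrow> nat" and x i
  \<comment> \<open>The effect of \<open>w\<close> in all tables at all points. The guard makes the
    bound on the values immediate.\<close>
  define sg where "sg w = (\<lambda>p. if p \<in> F \<times> {..<M} \<and> fold (den (fst p)) w (snd p) < M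
      then fold (den (fst p)) w (snd p) else 0)" for w :: "'a list"
  have fin: "finite (range sg)"
  proof (rule finite_subset)
    show "range sg \<subseteq> {g. (\<forall>p. (p \<in> F \<times> {..<M} \<longrightarrow> g p \<in> {..M}) \<and> (p \<notin> F \<times> {..<M} \<longrightarrow> g p = 0))}"
      by (auto simp: sg_def)
    show "finite \<dots>"
      by (rule finite_set_of_finite_funs) (use F in auto)
  qed
  have "finite (range (\<lambda>w. eqw (kernel_of M A) `` {w}))"
  proof (rule finite_range_factor[OF fin])
    fix u v assume uv: "sg u = sg v"
    have "fold a u i = fold a v i" if aA: "a \<in> A" and i: "i < M" for a i
    proof -
      note a = A[OF aA]
      have f: "nrm a \<in> F" using a by (auto simp: F_def nrm_def involutive_action_def)
      have eq: "fold (den (nrm a)) w j = fold a w j" if "j < M" for w j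
        using that
      proof (induction w arbitrary: j)
        case (Cons x w)
        have "den (nrm a) x j = a x j"
          using a Cons.prems by (auto simp: den_def nrm_def involutive_action_def)
        moreover have "a x j < M" using a Cons.prems by (auto simp: involutive_action_def)
        ultimately show ?case using Cons.IH by simp
      qed simp
      have "fold a w i < M" for w using a i fold_action_less by blast
      then have "sg w (nrm a, i) = fold a w i" for w using f i eq[OF i] by (simp add: sg_def)
      then show "fold a u i = fold a v i" using uv by metis
    qed
    then show "eqw (kernel_of M A) `` {u} = eqw (kernel_of M A) `` {v}"
      by (auto simp: eqw_kernel_of[OF A])
  qed
  moreover have "UNIV // eqw (kernel_of M A) = range (\<lambda>w. eqw (kernel_of M A) `` {w})"
    by (auto simp: quotient_def)
  ultimately show ?thesis by simp
qed

section \<open>The stages of the kernel\<close>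

definition admissible :: "'l set \<Rightarrow> nat \<Rightarrow> nat \<Rightarrow> 'l list set \<Rightarrow> ('l \<Rightarrow> nat \<Rightarrow> nat) set" where
  "admissible L M k K = {a. involutive_action L M a \<and>
     (\<forall>\<beta> z. \<beta> \<subseteq> L \<and> card \<beta> \<le> k \<and> set z \<subseteq> \<beta> \<and> z \<in> K \<longrightarrow> (\<forall>i<M. fold a z i = i))}"

text \<open>
  An action is admissible at stage \<open>k\<close> if it does not add anything to the relations of the
  previous stage on words with at most \<open>k\<close> letters; the next stage takes all of them at once.
\<close>

primrec ker :: "'l set \<Rightarrow> nat \<Rightarrow> nat \<Rightarrow> 'l list set" where
  "ker L c 0 = UNIV"
| "ker L c (Suc k) =
    (let M = c * card (UNIV // eqw (ker L c k)) in kernel_of M (admissible L M k (ker L c k)))"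

text \<open>Stage 0 is the trivial group, which starts the induction over the stages.\<close>

lemma word_kernel_UNIV: "finite L \<Longrightarrow> word_kernel L UNIV"
proof
  have "UNIV // eqw (UNIV :: 'a list set) = {UNIV}"
    by (auto simp: eqw_def quotient_def)
  then show "finite (UNIV // eqw (UNIV :: 'a list set))" by simp
qed auto

text \<open>Admissible actions are closed under switching off letters and under renaming letters by
  a permutation of \<open>L\<close>. Words that are trivial in all of them inherit
  \<open>retract\<close> and \<open>perm\<close> from this.\<close>

lemma word_kernel_admissible:
  assumes "word_kernel L K"
  shows "word_kernel L (kernel_of M (admissible L M k K))"
proof -
  interpret word_kernel L K by fact
  let ?A = "admissible L M k K"
  have inv: "involutive_action L M a" if "a \<in> ?A" for a
    using that by (simp add: admissible_def)
  show ?thesis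
  proof
    show "finite L" by (rule finite_letters)
    show "[] \<in> kernel_of M ?A" by (simp add: kernel_of_def)
    show "u @ v @ w \<in> kernel_of M ?A \<longleftrightarrow> u @ w \<in> kernel_of M ?A" if "v \<in> kernel_of M ?A" for u v w
    proof -
      have "fold a (u @ v @ w) i = fold a (u @ w) i" if "a \<in> ?A" "i < M" for a i
        using \<open>v \<in> kernel_of M ?A\<close> fold_action_less[OF inv[OF that(1)] that(2), of u] that(1)
        by (simp add: kernel_of_def)
      then show ?thesis by (simp add: kernel_of_def)
    qed
    show "[x, x] \<in> kernel_of M ?A" for x
    proof -
      have "a x (a x i) = i" if "a \<in> ?A" "i < M" for a i
        using inv[OF that(1)] that(2) unfolding involutive_action_def by blast
      then show ?thesis by (simp add: kernel_of_def)
    qed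
    show "[x] \<in> kernel_of M ?A" if "x \<notin> L" for x
    proof -
      have "a x i = i" if "a \<in> ?A" "i < M" for a i
        using inv[OF that(1)] that(2) \<open>x \<notin> L\<close> unfolding involutive_action_def by blast
      then show ?thesis by (simp add: kernel_of_def)
    qed
    show "finite (UNIV // eqw (kernel_of M ?A))"
      using finite_letters inv by (rule finite_index_kernel_of)
    show "filter (\<lambda>x. x \<in> \<eta>) u \<in> kernel_of M ?A" if u: "u \<in> kernel_of M ?A" for u \<eta>
    proof -
      have "fold a (filter (\<lambda>x. x \<in> \<eta>) u) i = i" if a: "a \<in> ?A" and i: "i < M" for a i
      proof -
        \<comment> \<open>Letters outside of \<eta> are switched off. The result is admissible since
          deleting letters keeps a word in \<open>K\<close> and adds no letter.\<close>
        define b where "b x = (if x \<in> \<eta> then a x else id)" for x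
        have b: "fold b z j = fold a (filter (\<lambda>x. x \<in> \<eta>) z) j" for z j
          by (induction z arbitrary: j) (auto simp: b_def)
        have "b \<in> ?A"
          unfolding admissible_def
        proof (intro CollectI conjI allI impI)
          show "involutive_action L M b" using inv[OF a] by (auto simp: b_def involutive_action_def)
          fix \<beta> z i assume "\<beta> \<subseteq> L \<and> card \<beta> \<le> k \<and> set z \<subseteq> \<beta> \<and> z \<in> K" "i < M"
          moreover from this have "set (filter (\<lambda>x. x \<in> \<eta>) z) \<subseteq> \<beta>" by auto
          ultimately show "fold b z i = i"
            using a retract[of z \<eta>] unfolding admissible_def b by blast
        qed
        then show ?thesis using u i b by (auto simp: kernel_of_def)
      qed
      then show ?thesis by (simp add: kernel_of_def)
    qed
    show "map \<pi> u \<in> kernel_of M ?A"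
      if u: "u \<in> kernel_of M ?A" "set u \<subseteq> L" and \<pi>: "bij_betw \<pi> L L" for u \<pi>
    proof -
      have "fold a (map \<pi> u) i = i" if a: "a \<in> ?A" and i: "i < M" for a i
      proof -
        \<comment> \<open>The renaming is controlled on \<open>L\<close> only; other letters have to
          act trivially anyway.\<close>
        define b where "b x = (if x \<in> L then a (\<pi> x) else id)" for x
        have b: "fold b z j = fold a (map \<pi> z) j" if "set z \<subseteq> L" for z j
          using that by (induction z arbitrary: j) (auto simp: b_def)
        have "b \<in> ?A"
          unfolding admissible_def
        proof (intro CollectI conjI allI impI)
          show "involutive_action L M b" using inv[OF a] by (auto simp: b_def involutive_action_def)
          fix \<beta> z i assume z: "\<beta> \<subseteq> L \<and> card \<beta> \<le> k \<and> set z \<subseteq> \<beta> \<and> z \<in> K" and i: "i < M"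
          have "\<pi> ` \<beta> \<subseteq> L" using \<pi> z by (auto simp: bij_betw_def)
          moreover have "card (\<pi> ` \<beta>) \<le> k"
            using z finite_subset[OF _ finite_letters] card_image_le[of \<beta> \<pi>] by fastforce
          moreover have "set (map \<pi> z) \<subseteq> \<pi> ` \<beta>" using z by auto
          moreover have "map \<pi> z \<in> K" using perm[of z \<pi>] z \<pi> by blast
          ultimately have "fold a (map \<pi> z) i = i" using a i unfolding admissible_def by blast
          moreover have "set z \<subseteq> L" using z by blast
          ultimately show "fold b z i = i" using b by simp
        qed
        then show ?thesis using u i b by (auto simp: kernel_of_def)
      qed
      then show ?thesis by (simp add: kernel_of_def)
    qed
  qed
qed

lemma word_kernel_ker: "finite L \<Longrightarrow> word_kernel L (ker L c k)"
  by (induction k) (simp_all add: word_kernel_UNIV word_kernel_admissible Let_def)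

section \<open>Tests\<close>

text \<open>An action of the letters by involutions on the quotient of \<open>S\<close> by
  \<open>R\<close>. Working with representatives keeps visible which piece of the group a glued
  point comes from.\<close>

locale test =
  fixes L :: "'l set" and S :: "'s set" and R :: "('s \<times> 's) set" and step :: "'l \<Rightarrow> 's \<Rightarrow> 's"
  assumes equiv: "equiv S R"
    and step_closed: "s \<in> S \<Longrightarrow> step x s \<in> S"
    and step_cong: "(s, t) \<in> R \<Longrightarrow> (step x s, step x t) \<in> R"
    and step_step: "s \<in> S \<Longrightarrow> (step x (step x s), s) \<in> R"
    and step_out: "s \<in> S \<Longrightarrow> x \<notin> L \<Longrightarrow> (step x s, s) \<in> R"
begin

definition passes :: "'l list \<Rightarrow> bool" where
  "passes w \<longleftrightarrow> (\<forall>s\<in>S. (fold step w s, s) \<in> R)"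

lemma R_refl: "s \<in> S \<Longrightarrow> (s, s) \<in> R"
  using equiv by (auto simp: equiv_def refl_on_def)

lemma R_sym: "(s, t) \<in> R \<Longrightarrow> (t, s) \<in> R"
  using equiv by (auto simp: equiv_def sym_def)

lemma R_trans: "(s, t) \<in> R \<Longrightarrow> (t, r) \<in> R \<Longrightarrow> (s, r) \<in> R"
  using equiv by (auto simp: equiv_def trans_def)

lemma fold_closed: "s \<in> S \<Longrightarrow> fold step w s \<in> S"
  by (induction w arbitrary: s) (auto simp: step_closed)

lemma fold_cong: "(s, t) \<in> R \<Longrightarrow> (fold step w s, fold step w t) \<in> R"
  by (induction w arbitrary: s t) (auto simp: step_cong)

lemma fold_rev_fold: "s \<in> S \<Longrightarrow> (fold step (rev w) (fold step w s), s) \<in> R"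
proof (induction w arbitrary: s)
  case (Cons x w)
  have "(fold step (rev w) (fold step w (step x s)), step x s) \<in> R"
    by (rule Cons.IH) (rule step_closed[OF Cons.prems])
  then show ?case using step_cong step_step[OF Cons.prems] R_trans by fastforce
qed (simp add: R_refl)

text \<open>The classes are numbered. Numbers that are not taken are fixed by all letters, which
  pads the action to the degree \<open>M\<close> that the next stage asks for.\<close>

lemma to_action:
  assumes "finite (S // R)" "card (S // R) \<le> M"
  obtains a f where "involutive_action L M a" "\<And>s. s \<in> S \<Longrightarrow> f s < M"
    "\<And>s t. s \<in> S \<Longrightarrow> t \<in> S \<Longrightarrow> f s = f t \<longleftrightarrow> (s, t) \<in> R"
    "\<And>s w. s \<in> S \<Longrightarrow> fold a w (f s) = f (fold step w s)"
    "\<And>i w. i \<notin> f ` S \<Longrightarrow> fold a w i = i"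
proof -
  obtain g :: "'s set \<Rightarrow> nat" and n where g: "g ` (S // R) = {i. i < n}" "inj_on g (S // R)"
    using finite_imp_nat_seg_image_inj_on[OF assms(1)]
      finite_imp_inj_to_nat_seg[OF assms(1)] by metis
  have n: "n \<le> M" using g card_image[OF g(2)] assms(2) by simp
  define f where "f s = g (R `` {s})" for s
  have f: "f s = f t \<longleftrightarrow> (s, t) \<in> R" if "s \<in> S" "t \<in> S" for s t
    unfolding f_def using inj_on_eq_iff[OF g(2)] eq_equiv_class_iff[OF equiv that] that
    by (simp add: quotientI)
  have f_less: "f s < M" if "s \<in> S" for s
  proof -
    have "g (R `` {s}) \<in> {i. i < n}" using g(1) quotientI[OF that, of R] by blast
    then show ?thesis using n by (simp add: f_def)
  qed
  define a where "a x i = (if i \<in> f ` S then f (step x (SOME s. s \<in> S \<and> f s = i)) else i)" for x i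
  have a: "a x (f s) = f (step x s)" if "s \<in> S" for x s
  proof -
    define t where "t = (SOME t. t \<in> S \<and> f t = f s)"
    have t: "t \<in> S \<and> f t = f s" unfolding t_def by (rule someI[of _ s]) (use that in simp)
    then have "(t, s) \<in> R" using f that by blast
    then have "f (step x t) = f (step x s)"
      using f step_closed step_cong t that by blast
    then show ?thesis using that by (simp add: a_def t_def)
  qed
  show ?thesis
  proof
    show "f s < M" if "s \<in> S" for s using f_less that .
    show "f s = f t \<longleftrightarrow> (s, t) \<in> R" if "s \<in> S" "t \<in> S" for s t using f that .
    show "fold a w (f s) = f (fold step w s)" if "s \<in> S" for s w
      using that by (induction w arbitrary: s) (auto simp: a step_closed)
    show "fold a w i = i" if "i \<notin> f ` S" for i w
      using that by (induction w) (auto simp: a_def)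
    show "involutive_action L M a"
      unfolding involutive_action_def
    proof (intro allI impI)
      fix x i assume i: "i < M"
      show "a x i < M \<and> a x (a x i) = i \<and> (x \<notin> L \<longrightarrow> a x i = i)"
      proof (cases "i \<in> f ` S")
        case True
        then obtain s where s: "s \<in> S" "i = f s" by blast
        show ?thesis
          using s a f f_less step_closed step_step step_out by metis
      qed (use i in \<open>simp add: a_def\<close>)
    qed
  qed
qed

text \<open>Such a test is, up to numbering, one of the admissible actions by which the next stage
  is defined.\<close>

lemma passes_Suc:
  assumes "finite (S // R)" "card (S // R) \<le> c * card (UNIV // eqw (ker L c k))"
    and "\<And>\<beta> z. \<beta> \<subseteq> L \<Longrightarrow> card \<beta> \<le> k \<Longrightarrow> set z \<subseteq> \<beta> \<Longrightarrow> z \<in> ker L c k \<Longrightarrow> passes z"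
    and w: "w \<in> ker L c (Suc k)"
  shows "passes w"
proof -
  let ?M = "c * card (UNIV // eqw (ker L c k))"
  obtain a f where 1: "involutive_action L ?M a" "\<And>s. s \<in> S \<Longrightarrow> f s < ?M"
    "\<And>s t. s \<in> S \<Longrightarrow> t \<in> S \<Longrightarrow> f s = f t \<longleftrightarrow> (s, t) \<in> R"
    "\<And>s w. s \<in> S \<Longrightarrow> fold a w (f s) = f (fold step w s)"
    "\<And>i w. i \<notin> f ` S \<Longrightarrow> fold a w i = i"
    using to_action[OF assms(1,2)] by blast
  have "a \<in> admissible L ?M k (ker L c k)"
    unfolding admissible_def
  proof (intro CollectI conjI allI impI)
    fix \<beta> z i assume "\<beta> \<subseteq> L \<and> card \<beta> \<le> k \<and> set z \<subseteq> \<beta> \<and> z \<in> ker L c k"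
    then have z: "passes z" using assms(3) by blast
    show "fold a z i = i"
    proof (cases "i \<in> f ` S")
      case True
      then show ?thesis using 1(3,4) z fold_closed by (auto simp: passes_def)
    qed (rule 1(5))
  qed (rule 1(1))
  then have "fold a w i = i" if "i < ?M" for i
    using w that by (simp add: kernel_of_def Let_def)
  then have "f (fold step w s) = f s" if "s \<in> S" for s
    using 1(2,4) that by metis
  then show ?thesis
    using 1(3) fold_closed by (auto simp: passes_def)
qed

end

lemma fold_snoc: "fold (\<lambda>x w. w @ [x]) z w = w @ z"
  by (induction z arbitrary: w) auto

text \<open>The Cayley graph of a stage is a test for the next one.\<close>

lemma ker_Suc_subset:
  assumes L: "finite L" and c: "c \<ge> 1"
  shows "ker L c (Suc k) \<subseteq> ker L c k"
proof
  fix w assume w: "w \<in> ker L c (Suc k)"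
  interpret word_kernel L "ker L c k" by (rule word_kernel_ker[OF L])
  interpret T: test L UNIV "eqw (ker L c k)" "\<lambda>x w. w @ [x]"
  proof
    show "equiv UNIV (eqw (ker L c k))" by (rule equiv_eqw)
    show "(s @ [x], t @ [x]) \<in> eqw (ker L c k)" if "(s, t) \<in> eqw (ker L c k)" for s t x
      using that by (simp add: eqw_iff eqv_cancel_right)
    show "((s @ [x]) @ [x], s) \<in> eqw (ker L c k)" for s x
      using eqv_app2[of "[x, x]" "[]" s] square by (simp add: eqw_iff eqv_nil)
    show "(s @ [x], s) \<in> eqw (ker L c k)" if "x \<notin> L" for s x
      using eqv_app2[of "[x]" "[]" s] out[OF that] by (simp add: eqw_iff eqv_nil)
  qed simp
  have p: "T.passes z \<longleftrightarrow> z \<in> ker L c k" for z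
  proof -
    have "(s @ z, s) \<in> eqw (ker L c k) \<longleftrightarrow> z \<in> ker L c k" for s
      using eqv_cancel_left[of s z "[]"] by (simp add: eqw_iff eqv_nil)
    then show ?thesis by (simp add: T.passes_def fold_snoc)
  qed
  have "T.passes w"
    \<comment> \<open>The Cayley graph has exactly as many classes as the index of its stage, so
      that any \<open>c \<ge> 1\<close> leaves enough room.\<close>
    by (rule T.passes_Suc[OF finite_index _ _ w]) (use c p in simp_all)
  then show "w \<in> ker L c k" by (simp add: p)
qed

lemma ker_antimono:
  assumes L: "finite L" and c: "c \<ge> 1" and "j \<le> k"
  shows "ker L c k \<subseteq> ker L c j"
  using \<open>j \<le> k\<close>
proof (induction k rule: dec_induct)
  case (step k)
  then show ?case using ker_Suc_subset[OF L c, of k] by blast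
qed simp

text \<open>Admissibility at stage \<open>k\<close> demands that kernel words with at most
  \<open>k\<close> letters act trivially, so these words survive into the next kernel; conversely,
  kernels only shrink.\<close>

lemma ker_stable:
  assumes L: "finite L" and c: "c \<ge> 1" and "j \<le> k"
    and \<beta>: "\<beta> \<subseteq> L" "card \<beta> \<le> j" "set z \<subseteq> \<beta>"
  shows "z \<in> ker L c k \<longleftrightarrow> z \<in> ker L c j"
  using \<open>j \<le> k\<close>
proof (induction k rule: dec_induct)
  case (step k)
  have "z \<in> ker L c (Suc k)" if "z \<in> ker L c k"
  proof -
    have "card \<beta> \<le> k" using \<beta>(2) step.hyps by simp
    then show ?thesis using that \<beta>(1,3) unfolding ker.simps Let_def kernel_of_def admissible_def by blast
  qed
  then show ?case using step.IH ker_Suc_subset[OF L c, of k] by blast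
qed simp

text \<open>One stage beyond \<open>card L\<close>: tests over sets of up to \<open>card L\<close>
  letters are enforced only by the stage that follows this number.\<close>

definition final_kernel :: "'l set \<Rightarrow> nat \<Rightarrow> 'l list set" where
  "final_kernel L c = ker L c (Suc (card L))"

lemma word_kernel_final: "finite L \<Longrightarrow> word_kernel L (final_kernel L c)"
  by (simp add: final_kernel_def word_kernel_ker del: ker.simps)

text \<open>The number of classes of words over a set of \<open>k\<close> letters does not change after stage \<open>k\<close>.\<close>

lemma (in test) passes_final:
  assumes L: "finite L" and c: "c \<ge> 1" and k: "k \<le> card L"
    and fin: "finite (S // R)" and card: "card (S // R) \<le> c * card (UNIV // eqw (ker L c k))"
    and z: "\<And>\<beta> z. \<beta> \<subseteq> L \<Longrightarrow> card \<beta> \<le> k \<Longrightarrow> set z \<subseteq> \<beta> \<Longrightarrow> z \<in> final_kernel L c \<Longrightarrow> passes z"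
    and w: "w \<in> final_kernel L c"
  shows "passes w"
proof (rule passes_Suc[OF fin card])
  show "w \<in> ker L c (Suc k)"
    using ker_antimono[OF L c, of "Suc k" "Suc (card L)"] k w unfolding final_kernel_def by blast
  show "passes z" if "\<beta> \<subseteq> L" "card \<beta> \<le> k" "set z \<subseteq> \<beta>" "z \<in> ker L c k" for \<beta> z
    using ker_stable[OF L c _ that(1-3), of "Suc (card L)"] that z k unfolding final_kernel_def by simp
qed

locale stable_words =
  fixes L :: "'l set" and c :: nat
  assumes finite_L: "finite L" and c_pos: "c \<ge> 1"
begin

abbreviation K where "K \<equiv> final_kernel L c"

sublocale word_kernel L K
  by (rule word_kernel_final[OF finite_L])

notation eqv (infix "\<approx>" 50)

text \<open>The bound on the size comes from counting: a class is determined by the index of a state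
  and by the class of its \<open>val\<close>, a word with at most \<open>k\<close> letters, on which
  stage \<open>k\<close> and the final kernel agree.\<close>

lemma test_passes:
  assumes T: "test L S R step" and k: "k \<le> card L"
    and I: "finite I" "card I \<le> c" "\<And>s. s \<in> S \<Longrightarrow> idx s \<in> I"
    and \<gamma>: "\<And>i. i \<in> I \<Longrightarrow> \<gamma> i \<subseteq> L \<and> card (\<gamma> i) \<le> k"
    and val: "\<And>s. s \<in> S \<Longrightarrow> set (val s) \<subseteq> \<gamma> (idx s)"
    and R: "\<And>s t. s \<in> S \<Longrightarrow> t \<in> S \<Longrightarrow> idx s = idx t \<Longrightarrow> val s \<approx> val t \<Longrightarrow> (s, t) \<in> R"
    and z: "\<And>\<beta> z. \<beta> \<subseteq> L \<Longrightarrow> card \<beta> \<le> k \<Longrightarrow> set z \<subseteq> \<beta> \<Longrightarrow> z \<in> K \<Longrightarrow> test.passes S R step z"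
    and w: "w \<in> K"
  shows "test.passes S R step w"
proof -
  interpret T: test L S R step by fact
  interpret k: word_kernel L "ker L c k" by (rule word_kernel_ker[OF finite_L])
  define f where "f C = (let s = SOME s. s \<in> C in (idx s, eqw (ker L c k) `` {val s}))" for C
  have rep: "(SOME s. s \<in> C) \<in> C \<and> C \<subseteq> S" if "C \<in> S // R" for C
  proof -
    have "C \<noteq> {}" using that T.equiv in_quotient_imp_non_empty by blast
    then show ?thesis using in_quotient_imp_subset[OF T.equiv that] by (simp add: some_in_eq)
  qed
  have f: "f ` (S // R) \<subseteq> I \<times> (UNIV // eqw (ker L c k))"
    using rep I(3) by (auto simp: f_def Let_def intro!: quotientI)
  have "inj_on f (S // R)"
  proof (rule inj_onI)
    fix C D assume CD: "C \<in> S // R" "D \<in> S // R" "f C = f D"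
    define s t where "s = (SOME s. s \<in> C)" and "t = (SOME s. s \<in> D)"
    have st: "s \<in> C" "t \<in> D" "s \<in> S" "t \<in> S" using rep CD by (auto simp: s_def t_def)
    have i: "idx s = idx t" and e: "eqw (ker L c k) `` {val s} = eqw (ker L c k) `` {val t}"
      using CD(3) by (auto simp: f_def Let_def s_def t_def)
    have "val s @ rev (val t) \<in> ker L c k"
      using eq_equiv_class[OF e k.equiv_eqw] by (simp add: eqw_def)
    moreover have "set (val s @ rev (val t)) \<subseteq> \<gamma> (idx s)" using val[OF st(3)] val[OF st(4)] i by auto
    moreover have "\<gamma> (idx s) \<subseteq> L" "card (\<gamma> (idx s)) \<le> k" using \<gamma> I(3)[OF st(3)] by auto
    ultimately have "val s @ rev (val t) \<in> K"
      using ker_stable[OF finite_L c_pos, of k "Suc (card L)" "\<gamma> (idx s)"] k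
      unfolding final_kernel_def by simp
    then have "(s, t) \<in> R" using R[OF st(3,4) i] by (simp add: eqv_def)
    then show "C = D" using quotient_eqI[OF T.equiv CD(1,2) st(1,2)] by blast
  qed
  moreover have fin: "finite (I \<times> (UNIV // eqw (ker L c k)))"
    using I(1) k.finite_index by blast
  ultimately have "finite (S // R)" "card (S // R) \<le> card (I \<times> (UNIV // eqw (ker L c k)))"
    using f by (auto intro: inj_on_finite card_inj_on_le)
  moreover have "card (I \<times> (UNIV // eqw (ker L c k))) \<le> c * card (UNIV // eqw (ker L c k))"
    using I(2) by (simp add: card_cartesian_product)
  ultimately have "finite (S // R)" "card (S // R) \<le> c * card (UNIV // eqw (ker L c k))"
    by linarith+
  then show ?thesis
    by (rule T.passes_final[OF finite_L c_pos k]) (use z w in blast)+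
qed

section \<open>Chains of cosets\<close>

text \<open>A left coset of the subgroup generated by \<alpha>, saturated under equivalence. The
  empty set qualifies as well, which allows members of a chain to be erased.\<close>

definition coset :: "'l list set \<Rightarrow> 'l set \<Rightarrow> bool" where
  "coset Q \<alpha> \<longleftrightarrow> (\<forall>g\<in>Q. \<forall>h. h \<in> Q \<longleftrightarrow> (\<exists>b. set b \<subseteq> \<alpha> \<and> h \<approx> g @ b))"

text \<open>Disjointness of three consecutive members makes the gluing of neighbours transitive. The
  chain is not closed up: its first and last member stay apart.\<close>

definition chain :: "nat \<Rightarrow> (nat \<Rightarrow> 'l list set) \<Rightarrow> (nat \<Rightarrow> 'l set) \<Rightarrow> bool" where
  "chain n Q \<alpha> \<longleftrightarrow> (\<forall>i<n. coset (Q i) (\<alpha> i) \<and> \<alpha> i \<subseteq> L) \<and>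
     (\<forall>i. Suc (Suc i) < n \<longrightarrow> Q i \<inter> Q (Suc i) \<inter> Q (Suc (Suc i)) = {})"

definition adjacent :: "nat \<Rightarrow> nat \<Rightarrow> bool" where
  "adjacent i j \<longleftrightarrow> i = j \<or> j = Suc i \<or> i = Suc j"

definition chain_states :: "nat \<Rightarrow> (nat \<Rightarrow> 'l list set) \<Rightarrow> (nat \<times> 'l list) set" where
  "chain_states n Q = {(i, g). i < n \<and> g \<in> Q i}"

definition chain_rel :: "nat \<Rightarrow> (nat \<Rightarrow> 'l list set) \<Rightarrow> ((nat \<times> 'l list) \<times> (nat \<times> 'l list)) set" where
  "chain_rel n Q = {((i, g), (j, h)). i < n \<and> g \<in> Q i \<and> j < n \<and> h \<in> Q j \<and> g \<approx> h \<and> adjacent i j}"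

text \<open>Right multiplication, carried out in any coset which contains the glued point and
  absorbs \<open>x\<close>; if there is none, the point stays. Which coset is chosen does not matter
  up to gluing.\<close>

definition chain_step ::
    "nat \<Rightarrow> (nat \<Rightarrow> 'l list set) \<Rightarrow> (nat \<Rightarrow> 'l set) \<Rightarrow> 'l \<Rightarrow> nat \<times> 'l list \<Rightarrow> nat \<times> 'l list" where
  "chain_step n Q \<alpha> x s =
     (if \<exists>j h. (s, (j, h)) \<in> chain_rel n Q \<and> x \<in> \<alpha> j
      then (SOME t. \<exists>j h. (s, (j, h)) \<in> chain_rel n Q \<and> x \<in> \<alpha> j \<and> t = (j, h @ [x])) else s)"

lemma cosetD: "coset Q \<alpha> \<Longrightarrow> g \<in> Q \<Longrightarrow> h \<in> Q \<Longrightarrow> \<exists>b. set b \<subseteq> \<alpha> \<and> h \<approx> g @ b"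
  unfolding coset_def by blast

lemma coset_eqv: "coset Q \<alpha> \<Longrightarrow> g \<in> Q \<Longrightarrow> g \<approx> h \<Longrightarrow> h \<in> Q"
  unfolding coset_def using eqv_sym by (metis append_Nil2 empty_subsetI list.set(1))

lemma coset_app: "coset Q \<alpha> \<Longrightarrow> g \<in> Q \<Longrightarrow> set b \<subseteq> \<alpha> \<Longrightarrow> g @ b \<in> Q"
  unfolding coset_def using eqv_refl by blast

lemma chainD:
  assumes "chain n Q \<alpha>"
  shows "i < n \<Longrightarrow> coset (Q i) (\<alpha> i)" "i < n \<Longrightarrow> \<alpha> i \<subseteq> L"
    "Suc (Suc i) < n \<Longrightarrow> Q i \<inter> Q (Suc i) \<inter> Q (Suc (Suc i)) = {}"
  using assms by (simp_all add: chain_def)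

lemma equiv_chain:
  assumes "chain n Q \<alpha>"
  shows "equiv (chain_states n Q) (chain_rel n Q)"
proof (rule equivI)
  show "refl_on (chain_states n Q) (chain_rel n Q)"
    by (auto simp: refl_on_def chain_states_def chain_rel_def adjacent_def)
  show "chain_rel n Q \<subseteq> chain_states n Q \<times> chain_states n Q"
    by (auto simp: chain_states_def chain_rel_def)
  show "sym (chain_rel n Q)"
    by (auto simp: sym_def chain_rel_def adjacent_def intro: eqv_sym)
  show "trans (chain_rel n Q)"
  proof (rule transI)
    fix s t r assume st: "(s, t) \<in> chain_rel n Q" and tr: "(t, r) \<in> chain_rel n Q"
    obtain i g j h l k where [simp]: "s = (i, g)" "t = (j, h)" "r = (l, k)"
      by (metis surj_pair)
    have gh: "g \<approx> h" "h \<approx> k" and lt: "i < n" "j < n" "l < n"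
      and Q: "g \<in> Q i" "h \<in> Q j" "k \<in> Q l" and adj: "adjacent i j" "adjacent j l"
      using st tr by (auto simp: chain_rel_def)
    have hi: "h \<in> Q i"
      by (rule coset_eqv[OF chainD(1)[OF assms lt(1)] Q(1) gh(1)])
    have hl: "h \<in> Q l"
      by (rule coset_eqv[OF chainD(1)[OF assms lt(3)] Q(3) eqv_sym[OF gh(2)]])
    \<comment> \<open>Gluing over distance two would put \<open>h\<close> into three consecutive
      cosets.\<close>
    have "adjacent i l"
    proof (rule ccontr)
      assume "\<not> adjacent i l"
      then have "j = Suc i \<and> l = Suc (Suc i) \<or> j = Suc l \<and> i = Suc (Suc l)"
        using adj by (auto simp: adjacent_def)
      then show False
        using chainD(3)[OF assms, of i] chainD(3)[OF assms, of l] lt hi hl Q(2) by blast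
    qed
    then show "(s, r) \<in> chain_rel n Q"
      using lt Q eqv_trans[OF gh] by (simp add: chain_rel_def)
  qed
qed

text \<open>Every coset that absorbs \<open>x\<close> may be used to compute the step: two
  representatives of one point stay equivalent, and in adjacent cosets, after multiplication by
  \<open>x\<close>.\<close>

lemma chain_step_active:
  assumes ch: "chain n Q \<alpha>" and s: "(s, (j, h)) \<in> chain_rel n Q" and x: "x \<in> \<alpha> j"
  shows "(chain_step n Q \<alpha> x s, (j, h @ [x])) \<in> chain_rel n Q"
proof -
  have ex: "\<exists>t j h. (s, (j, h)) \<in> chain_rel n Q \<and> x \<in> \<alpha> j \<and> t = (j, h @ [x])" using s x by blast
  have "chain_step n Q \<alpha> x s =
      (SOME t. \<exists>j h. (s, (j, h)) \<in> chain_rel n Q \<and> x \<in> \<alpha> j \<and> t = (j, h @ [x]))"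
    unfolding chain_step_def using s x by (intro if_P) blast
  with someI_ex[OF ex] obtain j' h' where 1: "(s, (j', h')) \<in> chain_rel n Q" "x \<in> \<alpha> j'"
    "chain_step n Q \<alpha> x s = (j', h' @ [x])"
    by metis
  have "((j', h'), (j, h)) \<in> chain_rel n Q"
    using equiv_chain[OF ch] 1(1) s by (meson equivE symD transD)
  moreover have "h' @ [x] \<in> Q j'" "h @ [x] \<in> Q j"
    using 1(1,2) s x ch coset_app[of _ _ _ "[x]"] by (auto simp: chain_rel_def chain_def)
  ultimately show ?thesis
    unfolding 1(3) by (auto simp: chain_rel_def intro: eqv_app1)
qed

lemma chain_step_stay:
  assumes "\<And>j h. (s, (j, h)) \<in> chain_rel n Q \<Longrightarrow> x \<notin> \<alpha> j"
  shows "chain_step n Q \<alpha> x s = s"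
  using assms unfolding chain_step_def by metis

lemma test_chain:
  assumes ch: "chain n Q \<alpha>"
  shows "test L (chain_states n Q) (chain_rel n Q) (chain_step n Q \<alpha>)"
proof
  note eq = equiv_chain[OF ch]
  have R_sym: "(t, s) \<in> chain_rel n Q" if "(s, t) \<in> chain_rel n Q" for s t
    using eq that by (meson equivE symD)
  have R_trans: "(s, r) \<in> chain_rel n Q" if "(s, t) \<in> chain_rel n Q" "(t, r) \<in> chain_rel n Q" for s t r
    using eq that by (meson equivE transD)
  have R_refl: "(s, s) \<in> chain_rel n Q" if "s \<in> chain_states n Q" for s
    using eq that by (meson equivE refl_onD)
  have R_S: "s \<in> chain_states n Q" if "(s, t) \<in> chain_rel n Q" for s t
    using that by (auto simp: chain_rel_def chain_states_def)
  show "equiv (chain_states n Q) (chain_rel n Q)" by fact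
  show "chain_step n Q \<alpha> x s \<in> chain_states n Q" if "s \<in> chain_states n Q" for s x
  proof (cases "\<exists>j h. (s, (j, h)) \<in> chain_rel n Q \<and> x \<in> \<alpha> j")
    case True
    then show ?thesis using chain_step_active[OF ch] R_S by blast
  next
    case False
    then have "chain_step n Q \<alpha> x s = s" by (intro chain_step_stay) blast
    then show ?thesis using that by simp
  qed
  show "(chain_step n Q \<alpha> x s, chain_step n Q \<alpha> x t) \<in> chain_rel n Q"
    if st: "(s, t) \<in> chain_rel n Q" for s t x
  proof (cases "\<exists>j h. (s, (j, h)) \<in> chain_rel n Q \<and> x \<in> \<alpha> j")
    case True
    then obtain j h where "(s, (j, h)) \<in> chain_rel n Q" "x \<in> \<alpha> j" by blast
    then show ?thesis
      using chain_step_active[OF ch, of s j h x] chain_step_active[OF ch, of t j h x] R_sym R_trans st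
      by blast
  next
    case False
    then have "chain_step n Q \<alpha> x s = s" by (intro chain_step_stay) blast
    moreover have "chain_step n Q \<alpha> x t = t"
      by (rule chain_step_stay) (use False st R_trans in blast)
    ultimately show ?thesis using st by simp
  qed
  show "(chain_step n Q \<alpha> x (chain_step n Q \<alpha> x s), s) \<in> chain_rel n Q"
    if s: "s \<in> chain_states n Q" for s x
  proof (cases "\<exists>j h. (s, (j, h)) \<in> chain_rel n Q \<and> x \<in> \<alpha> j")
    case True
    then obtain j h where jh: "(s, (j, h)) \<in> chain_rel n Q" "x \<in> \<alpha> j" by blast
    have 1: "(chain_step n Q \<alpha> x (chain_step n Q \<alpha> x s), (j, (h @ [x]) @ [x])) \<in> chain_rel n Q"
      by (rule chain_step_active[OF ch chain_step_active[OF ch jh] jh(2)])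
    have "(h @ [x]) @ [x] \<approx> h"
      using eqv_app2[of "[x, x]" "[]" h] square by (simp add: eqv_nil)
    then have "((j, (h @ [x]) @ [x]), (j, h)) \<in> chain_rel n Q"
      using 1 jh by (auto simp: chain_rel_def adjacent_def)
    then show ?thesis using 1 jh R_trans R_sym by blast
  next
    case False
    then have "chain_step n Q \<alpha> x s = s" by (intro chain_step_stay) blast
    then show ?thesis using R_refl[OF s] by simp
  qed
  show "(chain_step n Q \<alpha> x s, s) \<in> chain_rel n Q" if "s \<in> chain_states n Q" "x \<notin> L" for s x
  proof -
    have "x \<notin> \<alpha> j" if "(s, (j, h)) \<in> chain_rel n Q" for j h
      using that \<open>x \<notin> L\<close> ch by (auto simp: chain_rel_def chain_def)
    then have "chain_step n Q \<alpha> x s = s" by (intro chain_step_stay) blast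
    then show ?thesis using R_refl[OF that(1)] by simp
  qed
qed

lemma fold_chain_step:
  assumes ch: "chain n Q \<alpha>" and s: "(s, (j, h)) \<in> chain_rel n Q" and z: "set z \<subseteq> \<alpha> j"
  shows "(fold (chain_step n Q \<alpha>) z s, (j, h @ z)) \<in> chain_rel n Q"
  using s z
proof (induction z arbitrary: s h)
  case (Cons x z)
  then show ?case using Cons.IH[OF chain_step_active[OF ch Cons.prems(1)]] by simp
qed simp

text \<open>
  Under words over \<open>\<beta>\<close>, a state moves in the chain of the intersections with a single coset of
  \<open>\<beta>\<close>, unless it is in a coset which absorbs \<open>\<beta>\<close>; so chains pass by induction on the size of the
  sets of letters.
\<close>

lemma chain_passes:
  assumes "chain n Q \<alpha>" "n \<le> c" "\<And>i. i < n \<Longrightarrow> card (\<alpha> i) \<le> k" "k \<le> card L" "w \<in> K"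
  shows "test.passes (chain_states n Q) (chain_rel n Q) (chain_step n Q \<alpha>) w"
  using assms
proof (induction k arbitrary: Q \<alpha> w rule: less_induct)
  case (less k)
  note ch = less.prems(1)
  interpret T: test L "chain_states n Q" "chain_rel n Q" "chain_step n Q \<alpha>"
    by (rule test_chain[OF ch])
  \<comment> \<open>Relative to a base point, an element of the coset with index \<open>i\<close>
    becomes a word over \<open>\<alpha> i\<close>, as the count of classes requires.\<close>
  define base where "base i = (SOME g. g \<in> Q i)" for i
  define val where "val s = (SOME b. set b \<subseteq> \<alpha> (fst s) \<and> snd s \<approx> base (fst s) @ b)" for s :: "nat \<times> 'l list"
  have val: "set (val s) \<subseteq> \<alpha> (fst s) \<and> snd s \<approx> base (fst s) @ val s" if "s \<in> chain_states n Q" for s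
  proof -
    have s: "fst s < n" "snd s \<in> Q (fst s)" using that by (auto simp: chain_states_def)
    then have "base (fst s) \<in> Q (fst s)" unfolding base_def by (metis someI)
    then have "\<exists>b. set b \<subseteq> \<alpha> (fst s) \<and> snd s \<approx> base (fst s) @ b"
      using s ch unfolding chain_def coset_def by blast
    then show ?thesis unfolding val_def by (rule someI_ex)
  qed
  show ?case
  proof (rule test_passes[OF T.test_axioms less.prems(4), of "{..<n}" fst \<alpha> val])
    show "fst s \<in> {..<n}" if "s \<in> chain_states n Q" for s using that by (auto simp: chain_states_def)
    show "\<alpha> i \<subseteq> L \<and> card (\<alpha> i) \<le> k" if "i \<in> {..<n}" for i
      using that less.prems(3) ch by (auto simp: chain_def)
    show "set (val s) \<subseteq> \<alpha> (fst s)" if "s \<in> chain_states n Q" for s using val[OF that] by blast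
    show "(s, t) \<in> chain_rel n Q"
      if "s \<in> chain_states n Q" "t \<in> chain_states n Q" "fst s = fst t" "val s \<approx> val t" for s t
    proof -
      have "snd s \<approx> base (fst s) @ val s" "snd t \<approx> base (fst s) @ val t"
        using val[OF that(1)] val[OF that(2)] that(3) by metis+
      moreover have "base (fst s) @ val s \<approx> base (fst s) @ val t" using that(4) by (rule eqv_app2)
      ultimately have "snd s \<approx> snd t" by (meson eqv_sym eqv_trans)
      then show ?thesis using that by (auto simp: chain_states_def chain_rel_def adjacent_def)
    qed
    fix \<beta> z assume \<beta>: "\<beta> \<subseteq> L" "card \<beta> \<le> k" "set z \<subseteq> \<beta>" and z: "z \<in> K"
    have fin: "finite \<beta>" using \<beta>(1) finite_L finite_subset by blast
    show "T.passes z"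
      unfolding T.passes_def
    proof
      fix s0 assume s0: "s0 \<in> chain_states n Q"
      obtain i0 g0 where s0_eq: "s0 = (i0, g0)" by (metis surj_pair)
      show "(fold (chain_step n Q \<alpha>) z s0, s0) \<in> chain_rel n Q"
      proof (cases "\<exists>j h. (s0, (j, h)) \<in> chain_rel n Q \<and> \<beta> \<subseteq> \<alpha> j")
        \<comment> \<open>In a coset which absorbs \<beta>, all of \<open>z\<close> acts by right
          multiplication, and \<open>z\<close> has value 1.\<close>
        case True
        then obtain j h where jh: "(s0, (j, h)) \<in> chain_rel n Q" "\<beta> \<subseteq> \<alpha> j" by blast
        then have 1: "(fold (chain_step n Q \<alpha>) z s0, (j, h @ z)) \<in> chain_rel n Q"
          using fold_chain_step[OF ch jh(1), of z] \<beta>(3) by blast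
        have "h @ z \<approx> h" using eqv_app2[of z "[]" h] z by (simp add: eqv_nil)
        then have "((j, h @ z), (j, h)) \<in> chain_rel n Q"
          using 1 jh by (auto simp: chain_rel_def adjacent_def)
        then show ?thesis using 1 jh T.R_trans T.R_sym by blast
      next
        case no: False
        \<comment> \<open>Cosets that absorb \<beta> are emptied, because a run from
          \<open>s0\<close> never meets them. The others are cut down to the coset of \<beta>
          through \<open>g0\<close>, which makes their sets of letters smaller than \<beta> and
          permits the induction.\<close>
        define Q' where "Q' j = (if \<beta> \<subseteq> \<alpha> j then {} else {g \<in> Q j. \<exists>b. set b \<subseteq> \<beta> \<and> g \<approx> g0 @ b})" for j
        define \<alpha>' where "\<alpha>' j = (if \<beta> \<subseteq> \<alpha> j then {} else \<alpha> j \<inter> \<beta>)" for j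
        have "\<not> \<beta> \<subseteq> \<alpha> i0" using no s0 T.R_refl[OF s0] s0_eq by blast
        then have kpos: "0 < k" using \<beta>(2) fin by (cases k) auto
        have ch': "chain n Q' \<alpha>'"
          unfolding chain_def
        proof (intro conjI allI impI)
          fix i assume i: "i < n"
          show "\<alpha>' i \<subseteq> L" using \<beta>(1) by (auto simp: \<alpha>'_def)
          have Qi: "coset (Q i) (\<alpha> i)" using ch i by (simp add: chain_def)
          show "coset (Q' i) (\<alpha>' i)"
          proof (cases "\<beta> \<subseteq> \<alpha> i")
            case False
            show ?thesis
              unfolding coset_def
            proof (intro ballI allI)
              fix g h assume "g \<in> Q' i"
              then obtain b2 where g: "g \<in> Q i" "set b2 \<subseteq> \<beta>" "g \<approx> g0 @ b2"
                using False by (auto simp: Q'_def)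
              show "h \<in> Q' i \<longleftrightarrow> (\<exists>b. set b \<subseteq> \<alpha>' i \<and> h \<approx> g @ b)"
              proof
                assume "h \<in> Q' i"
                then obtain b3 where h: "h \<in> Q i" "set b3 \<subseteq> \<beta>" "h \<approx> g0 @ b3"
                  using False by (auto simp: Q'_def)
                obtain b1 where b1: "set b1 \<subseteq> \<alpha> i" "h \<approx> g @ b1"
                  using cosetD[OF Qi g(1) h(1)] by blast
                have "g0 @ b2 @ b1 \<approx> g0 @ b3"
                  using b1(2) h(3) eqv_app1[OF g(3), of b1] by (metis append_assoc eqv_sym eqv_trans)
                then have "b1 \<approx> rev b2 @ b3" using eqv_cancel_left eqv_move_left by blast
                \<comment> \<open>The only use of intersections of subgroups: \<open>b1\<close> is a
                  word over \<open>\<alpha> i\<close> with the value of a word over \<beta>.\<close>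
                then obtain b where b: "set b \<subseteq> \<alpha> i \<inter> \<beta>" "b \<approx> b1"
                  using eqv_inter[of b1 "rev b2 @ b3" "\<alpha> i" \<beta>] b1(1) g(2) h(2) by auto
                then have "h \<approx> g @ b" using b1(2) eqv_app2 eqv_sym eqv_trans by meson
                then show "\<exists>b. set b \<subseteq> \<alpha>' i \<and> h \<approx> g @ b" using b(1) False by (auto simp: \<alpha>'_def)
              next
                assume "\<exists>b. set b \<subseteq> \<alpha>' i \<and> h \<approx> g @ b"
                then obtain b where b: "set b \<subseteq> \<alpha> i" "set b \<subseteq> \<beta>" "h \<approx> g @ b"
                  using False by (auto simp: \<alpha>'_def)
                then have "h \<in> Q i" using Qi g(1) unfolding coset_def by blast
                moreover have "h \<approx> g0 @ b2 @ b"
                  using b(3) eqv_app1[OF g(3), of b] by (metis append_assoc eqv_trans)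
                ultimately show "h \<in> Q' i"
                  using False b(2) g(2) by (auto simp: Q'_def intro!: exI[of _ "b2 @ b"])
              qed
            qed
          qed (simp add: Q'_def coset_def)
        next
          fix i assume "Suc (Suc i) < n"
          then have "Q i \<inter> Q (Suc i) \<inter> Q (Suc (Suc i)) = {}" using ch by (simp add: chain_def)
          then show "Q' i \<inter> Q' (Suc i) \<inter> Q' (Suc (Suc i)) = {}" by (auto simp: Q'_def)
        qed
        have card': "card (\<alpha>' i) \<le> k - 1" for i
        proof (cases "\<beta> \<subseteq> \<alpha> i")
          case False
          then have "card (\<alpha> i \<inter> \<beta>) < card \<beta>" by (intro psubset_card_mono fin) blast
          then show ?thesis using False \<beta>(2) by (simp add: \<alpha>'_def)
        qed (simp add: \<alpha>'_def)
        interpret T': test L "chain_states n Q'" "chain_rel n Q'" "chain_step n Q' \<alpha>'"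
          by (rule test_chain[OF ch'])
        have R': "(s, t) \<in> chain_rel n Q" if "(s, t) \<in> chain_rel n Q'" for s t
          using that by (auto simp: chain_rel_def Q'_def split: if_splits)
        have s0': "s0 \<in> chain_states n Q'"
          using s0 \<open>\<not> \<beta> \<subseteq> \<alpha> i0\<close> by (auto simp: s0_eq chain_states_def Q'_def intro!: exI[of _ "[]"])
        \<comment> \<open>The runs in the large and in the small chain agree up to gluing, as the
          same letters of \<beta> are active in both.\<close>
        have sim: "(fold (chain_step n Q \<alpha>) w s0, fold (chain_step n Q' \<alpha>') w s0) \<in> chain_rel n Q"
          if "set w \<subseteq> \<beta>" for w
          using that
        proof (induction w rule: rev_induct)
          case Nil
          then show ?case using T.R_refl[OF s0] by simp
        next
          case (snoc x w)
          define s s' where "s = fold (chain_step n Q \<alpha>) w s0" and "s' = fold (chain_step n Q' \<alpha>') w s0"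
          have ss': "(s, s') \<in> chain_rel n Q" using snoc by (simp add: s_def s'_def)
          have s'S: "s' \<in> chain_states n Q'" unfolding s'_def by (rule T'.fold_closed[OF s0'])
          obtain i g where s'_eq: "s' = (i, g)" by (metis surj_pair)
          obtain b where g: "i < n" "g \<in> Q i" "set b \<subseteq> \<beta>" "g \<approx> g0 @ b"
            using s'S by (auto simp: s'_eq chain_states_def Q'_def split: if_splits)
          have "(chain_step n Q \<alpha> x s, chain_step n Q' \<alpha>' x s') \<in> chain_rel n Q"
          proof (cases "\<exists>j h. (s', (j, h)) \<in> chain_rel n Q \<and> x \<in> \<alpha> j")
            case True
            then obtain j h where jh: "(s', (j, h)) \<in> chain_rel n Q" "x \<in> \<alpha> j" by blast
            have sj: "(s, (j, h)) \<in> chain_rel n Q" using ss' jh(1) by (rule T.R_trans)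
            \<comment> \<open>Retracing \<open>w\<close> inside an absorbing coset would lead back
              to \<open>s0\<close>, so \<open>s0\<close> itself would be glued to that
              coset.\<close>
            have nb: "\<not> \<beta> \<subseteq> \<alpha> j"
            proof
              assume sub: "\<beta> \<subseteq> \<alpha> j"
              have "set (rev w) \<subseteq> \<alpha> j" using sub snoc.prems by auto
              then have "(fold (chain_step n Q \<alpha>) (rev w) s, (j, h @ rev w)) \<in> chain_rel n Q"
                by (rule fold_chain_step[OF ch sj])
              then have "(s0, (j, h @ rev w)) \<in> chain_rel n Q"
                using T.fold_rev_fold[OF s0, of w] T.R_sym T.R_trans unfolding s_def by blast
              then show False using no sub by blast
            qed
            have "h \<approx> g0 @ b" using jh(1) g(4) by (auto simp: s'_eq chain_rel_def intro: eqv_sym eqv_trans)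
            then have "(s', (j, h)) \<in> chain_rel n Q'"
              using jh(1) s'S nb g(3) by (auto simp: s'_eq chain_rel_def chain_states_def Q'_def)
            moreover have "x \<in> \<alpha>' j" using nb jh(2) snoc.prems by (auto simp: \<alpha>'_def)
            ultimately have "(chain_step n Q' \<alpha>' x s', (j, h @ [x])) \<in> chain_rel n Q"
              by (intro R' chain_step_active[OF ch'])
            then show ?thesis
              using chain_step_active[OF ch sj jh(2)] T.R_sym T.R_trans by blast
          next
            case F: False
            have "chain_step n Q \<alpha> x s = s"
              by (rule chain_step_stay) (use F ss' T.R_trans T.R_sym in blast)
            moreover have "chain_step n Q' \<alpha>' x s' = s'"
            proof (rule chain_step_stay)
              fix j h assume "(s', (j, h)) \<in> chain_rel n Q'"
              then have "x \<notin> \<alpha> j" using F R' by blast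
              then show "x \<notin> \<alpha>' j" by (simp add: \<alpha>'_def)
            qed
            ultimately show ?thesis using ss' by simp
          qed
          then show ?case by (simp add: s_def s'_def)
        qed
        have "T'.passes z"
          using less.IH[OF _ ch' less.prems(2) card' _ z] kpos less.prems(4) by simp
        then have "(fold (chain_step n Q' \<alpha>') z s0, s0) \<in> chain_rel n Q"
          using s0' R' by (simp add: T'.passes_def)
        then show ?thesis using sim[OF \<beta>(3)] T.R_trans by blast
      qed
    qed
  qed (use less.prems in auto)
qed

text \<open>If no factor splits, the cosets at the prefixes of the product form a chain. The product
  runs from its first to its last member; having value 1 it must also return to its start, so the
  two ends would be glued.\<close>

lemma acyclic_words:
  assumes n: "2 \<le> n" "n \<le> c" and h: "\<And>i. i < n \<Longrightarrow> set (h i) \<subseteq> \<alpha> i \<and> \<alpha> i \<subseteq> L"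
    and K: "concat (map h [0..<n]) \<in> K"
  shows "\<exists>i<n. \<exists>u v. set u \<subseteq> \<alpha> ((i + n - 1) mod n) \<inter> \<alpha> i \<and>
    set v \<subseteq> \<alpha> i \<inter> \<alpha> ((i + 1) mod n) \<and> h i \<approx> u @ v"
proof (rule ccontr)
  assume "\<not> ?thesis"
  then have neg: False if "i < n" "set u \<subseteq> \<alpha> ((i + n - 1) mod n) \<inter> \<alpha> i"
      "set v \<subseteq> \<alpha> i \<inter> \<alpha> ((i + 1) mod n)" "h i \<approx> u @ v" for i u v
    using that by blast
  define p where "p i = concat (map h [0..<i])" for i
  have p_Suc: "p (Suc i) = p i @ h i" for i by (simp add: p_def)
  show False
  proof (cases "n = 2")
    \<comment> \<open>With two cosets the ends are adjacent and the chain gives no contradiction.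
      But then \<open>h 0\<close> has itself a value over the common letters and splits
      trivially.\<close>
    case True
    then have "h 0 @ h 1 \<in> K" using K by (simp add: numeral_2_eq_2)
    then have "h 0 \<approx> rev (h 1)" by (simp add: eqv_def)
    then obtain w where "set w \<subseteq> \<alpha> 0 \<inter> \<alpha> 1" "w \<approx> h 0"
      using eqv_inter[of "h 0" "rev (h 1)" "\<alpha> 0" "\<alpha> 1"] h n by auto
    then show False
      using neg[of 0 w "[]"] True eqv_sym[of w "h 0"] by auto
  next
    case False
    define Q where "Q i = {g. \<exists>b. set b \<subseteq> \<alpha> i \<and> g \<approx> p i @ b}" for i
    have Qp: "p i @ b \<in> Q i" if "set b \<subseteq> \<alpha> i" for i b using that by (auto simp: Q_def)
    have QpS: "p (Suc i) \<in> Q i" if "i < n" for i using Qp[of "h i" i] h that by (simp add: p_Suc)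
    have Q: "coset (Q i) (\<alpha> i)" for i
      unfolding coset_def
    proof (intro ballI allI iffI)
      fix g h' assume "g \<in> Q i" "h' \<in> Q i"
      then obtain b b' where b: "set b \<subseteq> \<alpha> i" "g \<approx> p i @ b" "set b' \<subseteq> \<alpha> i" "h' \<approx> p i @ b'"
        by (auto simp: Q_def)
      have "p i \<approx> g @ rev b" using eqv_sym[OF b(2)] by (simp only: eqv_move_right)
      then have "p i @ b' \<approx> (g @ rev b) @ b'" by (rule eqv_app1)
      then have "h' \<approx> g @ (rev b @ b')" using eqv_trans[OF b(4)] by simp
      then show "\<exists>b. set b \<subseteq> \<alpha> i \<and> h' \<approx> g @ b" using b(1,3) by (intro exI[of _ "rev b @ b'"]) auto
    next
      fix g h' assume "g \<in> Q i" "\<exists>b. set b \<subseteq> \<alpha> i \<and> h' \<approx> g @ b"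
      then obtain b b' where b: "set b \<subseteq> \<alpha> i" "g \<approx> p i @ b" "set b' \<subseteq> \<alpha> i" "h' \<approx> g @ b'"
        by (auto simp: Q_def)
      have "g @ b' \<approx> (p i @ b) @ b'" using b(2) by (rule eqv_app1)
      then have "h' \<approx> p i @ (b @ b')" using eqv_trans[OF b(4)] by simp
      then show "h' \<in> Q i" using b(1,3) by (auto simp: Q_def intro!: exI[of _ "b @ b'"])
    qed
    have inter: "\<exists>b. set b \<subseteq> \<alpha> i \<inter> \<alpha> j \<and> g \<approx> r @ b"
      if gr: "g \<in> Q i" "g \<in> Q j" "r \<in> Q i" "r \<in> Q j" for g r i j
    proof -
      obtain b b' where b: "set b \<subseteq> \<alpha> i" "g \<approx> r @ b" "set b' \<subseteq> \<alpha> j" "g \<approx> r @ b'"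
        using cosetD[OF Q gr(3,1)] cosetD[OF Q gr(4,2)] by blast
      then have "b \<approx> b'" using eqv_trans[OF eqv_sym[OF b(2)] b(4)] by (simp only: eqv_cancel_left)
      then obtain d where "set d \<subseteq> \<alpha> i \<inter> \<alpha> j" "d \<approx> b" using eqv_inter[OF _ b(1,3)] by blast
      moreover from this have "g \<approx> r @ d" using eqv_trans[OF b(2) eqv_app2[OF eqv_sym]] by blast
      ultimately show ?thesis by blast
    qed
    have ch: "chain n Q \<alpha>"
      unfolding chain_def
    proof (intro conjI allI impI)
      show "coset (Q i) (\<alpha> i)" for i by (rule Q)
      show "\<alpha> i \<subseteq> L" if "i < n" for i using h that by blast
      fix i assume i: "Suc (Suc i) < n"
      show "Q i \<inter> Q (Suc i) \<inter> Q (Suc (Suc i)) = {}"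
      proof (rule ccontr)
        assume "Q i \<inter> Q (Suc i) \<inter> Q (Suc (Suc i)) \<noteq> {}"
        then obtain g where g: "g \<in> Q i" "g \<in> Q (Suc i)" "g \<in> Q (Suc (Suc i))" by blast
        have p0: "p j \<in> Q j" for j using Qp[of "[]" j] by simp
        obtain u where u: "set u \<subseteq> \<alpha> i \<inter> \<alpha> (Suc i)" "g \<approx> p (Suc i) @ u"
          using inter[OF g(1,2) QpS p0] i by force
        obtain v where v: "set v \<subseteq> \<alpha> (Suc i) \<inter> \<alpha> (Suc (Suc i))" "g \<approx> p (Suc (Suc i)) @ v"
          using inter[OF g(2,3) QpS p0] i by force
        \<comment> \<open>An element of three consecutive cosets, compared with both ends of the
          middle factor, would split this factor.\<close>
        have "p (Suc i) @ h (Suc i) @ v \<approx> p (Suc i) @ u"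
          using eqv_trans[OF eqv_sym[OF v(2)] u(2)] p_Suc[of "Suc i"] by simp
        then have "h (Suc i) \<approx> u @ rev v" using eqv_cancel_left[of "p (Suc i)"] eqv_move_right by blast
        moreover have "(Suc i + n - 1) mod n = i" "(Suc i + 1) mod n = Suc (Suc i)" using i by auto
        ultimately show False using neg[of "Suc i" u "rev v"] u(1) v(1) i by simp
      qed
    qed
    interpret T: test L "chain_states n Q" "chain_rel n Q" "chain_step n Q \<alpha>"
      by (rule test_chain[OF ch])
    have s0: "(0, []) \<in> chain_states n Q" using n Qp[of "[]" 0] by (auto simp: chain_states_def p_def)
    have run: "(fold (chain_step n Q \<alpha>) (p (Suc m)) (0, []), (m, p (Suc m))) \<in> chain_rel n Q" if "m < n" for m
      using that
    proof (induction m)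
      case 0
      then show ?case
        using fold_chain_step[OF ch T.R_refl[OF s0], of "h 0"] h by (simp add: p_def)
    next
      case (Suc m)
      \<comment> \<open>The prefix \<open>p (Suc m)\<close> belongs to both neighbouring cosets;
        here the run passes from one to the next.\<close>
      have "((m, p (Suc m)), (Suc m, p (Suc m))) \<in> chain_rel n Q"
        using Suc.prems QpS[of m] Qp[of "[]" "Suc m"] by (auto simp: chain_rel_def adjacent_def)
      then have "(fold (chain_step n Q \<alpha>) (p (Suc m)) (0, []), (Suc m, p (Suc m))) \<in> chain_rel n Q"
        using T.R_trans Suc.IH Suc.prems Suc_lessD by blast
      then show ?case
        using fold_chain_step[OF ch, of _ "Suc m" "p (Suc m)" "h (Suc m)"] h Suc.prems
        by (simp add: p_Suc[of "Suc m"])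
    qed
    have "card (\<alpha> i) \<le> card L" if "i < n" for i using h that by (simp add: card_mono finite_L)
    then have "T.passes (p n)"
      using chain_passes[OF ch n(2) _ order_refl] K by (simp add: p_def)
    then have "((0, []), (n - 1, p n)) \<in> chain_rel n Q"
    proof -
      have "(fold (chain_step n Q \<alpha>) (p n) (0, []), (n - 1, p n)) \<in> chain_rel n Q"
        using run[of "n - 1"] n by simp
      moreover have "(fold (chain_step n Q \<alpha>) (p n) (0, []), (0, [])) \<in> chain_rel n Q"
        using \<open>T.passes (p n)\<close> s0 by (simp add: T.passes_def)
      ultimately show ?thesis using T.R_sym T.R_trans by blast
    qed
    then show False using n False by (auto simp: chain_rel_def adjacent_def)
  qed
qed

end

section \<open>Schreier graphs of walks\<close>

locale letter_graph = stable_words L c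
  for L :: "'l set" and c +
  fixes V :: "'v set" and jact :: "'l \<Rightarrow> 'v \<Rightarrow> 'v"
  assumes finite_V: "finite V" and card_V: "card V \<le> c"
    and jact_closed: "v \<in> V \<Longrightarrow> jact x v \<in> V"
    and jact_jact: "v \<in> V \<Longrightarrow> jact x (jact x v) = v"
    and jact_out: "v \<in> V \<Longrightarrow> x \<notin> L \<Longrightarrow> jact x v = v"
begin

text \<open>A letter that fixes a vertex has no edge there. Hence a word is a walk only if each of
  its letters moves the current vertex.\<close>

fun jwalk :: "'v \<Rightarrow> 'l list \<Rightarrow> bool" where
  "jwalk u [] \<longleftrightarrow> True"
| "jwalk u (x # p) \<longleftrightarrow> jact x u \<noteq> u \<and> jwalk (jact x u) p"

lemma fold_jact_closed: "u \<in> V \<Longrightarrow> fold jact p u \<in> V"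
  by (induction p arbitrary: u) (auto simp: jact_closed)

lemma jwalk_append: "jwalk u (p @ q) \<longleftrightarrow> jwalk u p \<and> jwalk (fold jact p u) q"
  by (induction p arbitrary: u) auto

lemma fold_jact_rev: "u \<in> V \<Longrightarrow> fold jact (rev p) (fold jact p u) = u"
  by (induction p arbitrary: u) (auto simp: jact_closed jact_jact)

lemma jwalk_rev: "u \<in> V \<Longrightarrow> jwalk u p \<Longrightarrow> jwalk (fold jact p u) (rev p)"
proof (induction p arbitrary: u)
  case (Cons x p)
  then have "fold jact (rev p) (fold jact p (jact x u)) = jact x u"
    using fold_jact_rev jact_closed by blast
  then show ?case using Cons jact_closed jact_jact[of u x] by (auto simp: jwalk_append)
qed simp

text \<open>The vertex set is itself a test with at most \<open>c\<close> states. This is the case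
  \<open>k = 0\<close>, in which the empty word is the only one to be checked in advance.\<close>

lemma fold_jact_kernel:
  assumes "r \<in> K" "v \<in> V"
  shows "fold jact r v = v"
proof -
  interpret T: test L V "Id_on V" jact
    by unfold_locales (auto simp: equiv_def refl_on_def sym_def trans_def jact_closed jact_jact jact_out)
  have "T.passes r"
  proof (rule test_passes[OF T.test_axioms, of 0 V id "\<lambda>_. {}" "\<lambda>_. []"])
    fix \<beta> z assume "\<beta> \<subseteq> L" "card \<beta> \<le> 0" "set z \<subseteq> \<beta>"
    then have "z = []" using finite_subset[OF _ finite_L] by auto
    then show "T.passes z" by (auto simp: T.passes_def)
  qed (use assms finite_V card_V in auto)
  then show ?thesis using assms by (auto simp: T.passes_def)
qed

lemma eqv_fold_jact:
  assumes "p \<approx> q" "v \<in> V"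
  shows "fold jact p v = fold jact q v"
proof -
  have "fold jact (rev q) (fold jact p v) = v"
    using fold_jact_kernel[of "p @ rev q" v] assms by (simp add: eqv_def)
  then have "fold jact q (fold jact (rev q) (fold jact p v)) = fold jact q v" by simp
  then show ?thesis using fold_jact_rev[of "fold jact p v" "rev q"] fold_jact_closed assms(2) by simp
qed

text \<open>
  A pair \<open>(u, w)\<close> stands for the point reached by the word \<open>w\<close> over \<open>\<gamma>\<close> from the vertex \<open>u\<close>, in the
  graph in which every \<open>\<gamma>\<close>-component of the letter graph is replaced by the Schreier graph of the
  group of its closed walks. The letters outside of \<open>\<gamma>\<close> act on the original vertices only.
\<close>

definition srel :: "'l set \<Rightarrow> (('v \<times> 'l list) \<times> ('v \<times> 'l list)) set" where
  "srel \<gamma> = {((u, w), (u', w')). u \<in> V \<and> u' \<in> V \<and> set w \<subseteq> \<gamma> \<and> set w' \<subseteq> \<gamma> \<and>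
     (\<exists>r. set r \<subseteq> \<gamma> \<and> jwalk u r \<and> fold jact r u = u' \<and> w \<approx> r @ w')}"

definition sstates :: "'l set \<Rightarrow> ('v \<times> 'l list) set" where
  "sstates \<gamma> = {(u, w). u \<in> V \<and> set w \<subseteq> \<gamma>}"

definition sstep :: "'l set \<Rightarrow> 'l \<Rightarrow> 'v \<times> 'l list \<Rightarrow> 'v \<times> 'l list" where
  "sstep \<gamma> x s =
     (if x \<in> \<gamma> then (fst s, snd s @ [x])
      else if \<exists>v. (s, (v, [])) \<in> srel \<gamma> then (jact x (SOME v. (s, (v, [])) \<in> srel \<gamma>), [])
      else s)"

lemma srelI:
  assumes "u \<in> V" "set w \<subseteq> \<gamma>" "set w' \<subseteq> \<gamma>" "set r \<subseteq> \<gamma>" "jwalk u r" "w \<approx> r @ w'"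
  shows "((u, w), (fold jact r u, w')) \<in> srel \<gamma>"
  using assms fold_jact_closed unfolding srel_def by blast

lemma srelE:
  assumes "((u, w), (u', w')) \<in> srel \<gamma>"
  obtains r where "u \<in> V" "u' \<in> V" "set w \<subseteq> \<gamma>" "set w' \<subseteq> \<gamma>" "set r \<subseteq> \<gamma>" "jwalk u r"
    "fold jact r u = u'" "w \<approx> r @ w'"
  using assms unfolding srel_def by blast

lemma srel_same: "u \<in> V \<Longrightarrow> set w \<subseteq> \<gamma> \<Longrightarrow> set w' \<subseteq> \<gamma> \<Longrightarrow> w \<approx> w' \<Longrightarrow> ((u, w), (u, w')) \<in> srel \<gamma>"
  using srelI[of u w \<gamma> w' "[]"] by simp

lemma equiv_srel: "equiv (sstates \<gamma>) (srel \<gamma>)"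
proof (rule equivI)
  show "srel \<gamma> \<subseteq> sstates \<gamma> \<times> sstates \<gamma>" by (auto simp: srel_def sstates_def)
  show "refl_on (sstates \<gamma>) (srel \<gamma>)"
    by (auto simp: refl_on_def sstates_def intro: srel_same)
  show "sym (srel \<gamma>)"
  proof (rule symI)
    fix s t assume "(s, t) \<in> srel \<gamma>"
    moreover obtain u w u' w' where [simp]: "s = (u, w)" "t = (u', w')" by (metis surj_pair)
    ultimately have "((u, w), (u', w')) \<in> srel \<gamma>" by simp
    then obtain r where r: "u \<in> V" "u' \<in> V" "set w \<subseteq> \<gamma>" "set w' \<subseteq> \<gamma>" "set r \<subseteq> \<gamma>"
      "jwalk u r" "fold jact r u = u'" "w \<approx> r @ w'" by (rule srelE)
    have "w' \<approx> rev r @ w" using eqv_sym[OF r(8)] by (simp only: eqv_move_left)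
    then have "((u', w'), (fold jact (rev r) u', w)) \<in> srel \<gamma>"
      using r jwalk_rev[OF r(1,6)] by (intro srelI) auto
    then show "(t, s) \<in> srel \<gamma>" using fold_jact_rev[OF r(1), of r] r(7) by simp
  qed
  show "trans (srel \<gamma>)"
  proof (rule transI)
    fix s t k assume "(s, t) \<in> srel \<gamma>" "(t, k) \<in> srel \<gamma>"
    moreover obtain u w u' w' v y where [simp]: "s = (u, w)" "t = (u', w')" "k = (v, y)" by (metis surj_pair)
    ultimately have st: "((u, w), (u', w')) \<in> srel \<gamma>" and tk: "((u', w'), (v, y)) \<in> srel \<gamma>" by simp_all
    obtain r where r: "u \<in> V" "set w \<subseteq> \<gamma>" "set r \<subseteq> \<gamma>"
      "jwalk u r" "fold jact r u = u'" "w \<approx> r @ w'" using st by (rule srelE)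
    obtain q where q: "set y \<subseteq> \<gamma>" "set q \<subseteq> \<gamma>"
      "jwalk u' q" "fold jact q u' = v" "w' \<approx> q @ y" using tk by (rule srelE)
    have "w \<approx> (r @ q) @ y" using eqv_trans[OF r(6) eqv_app2[OF q(5)]] by simp
    then have "((u, w), (fold jact (r @ q) u, y)) \<in> srel \<gamma>"
      using r q by (intro srelI) (auto simp: jwalk_append)
    then show "(s, k) \<in> srel \<gamma>" using r q by simp
  qed
qed

lemma srel_sym: "(s, t) \<in> srel \<gamma> \<Longrightarrow> (t, s) \<in> srel \<gamma>"
  using equiv_srel by (meson equivE symD)

lemma srel_trans: "(s, t) \<in> srel \<gamma> \<Longrightarrow> (t, k) \<in> srel \<gamma> \<Longrightarrow> (s, k) \<in> srel \<gamma>"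
  using equiv_srel by (meson equivE transD)

lemma srel_refl: "s \<in> sstates \<gamma> \<Longrightarrow> (s, s) \<in> srel \<gamma>"
  using equiv_srel by (meson equivE refl_onD)

lemma srel_states: "(s, t) \<in> srel \<gamma> \<Longrightarrow> s \<in> sstates \<gamma> \<and> t \<in> sstates \<gamma>"
  by (auto simp: srel_def sstates_def)

text \<open>Gluing does not merge vertices: a walk that connects them would have value 1, and such a
  word fixes every vertex.\<close>

lemma srel_vertex_unique:
  assumes "(s, (v, [])) \<in> srel \<gamma>" "(s, (v', [])) \<in> srel \<gamma>"
  shows "v = v'"
proof -
  have "((v, []), (v', [])) \<in> srel \<gamma>" using assms srel_sym srel_trans by blast
  then obtain r where "v \<in> V" "fold jact r v = v'" "[] \<approx> r @ []" by (rule srelE)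
  then show ?thesis using fold_jact_kernel[of r v] eqv_sym[of "[]" r] by (simp add: eqv_nil)
qed

lemma sstep_vertex:
  assumes "(s, (v, [])) \<in> srel \<gamma>" "x \<notin> \<gamma>"
  shows "sstep \<gamma> x s = (jact x v, [])"
proof -
  have "(SOME v. (s, (v, [])) \<in> srel \<gamma>) = v"
    using assms(1) srel_vertex_unique by (intro some_equality) auto
  then show ?thesis using assms by (auto simp: sstep_def)
qed

lemma sstep_stay: "x \<notin> \<gamma> \<Longrightarrow> (\<And>v. (s, (v, [])) \<notin> srel \<gamma>) \<Longrightarrow> sstep \<gamma> x s = s"
  by (simp add: sstep_def)

lemma srel_snoc:
  assumes "((u, w), (u', w')) \<in> srel \<gamma>" "set y \<subseteq> \<gamma>"
  shows "((u, w @ y), (u', w' @ y)) \<in> srel \<gamma>"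
proof -
  obtain r where r: "u \<in> V" "u' \<in> V" "set w \<subseteq> \<gamma>" "set w' \<subseteq> \<gamma>" "set r \<subseteq> \<gamma>" "jwalk u r"
    "fold jact r u = u'" "w \<approx> r @ w'" using assms(1) by (rule srelE)
  have "w @ y \<approx> r @ w' @ y" using eqv_app1[OF r(8), of y] by simp
  then have "((u, w @ y), (fold jact r u, w' @ y)) \<in> srel \<gamma>"
    using r assms(2) by (intro srelI) auto
  then show ?thesis using r by simp
qed

lemma test_schreier:
  assumes \<gamma>: "\<gamma> \<subseteq> L"
  shows "test L (sstates \<gamma>) (srel \<gamma>) (sstep \<gamma>)"
proof
  show "equiv (sstates \<gamma>) (srel \<gamma>)" by (rule equiv_srel)
  show "sstep \<gamma> x s \<in> sstates \<gamma>" if s: "s \<in> sstates \<gamma>" for s x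
  proof (cases "x \<in> \<gamma>")
    case True
    then show ?thesis using s by (auto simp: sstep_def sstates_def)
  next
    case out: False
    show ?thesis
    proof (cases "\<exists>v. (s, (v, [])) \<in> srel \<gamma>")
      case True
      then obtain v where v: "(s, (v, [])) \<in> srel \<gamma>" by blast
      then have "v \<in> V" by (auto simp: srel_def)
      then show ?thesis using sstep_vertex[OF v out] jact_closed by (simp add: sstates_def)
    next
      case False
      then show ?thesis using sstep_stay[OF out] s by simp
    qed
  qed
  show "(sstep \<gamma> x s, sstep \<gamma> x t) \<in> srel \<gamma>" if st: "(s, t) \<in> srel \<gamma>" for s t x
  proof (cases "x \<in> \<gamma>")
    case True
    obtain u w u' w' where [simp]: "s = (u, w)" "t = (u', w')" by (metis surj_pair)
    show ?thesis using srel_snoc[of u w u' w' \<gamma> "[x]"] st True by (simp add: sstep_def)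
  next
    case out: False
    show ?thesis
    proof (cases "\<exists>v. (s, (v, [])) \<in> srel \<gamma>")
      case True
      then obtain v where v: "(s, (v, [])) \<in> srel \<gamma>" by blast
      have v': "(t, (v, [])) \<in> srel \<gamma>" using v st srel_sym srel_trans by blast
      have "(jact x v, []) \<in> sstates \<gamma>" using srel_states[OF v] jact_closed by (auto simp: sstates_def)
      then show ?thesis using sstep_vertex[OF v out] sstep_vertex[OF v' out] srel_refl by simp
    next
      case False
      then have "(t, (v, [])) \<notin> srel \<gamma>" for v using st srel_trans by blast
      then show ?thesis using False sstep_stay[OF out] st by simp
    qed
  qed
  show "(sstep \<gamma> x (sstep \<gamma> x s), s) \<in> srel \<gamma>" if s: "s \<in> sstates \<gamma>" for s x
  proof (cases "x \<in> \<gamma>")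
    case True
    obtain u w where [simp]: "s = (u, w)" by (metis surj_pair)
    have "w @ [x, x] \<approx> w" using eqv_app2[of "[x, x]" "[]" w] square by (simp add: eqv_nil)
    then show ?thesis using s True by (auto simp: sstep_def sstates_def intro!: srel_same)
  next
    case out: False
    show ?thesis
    proof (cases "\<exists>v. (s, (v, [])) \<in> srel \<gamma>")
      case True
      then obtain v where v: "(s, (v, [])) \<in> srel \<gamma>" by blast
      have vV: "v \<in> V" using v by (auto simp: srel_def)
      have "((jact x v, []), (jact x v, [])) \<in> srel \<gamma>"
        using vV jact_closed by (intro srel_same) auto
      then have "sstep \<gamma> x (sstep \<gamma> x s) = (v, [])"
        using sstep_vertex[OF v out] sstep_vertex[OF _ out] jact_jact[OF vV] by metis
      then show ?thesis using srel_sym[OF v] by simp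
    next
      case False
      then show ?thesis using sstep_stay[OF out] srel_refl[OF s] by simp
    qed
  qed
  show "(sstep \<gamma> x s, s) \<in> srel \<gamma>" if s: "s \<in> sstates \<gamma>" and x: "x \<notin> L" for s x
  proof -
    have out: "x \<notin> \<gamma>" using \<gamma> x by blast
    show ?thesis
    proof (cases "\<exists>v. (s, (v, [])) \<in> srel \<gamma>")
      case True
      then obtain v where v: "(s, (v, [])) \<in> srel \<gamma>" by blast
      have vV: "v \<in> V" using v by (auto simp: srel_def)
      show ?thesis using sstep_vertex[OF v out] srel_sym[OF v] jact_out[OF vV x] by simp
    next
      case False
      then show ?thesis using sstep_stay[OF out] srel_refl[OF s] by simp
    qed
  qed
qed

abbreviation spasses :: "'l set \<Rightarrow> 'l list \<Rightarrow> bool" where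
  "spasses \<gamma> \<equiv> test.passes (sstates \<gamma>) (srel \<gamma>) (sstep \<gamma>)"

lemma fold_sstep_in: "set z \<subseteq> \<gamma> \<Longrightarrow> fold (sstep \<gamma>) z (u, w) = (u, w @ z)"
  by (induction z arbitrary: w) (auto simp: sstep_def)

lemma fold_sstep_jwalk:
  assumes "\<gamma> \<subseteq> L" "u \<in> V" "jwalk u p"
  shows "(fold (sstep \<gamma>) p (u, []), (fold jact p u, [])) \<in> srel \<gamma>"
  using assms(2,3)
proof (induction p arbitrary: u)
  case Nil
  then show ?case by (simp add: srel_same)
next
  case (Cons x p)
  interpret T: test L "sstates \<gamma>" "srel \<gamma>" "sstep \<gamma>" by (rule test_schreier[OF assms(1)])
  have u': "jact x u \<in> V" using Cons.prems(1) by (rule jact_closed)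
  have "(sstep \<gamma> x (u, []), (jact x u, [])) \<in> srel \<gamma>"
  proof (cases "x \<in> \<gamma>")
    case True
    have "((u, [x]), (fold jact [x] u, [])) \<in> srel \<gamma>"
      using True Cons.prems by (intro srelI) auto
    then show ?thesis using True by (simp add: sstep_def)
  next
    case False
    have "((u, []), (u, [])) \<in> srel \<gamma>" using Cons.prems(1) by (simp add: srel_same)
    then show ?thesis using sstep_vertex[OF _ False, of "(u, [])" u] u' by (simp add: srel_same)
  qed
  from T.fold_cong[OF this, of p] have
    "(fold (sstep \<gamma>) (x # p) (u, []), fold (sstep \<gamma>) p (jact x u, [])) \<in> srel \<gamma>" by simp
  then show ?case using Cons.IH[OF u'] Cons.prems(2) T.R_trans by auto
qed

text \<open>From \<open>(u, [])\<close> the word \<open>g\<close> leads to \<open>(u, g)\<close>,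
  whereas the walk \<open>p\<close> leads to its proper end point. As \<open>g @ rev p\<close>
  passes, both are the same point of the graph, and the definition of \<open>srel\<close> provides
  the walk over \<gamma>.\<close>

lemma jwalk_reduce_if_passes:
  assumes \<gamma>: "\<gamma> \<subseteq> L" and pass: "\<And>w. w \<in> K \<Longrightarrow> spasses \<gamma> w"
    and u: "u \<in> V" "jwalk u p" and g: "p \<approx> g" "set g \<subseteq> \<gamma>"
  shows "\<exists>q. set q \<subseteq> \<gamma> \<and> jwalk u q \<and> fold jact q u = fold jact p u \<and> q \<approx> p"
proof -
  interpret T: test L "sstates \<gamma>" "srel \<gamma>" "sstep \<gamma>" by (rule test_schreier[OF \<gamma>])
  have s: "(u, []) \<in> sstates \<gamma>" using u by (simp add: sstates_def)
  have "spasses \<gamma> (g @ rev p)" using pass g(1) eqv_sym unfolding eqv_def by blast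
  then have "(fold (sstep \<gamma>) (rev p) (u, g), (u, [])) \<in> srel \<gamma>"
    using s fold_sstep_in[OF g(2), of u "[]"] by (fastforce simp: T.passes_def)
  then have "(fold (sstep \<gamma>) p (fold (sstep \<gamma>) (rev p) (u, g)), fold (sstep \<gamma>) p (u, [])) \<in> srel \<gamma>"
    by (rule T.fold_cong)
  moreover have "(fold (sstep \<gamma>) p (fold (sstep \<gamma>) (rev p) (u, g)), (u, g)) \<in> srel \<gamma>"
    using T.fold_rev_fold[of "(u, g)" "rev p"] u g by (simp add: sstates_def)
  ultimately have "((u, g), (fold jact p u, [])) \<in> srel \<gamma>"
    using fold_sstep_jwalk[OF \<gamma> u] T.R_sym T.R_trans by blast
  then obtain r where "set r \<subseteq> \<gamma>" "jwalk u r" "fold jact r u = fold jact p u" "g \<approx> r @ []"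
    by (rule srelE)
  moreover from this have "r \<approx> p" using eqv_sym[OF eqv_trans[OF g(1)]] by simp
  ultimately show ?thesis by blast
qed

text \<open>By induction on the size of \<gamma>: a word over another set \<beta> of at most this
  size sees of \<gamma> only the letters in the intersection, and the graph for these passes
  already.\<close>

lemma schreier_passes:
  assumes "\<gamma> \<subseteq> L" "w \<in> K"
  shows "spasses \<gamma> w"
  using assms
proof (induction "card \<gamma>" arbitrary: \<gamma> w rule: less_induct)
  case less
  note \<gamma> = less.prems(1)
  interpret T: test L "sstates \<gamma>" "srel \<gamma>" "sstep \<gamma>" by (rule test_schreier[OF \<gamma>])
  show ?case
  proof (rule test_passes[OF T.test_axioms, of "card \<gamma>" V fst "\<lambda>_. \<gamma>" snd])
    show "card \<gamma> \<le> card L" using \<gamma> by (simp add: card_mono finite_L)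
    show "(s, t) \<in> srel \<gamma>"
      if "s \<in> sstates \<gamma>" "t \<in> sstates \<gamma>" "fst s = fst t" "snd s \<approx> snd t" for s t
      using that by (auto simp: sstates_def intro: srel_same)
    fix \<beta> z assume \<beta>: "\<beta> \<subseteq> L" "card \<beta> \<le> card \<gamma>" "set z \<subseteq> \<beta>" and z: "z \<in> K"
    show "T.passes z"
      unfolding T.passes_def
    proof
      fix s0 assume s0: "s0 \<in> sstates \<gamma>"
      obtain u w where s0_eq: "s0 = (u, w)" by (metis surj_pair)
      have uw: "u \<in> V" "set w \<subseteq> \<gamma>" using s0 by (auto simp: s0_eq sstates_def)
      show "(fold (sstep \<gamma>) z s0, s0) \<in> srel \<gamma>"
      proof (cases "\<beta> \<subseteq> \<gamma>")
        case True
        then have "set z \<subseteq> \<gamma>" using \<beta>(3) by blast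
        moreover have "w @ z \<approx> w" using eqv_app2[of z "[]" w] z by (simp add: eqv_nil)
        ultimately show ?thesis using uw by (auto simp: s0_eq fold_sstep_in intro!: srel_same)
      next
        case nsub: False
        define \<delta> where "\<delta> = \<beta> \<inter> \<gamma>"
        have \<delta>: "\<delta> \<subseteq> L" "\<delta> \<subseteq> \<gamma>" using \<gamma> by (auto simp: \<delta>_def)
        have "card \<delta> < card \<beta>"
          unfolding \<delta>_def by (rule psubset_card_mono) (use \<beta>(1) finite_L finite_subset nsub in blast)+
        then have pass: "spasses \<delta> w" if "w \<in> K" for w
          using less.hyps[of \<delta> w] \<beta>(2) \<delta>(1) that by simp
        interpret D: test L "sstates \<delta>" "srel \<delta>" "sstep \<delta>" by (rule test_schreier[OF \<delta>(1)])
        have sub: "(s, t) \<in> srel \<gamma>" if "(s, t) \<in> srel \<delta>" for s t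
          using that \<delta>(2) unfolding srel_def by blast
        \<comment> \<open>Gluing over \<gamma> identifies no more \<delta>-states than gluing over
          \<delta>: the connecting walk has a value over \<delta> and can be replaced by a walk over
          \<delta>, by the induction hypothesis.\<close>
        have restr: "(s, t) \<in> srel \<delta>"
          if st: "(s, t) \<in> srel \<gamma>" "s \<in> sstates \<delta>" "t \<in> sstates \<delta>" for s t
        proof -
          obtain v y v' y' where eq: "s = (v, y)" "t = (v', y')" by (metis surj_pair)
          have y: "set y \<subseteq> \<delta>" "set y' \<subseteq> \<delta>" using st(2,3) by (auto simp: eq sstates_def)
          obtain r where r: "v \<in> V" "jwalk v r" "fold jact r v = v'" "y \<approx> r @ y'"
            using st(1) unfolding eq by (rule srelE)
          have "r \<approx> y @ rev y'" using eqv_sym[OF r(4)] by (simp only: eqv_move_right)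
          then obtain q where q: "set q \<subseteq> \<delta>" "jwalk v q" "fold jact q v = v'" "q \<approx> r"
            using jwalk_reduce_if_passes[OF \<delta>(1) pass r(1,2), of "y @ rev y'"] y r(3) by auto
          have "y \<approx> q @ y'" using eqv_trans[OF r(4) eqv_app1[OF eqv_sym[OF q(4)]]] .
          then show ?thesis using srelI[OF r(1) y q(1,2)] q(3) by (simp add: eq)
        qed
        show ?thesis
        proof (cases "\<exists>b v. set b \<subseteq> \<delta> \<and> ((u, w @ b), (v, [])) \<in> srel \<gamma>")
          case True
          then obtain b v where b: "set b \<subseteq> \<delta>" "((u, w @ b), (v, [])) \<in> srel \<gamma>" by blast
          \<comment> \<open>Retracting \<open>b\<close> from the vertex shows that \<open>s0\<close>
            is glued to a \<delta>-state, and from there the letters of \<beta> act alike in both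
            graphs.\<close>
          define t0 where "t0 = (v, rev b)"
          have "set (rev b) \<subseteq> \<gamma>" using b(1) \<delta>(2) by auto
          from srel_snoc[OF b(2) this] have 1: "((u, w @ b @ rev b), t0) \<in> srel \<gamma>" by (simp add: t0_def)
          have "w \<approx> w @ b @ rev b"
            using eqv_app2[of "[]" "b @ rev b" w] eqv_sym[of "b @ rev b" "[]"] app_rev[of b]
            by (simp add: eqv_nil)
          moreover have "set (w @ b @ rev b) \<subseteq> \<gamma>" using uw(2) b(1) \<delta>(2) by auto
          ultimately have "(s0, (u, w @ b @ rev b)) \<in> srel \<gamma>"
            unfolding s0_eq by (intro srel_same uw)
          then have st: "(s0, t0) \<in> srel \<gamma>" using 1 by (rule srel_trans)
          have t0: "t0 \<in> sstates \<delta>" using b by (auto simp: t0_def sstates_def srel_def)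
          have step: "sstep \<gamma> x t = sstep \<delta> x t" if t: "t \<in> sstates \<delta>" and x: "x \<in> \<beta>" for t x
          proof (cases "x \<in> \<gamma>")
            case True
            then show ?thesis using x by (simp add: sstep_def \<delta>_def)
          next
            case out: False
            then have out': "x \<notin> \<delta>" by (simp add: \<delta>_def)
            show ?thesis
            proof (cases "\<exists>v. (t, (v, [])) \<in> srel \<gamma>")
              case True
              then obtain v where v: "(t, (v, [])) \<in> srel \<gamma>" by blast
              then have "(v, []) \<in> sstates \<delta>" by (auto simp: srel_def sstates_def)
              then show ?thesis using sstep_vertex[OF v out] sstep_vertex[OF restr[OF v t] out'] by simp
            next
              case False
              then show ?thesis using sstep_stay[OF out, of t] sstep_stay[OF out', of t] sub by metis
            qed
          qed
          have "fold (sstep \<gamma>) y t = fold (sstep \<delta>) y t" if "t \<in> sstates \<delta>" "set y \<subseteq> \<beta>" for t y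
            using that by (induction y arbitrary: t) (auto simp: step D.step_closed)
          then have "(fold (sstep \<gamma>) z t0, t0) \<in> srel \<gamma>"
            using sub pass[OF z] t0 \<beta>(3) by (simp add: D.passes_def)
          then show ?thesis using T.fold_cong[OF st, of z] st T.R_sym T.R_trans by blast
        next
          case False
          \<comment> \<open>No original vertex is ever met, so the letters outside of \<gamma> do
            nothing. Thus \<open>z\<close> acts by its retraction to \<gamma>, which has value
            1.\<close>
          have "fold (sstep \<gamma>) y (u, w @ b) = (u, w @ b @ filter (\<lambda>x. x \<in> \<gamma>) y)"
            if "set y \<subseteq> \<beta>" "set b \<subseteq> \<delta>" for y b
            using that
          proof (induction y arbitrary: b)
            case (Cons x y)
            show ?case
            proof (cases "x \<in> \<gamma>")
              case True
              then have "set (b @ [x]) \<subseteq> \<delta>" using Cons.prems by (auto simp: \<delta>_def)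
              then show ?thesis using Cons.IH[of "b @ [x]"] Cons.prems True by (simp add: sstep_def)
            next
              case out: False
              have "sstep \<gamma> x (u, w @ b) = (u, w @ b)"
                by (rule sstep_stay[OF out]) (use False Cons.prems in blast)
              then show ?thesis using Cons out by simp
            qed
          qed simp
          from this[OF \<beta>(3), of "[]"] have "fold (sstep \<gamma>) z s0 = (u, w @ filter (\<lambda>x. x \<in> \<gamma>) z)"
            by (simp add: s0_eq)
          moreover have "w @ filter (\<lambda>x. x \<in> \<gamma>) z \<approx> w"
            using eqv_app2[of "filter (\<lambda>x. x \<in> \<gamma>) z" "[]" w] retract[OF z] by (simp add: eqv_nil)
          ultimately show ?thesis using uw by (auto simp: s0_eq intro!: srel_same)
        qed
      qed
    qed
  qed (use less.prems finite_V card_V in \<open>auto simp: sstates_def\<close>)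
qed

lemma jwalk_reduce:
  assumes "\<gamma> \<subseteq> L" "u \<in> V" "jwalk u p" "p \<approx> g" "set g \<subseteq> \<gamma>"
  obtains q where "set q \<subseteq> \<gamma>" "jwalk u q" "fold jact q u = fold jact p u" "q \<approx> p"
  using jwalk_reduce_if_passes[OF assms(1) schreier_passes[OF assms(1)] assms(2-)] by blast

text \<open>A word over \<delta> may leave the original vertices, but only by letters common to
  \<gamma> and \<delta>. Whenever it returns to a vertex, the excursion is replaced by a walk over
  these common letters.\<close>

lemma fold_sstep_vertex:
  assumes \<gamma>: "\<gamma> \<subseteq> L" and \<delta>: "\<delta> \<subseteq> L" and v: "v \<in> V" and d: "set d \<subseteq> \<delta>"
  shows "\<exists>q s. set q \<subseteq> \<delta> \<and> jwalk v q \<and> set s \<subseteq> \<gamma> \<inter> \<delta> \<and>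
    (fold (sstep \<gamma>) d (v, []), (fold jact q v, s)) \<in> srel \<gamma>"
  using d
proof (induction d rule: rev_induct)
  case Nil
  then show ?case using v by (intro exI[of _ "[]"]) (simp add: srel_same)
next
  case (snoc x d)
  interpret T: test L "sstates \<gamma>" "srel \<gamma>" "sstep \<gamma>" by (rule test_schreier[OF \<gamma>])
  obtain q s where q: "set q \<subseteq> \<delta>" "jwalk v q" "set s \<subseteq> \<gamma> \<inter> \<delta>"
    "(fold (sstep \<gamma>) d (v, []), (fold jact q v, s)) \<in> srel \<gamma>" using snoc by auto
  define t where "t = fold jact q v"
  have t: "t \<in> V" using v fold_jact_closed by (simp add: t_def)
  have step: "(fold (sstep \<gamma>) (d @ [x]) (v, []), sstep \<gamma> x (t, s)) \<in> srel \<gamma>"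
    using T.step_cong[OF q(4)] by (simp add: t_def)
  show ?case
  proof (cases "x \<in> \<gamma>")
    case True
    then have "sstep \<gamma> x (t, s) = (fold jact q v, s @ [x])" by (simp add: sstep_def t_def)
    moreover have "set (s @ [x]) \<subseteq> \<gamma> \<inter> \<delta>" using True q(3) snoc.prems by simp
    ultimately show ?thesis using step q(1,2) by metis
  next
    case out: False
    show ?thesis
    proof (cases "\<exists>v'. ((t, s), (v', [])) \<in> srel \<gamma>")
      case True
      then obtain v' where v': "((t, s), (v', [])) \<in> srel \<gamma>" by blast
      then obtain r where r: "jwalk t r" "fold jact r t = v'" "s \<approx> r @ []" by (rule srelE)
      have "r \<approx> s" using eqv_sym[OF r(3)] by simp
      \<comment> \<open>The connecting walk \<open>r\<close> over \<gamma> has the value of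
        \<open>s\<close>, a word over the common letters.\<close>
      then obtain q' where q': "set q' \<subseteq> \<gamma> \<inter> \<delta>" "jwalk t q'" "fold jact q' t = v'"
        using jwalk_reduce[OF _ t r(1), of "\<gamma> \<inter> \<delta>" s] \<gamma> q(3) r(2) by (metis le_infI1)
      have v'V: "v' \<in> V" using v' by (auto simp: srel_def)
      have s1: "sstep \<gamma> x (t, s) = (jact x v', [])" by (rule sstep_vertex[OF v' out])
      show ?thesis
      proof (cases "jact x v' = v'")
        case True
        then have "sstep \<gamma> x (t, s) = (fold jact (q @ q') v, [])" using s1 q' by (simp add: t_def)
        moreover have "jwalk v (q @ q')" "set (q @ q') \<subseteq> \<delta>"
          using q q' by (auto simp: jwalk_append t_def)
        ultimately show ?thesis using step by (metis empty_subsetI list.set(1))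
      next
        case False
        then have "sstep \<gamma> x (t, s) = (fold jact (q @ q' @ [x]) v, [])" using s1 q' by (simp add: t_def)
        moreover have "jwalk v (q @ q' @ [x])" "set (q @ q' @ [x]) \<subseteq> \<delta>"
          using q q' snoc.prems False by (auto simp: jwalk_append t_def)
        ultimately show ?thesis using step by (metis empty_subsetI list.set(1))
      qed
    next
      case False
      then have "sstep \<gamma> x (t, s) = (fold jact q v, s)" using sstep_stay[OF out, of "(t, s)"] by (simp add: t_def)
      then show ?thesis using step q by metis
    qed
  qed
qed

text \<open>In the graph for \<gamma>, the word \<open>g\<close> from \<open>u\<close> and the word
  \<open>rev d\<close> from the end of \<open>p\<close> meet. This yields a vertex \<open>t\<close>
  reached from \<open>u\<close> over \<gamma> and from the end of \<open>p\<close> over \<delta>.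
  What is left is a closed walk at \<open>t\<close> with a value over \<delta>, to which
  \<open>jwalk_reduce\<close> applies.\<close>

lemma jwalk_factor:
  assumes \<gamma>: "\<gamma> \<subseteq> L" and \<delta>: "\<delta> \<subseteq> L" and u: "u \<in> V" "jwalk u p"
    and p: "p \<approx> g @ d" "set g \<subseteq> \<gamma>" "set d \<subseteq> \<delta>"
  obtains q1 q2 where "set q1 \<subseteq> \<gamma>" "set q2 \<subseteq> \<delta>" "jwalk u (q1 @ q2)"
    "fold jact (q1 @ q2) u = fold jact p u" "q1 @ q2 \<approx> p"
proof -
  interpret T: test L "sstates \<gamma>" "srel \<gamma>" "sstep \<gamma>" by (rule test_schreier[OF \<gamma>])
  define v where "v = fold jact p u"
  have v: "v \<in> V" using u fold_jact_closed by (simp add: v_def)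
  have s: "(u, []) \<in> sstates \<gamma>" using u by (simp add: sstates_def)
  obtain q s where q: "set q \<subseteq> \<delta>" "jwalk v q" "set s \<subseteq> \<gamma> \<inter> \<delta>"
    "(fold (sstep \<gamma>) (rev d) (v, []), (fold jact q v, s)) \<in> srel \<gamma>"
    using fold_sstep_vertex[OF \<gamma> \<delta> v, of "rev d"] p(3) by auto
  define t where "t = fold jact q v"
  have "(g @ d) @ rev p \<in> K" using eqv_sym[OF p(1)] by (simp add: eqv_def)
  then have "(fold (sstep \<gamma>) (rev (p @ rev d)) (fold (sstep \<gamma>) g (u, [])), (u, [])) \<in> srel \<gamma>"
    using schreier_passes[OF \<gamma>] s by (fastforce simp: T.passes_def)
  then have "(fold (sstep \<gamma>) (p @ rev d) (fold (sstep \<gamma>) (rev (p @ rev d)) (u, g)),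
      fold (sstep \<gamma>) (p @ rev d) (u, [])) \<in> srel \<gamma>"
    using fold_sstep_in[OF p(2), of u "[]"] T.fold_cong by simp
  moreover have "(fold (sstep \<gamma>) (p @ rev d) (fold (sstep \<gamma>) (rev (p @ rev d)) (u, g)), (u, g)) \<in> srel \<gamma>"
    using T.fold_rev_fold[of "(u, g)" "rev (p @ rev d)"] u p(2) by (simp add: sstates_def)
  ultimately have "((u, g), fold (sstep \<gamma>) (rev d) (fold (sstep \<gamma>) p (u, []))) \<in> srel \<gamma>"
    unfolding fold_append comp_def using T.R_sym T.R_trans by blast
  moreover have "(fold (sstep \<gamma>) (rev d) (fold (sstep \<gamma>) p (u, [])), fold (sstep \<gamma>) (rev d) (v, [])) \<in> srel \<gamma>"
    using fold_sstep_jwalk[OF \<gamma> u] unfolding v_def by (rule T.fold_cong)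
  ultimately have "((u, g), (t, s)) \<in> srel \<gamma>"
    using q(4) T.R_trans unfolding t_def by blast
  then obtain r where r: "set r \<subseteq> \<gamma>" "jwalk u r" "fold jact r u = t" "g \<approx> r @ s" by (rule srelE)
  have t: "t \<in> V" using v fold_jact_closed by (simp add: t_def)
  \<comment> \<open>From \<open>t\<close> back to \<open>u\<close>, along \<open>p\<close>, and over
    \<delta> to \<open>t\<close> again. By \<open>g \<approx> r @ s\<close> its value is that of
    \<open>(s @ d) @ q\<close>.\<close>
  define p' where "p' = rev r @ p @ q"
  have walk: "jwalk t p'"
    using jwalk_rev[OF u(1) r(2)] fold_jact_rev[OF u(1), of r] r(3) u(2) q(2)
    by (simp add: p'_def jwalk_append v_def)
  have end': "fold jact p' t = t"
    using fold_jact_rev[OF u(1), of r] r(3) by (simp add: p'_def v_def t_def)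
  have "p \<approx> r @ (s @ d)" using eqv_trans[OF p(1) eqv_app1[OF r(4), of d]] by simp
  then have 1: "rev r @ p \<approx> s @ d" using eqv_sym eqv_move_left by metis
  then have "p' \<approx> (s @ d) @ q" using eqv_app1[OF 1, of q] by (simp add: p'_def)
  moreover have "set ((s @ d) @ q) \<subseteq> \<delta>" using q p(3) by auto
  ultimately obtain q' where q': "set q' \<subseteq> \<delta>" "jwalk t q'" "fold jact q' t = t" "q' \<approx> p'"
    using jwalk_reduce[OF \<delta> t walk] end' by metis
  have "r @ q' @ rev q \<approx> p"
  proof -
    have "r @ q' \<approx> r @ rev r @ p @ q" using eqv_app2[OF q'(4), of r] by (simp add: p'_def)
    also have "r @ rev r @ p @ q \<approx> p @ q"
      using eqv_app1[of "r @ rev r" "[]" "p @ q"] app_rev[of r] by (simp add: eqv_nil)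
    finally have "r @ q' \<approx> p @ q" .
    then have "(r @ q') @ rev q \<approx> p"
      by (simp only: eqv_move_right rev_rev_ident)
    then show ?thesis by simp
  qed
  moreover have "jwalk u (r @ q' @ rev q)"
    using r(2,3) q'(2,3) jwalk_rev[OF v q(2)] by (simp add: jwalk_append t_def)
  moreover have "fold jact (r @ q' @ rev q) u = v"
    using r(3) q'(3) fold_jact_rev[OF v, of q] by (simp add: t_def)
  moreover have "set (q' @ rev q) \<subseteq> \<delta>" using q'(1) q(1) by simp
  ultimately show thesis using that[of r "q' @ rev q"] r(1) by (simp add: v_def)
qed

end

section \<open>Walks and their partial isomorphisms\<close>

definition winv :: "('s, 'e) incidence \<Rightarrow> 'e list \<Rightarrow> 'e list" where
  "winv I w = rev (map (linv I) w)"

locale incidence =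
  fixes I :: "('s, 'e) incidence"
  assumes inc: "incidence_pattern I"
begin

lemma link:
  assumes "e \<in> links I"
  shows "src I e \<in> sites I" "tgt I e \<in> sites I" "linv I e \<in> links I" "linv I (linv I e) = e"
    "src I (linv I e) = tgt I e" "tgt I (linv I e) = src I e"
proof -
  show "src I e \<in> sites I" "tgt I e \<in> sites I" "linv I e \<in> links I" "linv I (linv I e) = e"
    "src I (linv I e) = tgt I e"
    using inc assms by (simp_all add: incidence_pattern_def)
  then show "tgt I (linv I e) = src I e"
    using inc by (metis incidence_pattern_def)
qed

lemma walk_sites: "walk I s w s' \<Longrightarrow> s \<in> sites I \<and> s' \<in> sites I"
  by (induction w arbitrary: s) (auto simp: link)

lemma walk_append: "walk I s (u @ w) s' \<longleftrightarrow> (\<exists>t. walk I s u t \<and> walk I t w s')"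
  by (induction u arbitrary: s) (auto dest: walk_sites)

lemma walk_winv: "walk I s w s' \<Longrightarrow> walk I s' (winv I w) s"
proof (induction w arbitrary: s)
  case (Cons e w)
  then have "walk I (tgt I e) [linv I e] s" by (auto simp: link)
  then show ?case using Cons by (auto simp: winv_def walk_append)
qed (simp add: winv_def)

lemma walk_links: "walk I s w s' \<Longrightarrow> set w \<subseteq> links I"
  by (induction w arbitrary: s) auto

lemma winv_winv: "set w \<subseteq> links I \<Longrightarrow> winv I (winv I w) = w"
  by (induction w) (auto simp: winv_def link)

end

locale pattern_cover =
  fixes \<sigma> :: "'r signature" and P :: "('h, 's, 'e, 'r) pattern" and N :: nat
  assumes pat: "amalgamation_pattern \<sigma> P" and fin: "finite_pattern P" and N: "2 \<le> N"
begin

abbreviation "I \<equiv> inc P"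
abbreviation "H \<equiv> univ (str P)"

sublocale incidence I
  using pat by unfold_locales (simp add: amalgamation_pattern_def)

lemma finite_inc: "finite (sites I)" "finite (links I)"
  using inc by (simp_all add: incidence_pattern_def)

lemma univ_part: "univ (part P s) = {a \<in> H. delta P a = s}"
  by (auto simp: Defs.part_def Defs.induced_def)

lemma delta_sites: "a \<in> H \<Longrightarrow> delta P a \<in> sites I"
  using pat by (simp add: amalgamation_pattern_def)

lemma rho_iso:
  assumes "e \<in> links I"
  shows "partial_isomorphism \<sigma> (rho P e) (part P (src I e)) (part P (tgt I e))"
  using pat assms by (simp add: amalgamation_pattern_def)

lemma rho_linv: "e \<in> links I \<Longrightarrow> rho P (linv I e) = (rho P e)\<inverse>"
  using pat by (simp add: amalgamation_pattern_def)

lemma rho: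
  assumes "e \<in> links I"
  shows "rho P e \<subseteq> univ (part P (src I e)) \<times> univ (part P (tgt I e))"
    "single_valued (rho P e)" "single_valued ((rho P e)\<inverse>)"
  using rho_iso[OF assms] by (auto simp: partial_isomorphism_def isomorphism_def)

lemma rho_H: "e \<in> links I \<Longrightarrow> rho P e \<subseteq> H \<times> H"
  using rho(1)[of e] by (auto simp: univ_part)

section \<open>Extension of partial injections to permutations\<close>

text \<open>
  A partial injection \<open>r\<close> acts as \<open>r\<close> on the first copy of \<open>H\<close> and as its inverse on the second
  one; points without image change the copy. The inverse of the result belongs to \<open>r\<inverse>\<close>.
\<close>

definition ext :: "('h \<times> 'h) set \<Rightarrow> 'h \<times> bool \<Rightarrow> 'h \<times> bool" where
  "ext r p = (case p of (a, b) \<Rightarrow>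
     if a \<notin> H then (a, b)
     else if \<not> b then (if a \<in> Domain r then (THE c. (a, c) \<in> r, False) else (a, True))
     else (if a \<in> Range r then (THE c. (c, a) \<in> r, True) else (a, False)))"

definition partial_injection :: "('h \<times> 'h) set \<Rightarrow> bool" where
  "partial_injection r \<longleftrightarrow> r \<subseteq> H \<times> H \<and> single_valued r \<and> single_valued (r\<inverse>)"

lemma partial_injection_rho: "e \<in> links I \<Longrightarrow> partial_injection (rho P e)"
  using rho rho_H by (simp add: partial_injection_def)

lemma partial_injection_converse: "partial_injection r \<Longrightarrow> partial_injection (r\<inverse>)"
  by (auto simp: partial_injection_def)

lemma ext_simps:
  assumes "partial_injection r"
  shows "(a, c) \<in> r \<Longrightarrow> ext r (a, False) = (c, False)"
    "(c, a) \<in> r \<Longrightarrow> ext r (a, True) = (c, True)"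
    "a \<in> H \<Longrightarrow> a \<notin> Domain r \<Longrightarrow> ext r (a, False) = (a, True)"
    "a \<in> H \<Longrightarrow> a \<notin> Range r \<Longrightarrow> ext r (a, True) = (a, False)"
    "a \<notin> H \<Longrightarrow> ext r (a, b) = (a, b)"
proof -
  have "(THE c. (a, c) \<in> r) = c" if "(a, c) \<in> r" for a c
    using assms that unfolding partial_injection_def single_valued_def by blast
  moreover have "(THE c. (c, a) \<in> r) = c" if "(c, a) \<in> r" for a c
    using assms that unfolding partial_injection_def single_valued_def by blast
  ultimately show "(a, c) \<in> r \<Longrightarrow> ext r (a, False) = (c, False)"
    "(c, a) \<in> r \<Longrightarrow> ext r (a, True) = (c, True)"
    "a \<in> H \<Longrightarrow> a \<notin> Domain r \<Longrightarrow> ext r (a, False) = (a, True)"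
    "a \<in> H \<Longrightarrow> a \<notin> Range r \<Longrightarrow> ext r (a, True) = (a, False)"
    "a \<notin> H \<Longrightarrow> ext r (a, b) = (a, b)"
    using assms by (auto simp: ext_def partial_injection_def)
qed

lemma ext_converse:
  assumes r: "partial_injection r"
  shows "ext (r\<inverse>) (ext r p) = p"
proof -
  note s = ext_simps[OF r] and s' = ext_simps[OF partial_injection_converse[OF r]]
  obtain a b where p: "p = (a, b)" by (metis surj_pair)
  have H: "c \<in> H" if "c \<in> Domain r \<or> c \<in> Range r" for c
    using r that by (auto simp: partial_injection_def)
  show ?thesis
  proof (cases "a \<in> H")
    case False
    then show ?thesis using s(5)[of a b] s'(5)[of a b] by (simp add: p)
  next
    case a: True
    show ?thesis
    proof (cases b)
      case True
      show ?thesis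
      proof (cases "a \<in> Range r")
        case True
        then obtain c where "(c, a) \<in> r" by blast
        then show ?thesis using s(2)[of c a] s'(2)[of a c] \<open>b\<close> by (simp add: p)
      next
        case False
        then show ?thesis using s(4)[OF a] s'(3)[OF a] \<open>b\<close> by (simp add: p)
      qed
    next
      case False
      show ?thesis
      proof (cases "a \<in> Domain r")
        case True
        then obtain c where "(a, c) \<in> r" by blast
        then show ?thesis using s(1)[of a c] s'(1)[of c a] \<open>\<not> b\<close> by (simp add: p)
      next
        case False
        then show ?thesis using s(3)[OF a] s'(4)[OF a] \<open>\<not> b\<close> by (simp add: p)
      qed
    qed
  qed
qed

abbreviation "M \<equiv> H \<times> (UNIV :: bool set)"

lemma ext_permutes:
  assumes r: "partial_injection r"
  shows "ext r permutes M"
proof (rule bij_imp_permutes)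
  have M: "ext r p \<in> M" if p: "p \<in> M" and r: "partial_injection r" for p r
  proof -
    note s = ext_simps[OF r]
    have H: "c \<in> H" if "(a, c) \<in> r \<or> (c, a) \<in> r" for a c
      using r that by (auto simp: partial_injection_def)
    obtain a b where ab: "p = (a, b)" "a \<in> H" using p by blast
    show ?thesis
    proof (cases "if b then a \<in> Range r else a \<in> Domain r")
      case True
      then obtain c where "if b then (c, a) \<in> r else (a, c) \<in> r" by (cases b) auto
      then show ?thesis using s(1)[of a c] s(2)[of c a] H[of a c] ab by (cases b) auto
    next
      case False
      then show ?thesis using s(3,4)[OF ab(2)] ab by (cases b) auto
    qed
  qed
  show "bij_betw (ext r) M M"
  proof (rule bij_betw_byWitness[of _ "ext (r\<inverse>)"])
    show "\<forall>p\<in>M. ext (r\<inverse>) (ext r p) = p" using ext_converse[OF r] by blast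
    show "\<forall>p\<in>M. ext r (ext (r\<inverse>) p) = p"
      using ext_converse[OF partial_injection_converse[OF r]] by simp
    show "ext r ` M \<subseteq> M" "ext (r\<inverse>) ` M \<subseteq> M"
      using M r partial_injection_converse[OF r] by blast+
  qed
  show "ext r p = p" if "p \<notin> M" for p
    using that ext_simps(5)[OF r] by (cases p) auto
qed

text \<open>Acts alike on the two copies, hence respects the change of copy in
  \<open>ext\<close>.\<close>

definition hat :: "('h \<Rightarrow> 'h) \<Rightarrow> 'h \<times> bool \<Rightarrow> 'h \<times> bool" where
  "hat \<pi> p = (if fst p \<in> H then (\<pi> (fst p), snd p) else p)"

lemma hat_permutes:
  assumes "bij_betw \<pi> H H"
  shows "hat \<pi> permutes M"
proof (rule bij_imp_permutes)
  have "inj_on (hat \<pi>) M" using assms by (auto simp: inj_on_def hat_def bij_betw_def)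
  moreover have "hat \<pi> ` M = M"
  proof
    show "hat \<pi> ` M \<subseteq> M" using assms by (auto simp: hat_def bij_betw_def)
    show "M \<subseteq> hat \<pi> ` M"
    proof
      fix p assume p: "p \<in> M"
      then have "fst p \<in> \<pi> ` H" using assms by (auto simp: bij_betw_def)
      then obtain a where "a \<in> H" "fst p = \<pi> a" by blast
      then show "p \<in> hat \<pi> ` M" by (intro image_eqI[of _ _ "(a, snd p)"]) (auto simp: hat_def prod_eq_iff)
    qed
  qed
  ultimately show "bij_betw (hat \<pi>) M M" by (simp add: bij_betw_def)
qed (auto simp: hat_def)

text \<open>\<open>ext\<close> involves no choice, so it is natural under bijections of the
  universe. This is what lets symmetries of the pattern act on the covering graph.\<close>

lemma ext_hat:
  assumes r: "partial_injection r" and \<pi>: "bij_betw \<pi> H H"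
  shows "ext (map_prod \<pi> \<pi> ` r) (hat \<pi> p) = hat \<pi> (ext r p)"
proof -
  have inj: "\<pi> x = \<pi> y \<longleftrightarrow> x = y" if "x \<in> H" "y \<in> H" for x y
    using \<pi> that by (auto simp: bij_betw_def inj_on_def)
  have rH: "c \<in> H \<and> d \<in> H" if "(c, d) \<in> r" for c d using r that by (auto simp: partial_injection_def)
  have r': "partial_injection (map_prod \<pi> \<pi> ` r)"
    unfolding partial_injection_def
  proof (intro conjI)
    show "map_prod \<pi> \<pi> ` r \<subseteq> H \<times> H" using rH \<pi> by (auto simp: bij_betw_def)
    show "single_valued (map_prod \<pi> \<pi> ` r)"
    proof (rule single_valuedI)
      fix x y z assume "(x, y) \<in> map_prod \<pi> \<pi> ` r" "(x, z) \<in> map_prod \<pi> \<pi> ` r"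
      then obtain u1 u2 t1 t2 where u: "(u1, u2) \<in> r" "(t1, t2) \<in> r" "\<pi> u1 = \<pi> t1" "y = \<pi> u2" "z = \<pi> t2"
        by auto
      then have "u1 = t1" using inj rH by blast
      then have "u2 = t2" using r u(1,2) by (auto simp: partial_injection_def single_valued_def)
      then show "y = z" using u by simp
    qed
    show "single_valued ((map_prod \<pi> \<pi> ` r)\<inverse>)"
    proof (rule single_valuedI)
      fix x y z assume "(x, y) \<in> (map_prod \<pi> \<pi> ` r)\<inverse>" "(x, z) \<in> (map_prod \<pi> \<pi> ` r)\<inverse>"
      then obtain u1 u2 t1 t2 where u: "(u1, u2) \<in> r" "(t1, t2) \<in> r" "\<pi> u2 = \<pi> t2" "y = \<pi> u1" "z = \<pi> t1"
        by auto
      then have "u2 = t2" using inj rH by blast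
      then have "u1 = t1" using r u(1,2) by (auto simp: partial_injection_def single_valued_def)
      then show "y = z" using u by simp
    qed
  qed
  note s = ext_simps[OF r] and s' = ext_simps[OF r']
  obtain a b where p: "p = (a, b)" by (metis surj_pair)
  show ?thesis
  proof (cases "a \<in> H")
    case False
    then show ?thesis using s(5)[of a b] s'(5)[of a b] by (simp add: p hat_def)
  next
    case a: True
    have \<pi>a: "\<pi> a \<in> H" using a \<pi> by (auto simp: bij_betw_def)
    show ?thesis
    proof (cases b)
      case True
      show ?thesis
      proof (cases "a \<in> Range r")
        case True
        then obtain c where c: "(c, a) \<in> r" by blast
        then have "(\<pi> c, \<pi> a) \<in> map_prod \<pi> \<pi> ` r" by force
        then show ?thesis using s(2)[OF c] s'(2)[of "\<pi> c" "\<pi> a"] \<open>b\<close> a rH[OF c] by (simp add: p hat_def)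
      next
        case False
        have "\<pi> a \<notin> Range (map_prod \<pi> \<pi> ` r)"
        proof
          assume "\<pi> a \<in> Range (map_prod \<pi> \<pi> ` r)"
          then obtain u1 u2 where u: "(u1, u2) \<in> r" "\<pi> a = \<pi> u2" by auto
          then have "a = u2" using inj a rH by blast
          then show False using False u by blast
        qed
        then show ?thesis using s(4)[OF a False] s'(4)[OF \<pi>a] \<open>b\<close> a by (simp add: p hat_def)
      qed
    next
      case False
      show ?thesis
      proof (cases "a \<in> Domain r")
        case True
        then obtain c where c: "(a, c) \<in> r" by blast
        then have "(\<pi> a, \<pi> c) \<in> map_prod \<pi> \<pi> ` r" by force
        then show ?thesis using s(1)[OF c] s'(1)[of "\<pi> a" "\<pi> c"] \<open>\<not> b\<close> a rH[OF c] by (simp add: p hat_def)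
      next
        case nD: False
        have "\<pi> a \<notin> Domain (map_prod \<pi> \<pi> ` r)"
        proof
          assume "\<pi> a \<in> Domain (map_prod \<pi> \<pi> ` r)"
          then obtain u1 u2 where u: "(u1, u2) \<in> r" "\<pi> a = \<pi> u1" by auto
          then have "a = u1" using inj a rH by blast
          then show False using nD u by blast
        qed
        then show ?thesis using s(3)[OF a nD] s'(3)[OF \<pi>a] \<open>\<not> b\<close> a by (simp add: p hat_def)
      qed
    qed
  qed
qed

section \<open>The covering graph\<close>

text \<open>
  The vertices record a site, the composition of the permutations along a walk, and the parity of
  the length of the walk; the latter excludes loops. A letter is an unordered link of the covering
  graph, represented by its two orientations.
\<close>

definition V :: "('s \<times> ('h \<times> bool \<Rightarrow> 'h \<times> bool) \<times> bool) set" where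
  "V = sites I \<times> {\<tau>. \<tau> permutes M} \<times> UNIV"

definition mv :: "'e \<Rightarrow> 's \<times> ('h \<times> bool \<Rightarrow> 'h \<times> bool) \<times> bool \<Rightarrow> 's \<times> ('h \<times> bool \<Rightarrow> 'h \<times> bool) \<times> bool" where
  "mv e v = (tgt I e, ext (rho P e) \<circ> fst (snd v), \<not> snd (snd v))"

definition lk where "lk e v = {(e, v), (linv I e, mv e v)}"

definition L where "L = {lk e v | e v. e \<in> links I \<and> v \<in> V \<and> src I e = fst v}"

text \<open>A letter contains at most one link at a given vertex, by \<open>lk_unique\<close>, so
  that \<open>SOME\<close> leaves no freedom.\<close>

definition jact where
  "jact x v = (if x \<in> L \<and> (\<exists>e. (e, v) \<in> x) then mv (SOME e. (e, v) \<in> x) v else v)"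

text \<open>\<open>N\<close> bounds the number of cosets in the chains, \<open>card V\<close> is the
  number of starting points of a Schreier graph; both kinds of tests have to fit.\<close>

definition c :: nat where "c = N + card V"

lemma finite_V: "finite V"
  using fin finite_inc finite_permutations[of M] by (simp add: V_def finite_pattern_def)

lemma fst_V: "v \<in> V \<Longrightarrow> fst v \<in> sites I"
  by (auto simp: V_def)

lemma mv:
  assumes e: "e \<in> links I" and v: "v \<in> V" and s: "src I e = fst v"
  shows "mv e v \<in> V" "fst (mv e v) = tgt I e" "mv (linv I e) (mv e v) = v" "mv e v \<noteq> v"
    "lk (linv I e) (mv e v) = lk e v"
proof -
  note pe = partial_injection_rho[OF e]
  obtain s' \<tau> b where v_eq: "v = (s', \<tau>, b)" by (metis surj_pair)
  show "mv e v \<in> V"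
    using v link[OF e] permutes_compose[OF _ ext_permutes[OF pe]] by (simp add: V_def mv_def v_eq)
  show "fst (mv e v) = tgt I e" by (simp add: mv_def)
  have "ext (rho P (linv I e)) \<circ> (ext (rho P e) \<circ> \<tau>) = \<tau>"
    using ext_converse[OF pe] by (auto simp: rho_linv[OF e] fun_eq_iff)
  then show 1: "mv (linv I e) (mv e v) = v"
    using link(6)[OF e] s by (simp add: mv_def v_eq)
  show "mv e v \<noteq> v" by (simp add: mv_def v_eq)
  show "lk (linv I e) (mv e v) = lk e v"
    using 1 link(4)[OF e] by (auto simp: lk_def)
qed

lemma lk_L: "e \<in> links I \<Longrightarrow> v \<in> V \<Longrightarrow> src I e = fst v \<Longrightarrow> lk e v \<in> L"
  unfolding L_def by blast

lemma finite_L: "finite L"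
proof (rule finite_subset)
  show "L \<subseteq> (\<lambda>(e, v). lk e v) ` (links I \<times> V)" by (auto simp: L_def)
qed (use finite_inc finite_V in simp)

lemma L_cases:
  assumes "x \<in> L" "(e, v) \<in> x"
  shows "e \<in> links I" "v \<in> V" "src I e = fst v" "x = lk e v"
proof -
  obtain e' v' where x: "x = lk e' v'" "e' \<in> links I" "v' \<in> V" "src I e' = fst v'"
    using assms(1) by (auto simp: L_def)
  then have "(e, v) = (e', v') \<or> (e, v) = (linv I e', mv e' v')" using assms(2) by (auto simp: lk_def)
  then have "e \<in> links I \<and> v \<in> V \<and> src I e = fst v \<and> x = lk e v"
    using x mv[OF x(2-4)] link[OF x(2)] by auto
  then show "e \<in> links I" "v \<in> V" "src I e = fst v" "x = lk e v" by auto
qed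

text \<open>The two orientations start at different vertices because a move changes the parity, even
  if the link is its own inverse.\<close>

lemma lk_unique:
  assumes "x \<in> L" "(e, v) \<in> x" "(e', v) \<in> x"
  shows "e = e'"
  using assms(3) L_cases(4)[OF assms(1,2)] mv(4)[OF L_cases(1-3)[OF assms(1,2)]] by (auto simp: lk_def)

lemma jact_lk:
  assumes "e \<in> links I" "v \<in> V" "src I e = fst v"
  shows "jact (lk e v) v = mv e v"
proof -
  have x: "lk e v \<in> L" "(e, v) \<in> lk e v" using lk_L[OF assms] by (auto simp: lk_def)
  have "(SOME e'. (e', v) \<in> lk e v) = e"
    using x lk_unique[OF x(1)] by (intro some_equality) auto
  then show ?thesis using x by (auto simp: jact_def)
qed

lemma jact_moves:
  assumes "v \<in> V" "jact x v \<noteq> v"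
  obtains e where "e \<in> links I" "src I e = fst v" "x = lk e v"
proof -
  have "x \<in> L \<and> (\<exists>e. (e, v) \<in> x)" using assms(2) unfolding jact_def by metis
  then obtain e where e: "x \<in> L" "(e, v) \<in> x" by blast
  show thesis using that L_cases[OF e] by blast
qed

sublocale letter_graph L c V jact
proof
  show "finite L" by (rule finite_L)
  show "finite V" by (rule finite_V)
  show "c \<ge> 1" using N by (simp add: c_def)
  show "card V \<le> c" by (simp add: c_def)
  fix v x assume v: "v \<in> V"
  show "x \<notin> L \<Longrightarrow> jact x v = v" by (simp add: jact_def)
  have *: "jact x v \<in> V \<and> jact x (jact x v) = v"
  proof (cases "jact x v = v")
    case True
    then show ?thesis using v by simp
  next
    case False
    then obtain e where e: "e \<in> links I" "src I e = fst v" "x = lk e v" using jact_moves[OF v] by blast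
    note m = mv[OF e(1) v e(2)]
    have "jact x v = mv e v" using jact_lk[OF e(1) v e(2)] e(3) by simp
    moreover have "jact x (mv e v) = v"
      using jact_lk[of "linv I e" "mv e v"] m link[OF e(1)] e(3) by simp
    ultimately show ?thesis using m(1) by simp
  qed
  then show "jact x v \<in> V" "jact x (jact x v) = v" by auto
qed

section \<open>Lifts of walks to the covering graph\<close>

fun lift :: "'e list \<Rightarrow> 's \<times> ('h \<times> bool \<Rightarrow> 'h \<times> bool) \<times> bool \<Rightarrow> ('e \<times> ('s \<times> ('h \<times> bool \<Rightarrow> 'h \<times> bool) \<times> bool)) set list" where
  "lift [] v = []"
| "lift (e # w) v = lk e v # lift w (mv e v)"

lemma lift_append: "lift (u @ w) v = lift u v @ lift w (fold mv u v)"
  by (induction u arbitrary: v) auto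

lemma lift_walk:
  assumes "walk I (fst v) w s'" "v \<in> V"
  shows "jwalk v (lift w v)" "fold jact (lift w v) v = fold mv w v" "fold mv w v \<in> V"
    "fst (fold mv w v) = s'" "set (lift w v) \<subseteq> L"
proof -
  have "jwalk v (lift w v) \<and> fold jact (lift w v) v = fold mv w v \<and> fold mv w v \<in> V \<and>
    fst (fold mv w v) = s' \<and> set (lift w v) \<subseteq> L"
    using assms
  proof (induction w arbitrary: v)
    case (Cons e w)
    then have e: "e \<in> links I" "src I e = fst v" by auto
    note m = mv[OF e(1) Cons.prems(2) e(2)]
    show ?case
      using Cons.IH[of "mv e v"] Cons.prems m jact_lk[OF e(1) Cons.prems(2) e(2)]
        lk_L[OF e(1) Cons.prems(2) e(2)] by auto
  qed simp
  then show "jwalk v (lift w v)" "fold jact (lift w v) v = fold mv w v" "fold mv w v \<in> V"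
    "fst (fold mv w v) = s'" "set (lift w v) \<subseteq> L" by auto
qed

text \<open>A letter that moves a vertex comes from a link starting there. Hence every walk of the
  letter graph is a lift, which allows words found by \<open>jwalk_reduce\<close> to be read as
  walks of the incidence pattern.\<close>

lemma jwalk_lift:
  assumes "jwalk v p" "v \<in> V"
  obtains w s' where "walk I (fst v) w s'" "lift w v = p"
proof -
  have "\<exists>w s'. walk I (fst v) w s' \<and> lift w v = p"
    using assms
  proof (induction p arbitrary: v)
    case Nil
    then show ?case using fst_V by (intro exI[of _ "[]"]) auto
  next
    case (Cons x p)
    have "jact x v \<noteq> v" using Cons.prems(1) by simp
    then obtain e where e: "e \<in> links I" "src I e = fst v" "x = lk e v"
      using jact_moves[OF Cons.prems(2)] by blast
    note m = mv[OF e(1) Cons.prems(2) e(2)]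
    have "jact x v = mv e v" using jact_lk[OF e(1) Cons.prems(2) e(2)] e(3) by simp
    then have "jwalk (mv e v) p" using Cons.prems(1) by simp
    from Cons.IH[OF this m(1)] obtain w s' where "walk I (tgt I e) w s'" "lift w (mv e v) = p"
      unfolding m(2) by blast
    then show ?case using e by (intro exI[of _ "e # w"]) auto
  qed
  then show thesis using that by blast
qed

text \<open>A letter does not see the orientation of its link, so inverting a walk just reverses the
  word of its lift.\<close>

lemma lift_winv:
  assumes "walk I (fst v) w s'" "v \<in> V"
  shows "lift (winv I w) (fold mv w v) = rev (lift w v)" "fold mv (winv I w) (fold mv w v) = v"
proof -
  have "lift (winv I w) (fold mv w v) = rev (lift w v) \<and> fold mv (winv I w) (fold mv w v) = v"
    using assms
  proof (induction w arbitrary: v)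
    case (Cons e w)
    then have e: "e \<in> links I" "src I e = fst v" by auto
    note m = mv[OF e(1) Cons.prems(2) e(2)]
    show ?case using Cons.IH[of "mv e v"] Cons.prems m by (simp add: winv_def lift_append)
  qed (simp add: winv_def)
  then show "lift (winv I w) (fold mv w v) = rev (lift w v)" "fold mv (winv I w) (fold mv w v) = v" by auto
qed

text \<open>The end point of a lift determines the partial map along a walk wherever it is defined.\<close>

lemma rho_walk_mv:
  assumes "walk I (fst v) w s'" "v \<in> V" "(a, a') \<in> rho_walk P (fst v) w" "fst (snd v) m = (a, False)"
  shows "fst (snd (fold mv w v)) m = (a', False)"
  using assms
proof (induction w arbitrary: v a)
  case (Cons e w)
  then have e: "e \<in> links I" "src I e = fst v" by auto
  note m = mv[OF e(1) Cons.prems(2) e(2)]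
  obtain b where b: "(a, b) \<in> rho P e" "(b, a') \<in> rho_walk P (tgt I e) w" using Cons.prems(3) by auto
  have "fst (snd (mv e v)) m = (b, False)"
    using ext_simps(1)[OF partial_injection_rho[OF e(1)] b(1)] Cons.prems(4) by (simp add: mv_def)
  then show ?case using Cons.IH[of "mv e v" b] Cons.prems m b by simp
qed auto

lemma rho_walk_coherent:
  assumes "walk I (fst v) w1 s1" "walk I (fst v) w2 s2" "v \<in> V" "fold mv w1 v = fold mv w2 v"
    and "(a, a1) \<in> rho_walk P (fst v) w1" "(a, a2) \<in> rho_walk P (fst v) w2"
  shows "a1 = a2"
proof -
  have "fst (snd v) permutes M" using assms(3) by (auto simp: V_def)
  \<comment> \<open>The permutation recorded at \<open>v\<close> is onto. Following its point over
    \<open>(a, False)\<close> reads off the image of \<open>a\<close> from the end vertex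
    alone.\<close>
  then obtain m where "fst (snd v) m = (a, False)" by (metis permutes_surj surjD)
  then show ?thesis using rho_walk_mv assms by (metis prod.inject)
qed

lemma rho_walk_range:
  assumes "walk I s w t"
  shows "rho_walk P s w \<subseteq> univ (part P s) \<times> univ (part P t)"
  using assms
proof (induction w arbitrary: s)
  case (Cons e w)
  then have e: "e \<in> links I" "src I e = s" "walk I (tgt I e) w t" by auto
  show ?case using Cons.IH[OF e(3)] rho(1)[OF e(1)] e(2) by auto
qed auto

lemma rho_walk_append:
  assumes "walk I s u t" "walk I t w t'"
  shows "rho_walk P s (u @ w) = rho_walk P s u O rho_walk P t w"
  using assms(1)
proof (induction u arbitrary: s)
  case Nil
  then have "s = t" by simp
  then show ?case using rho_walk_range[OF assms(2)] by auto
next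
  case (Cons e u)
  then show ?case using Cons.IH[of "tgt I e"] by (simp add: O_assoc)
qed

section \<open>Walks whose lifts have equal values\<close>

definition base :: "'s \<Rightarrow> 's \<times> ('h \<times> bool \<Rightarrow> 'h \<times> bool) \<times> bool" where
  "base s = (s, id, False)"

lemma base: "s \<in> sites I \<Longrightarrow> base s \<in> V" "fst (base s) = s"
  by (simp_all add: base_def V_def permutes_id)

text \<open>All vertices over \<open>s\<close> are involved, which makes concatenation compatible;
  deck transformations reduce the condition to a single vertex in \<open>weq_iff\<close>.\<close>

definition weq :: "'s \<Rightarrow> 'e list \<Rightarrow> 'e list \<Rightarrow> bool" where
  "weq s w1 w2 \<longleftrightarrow> (\<forall>v\<in>V. fst v = s \<longrightarrow> lift w1 v \<approx> lift w2 v)"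

text \<open>An automorphism of the covering graph permutes the letters, and the kernel is invariant
  under all permutations of \<open>L\<close>. As \<open>L\<close> is finite, injectivity of the map
  on letters suffices.\<close>

lemma lift_automorphism:
  assumes \<theta>: "bij_betw \<theta> (links I) (links I)" "\<And>e. e \<in> links I \<Longrightarrow> linv I (\<theta> e) = \<theta> (linv I e)"
    and D: "D ` V \<subseteq> V" "inj_on D V"
    and D_mv: "\<And>e v. e \<in> links I \<Longrightarrow> v \<in> V \<Longrightarrow> src I e = fst v \<Longrightarrow>
      src I (\<theta> e) = fst (D v) \<and> D (mv e v) = mv (\<theta> e) (D v)"
    and w: "walk I (fst v) w1 s1" "walk I (fst v) w2 s2" "v \<in> V" "lift w1 v \<approx> lift w2 v"
  shows "lift (map \<theta> w1) (D v) \<approx> lift (map \<theta> w2) (D v)"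
proof -
  define \<pi> where "\<pi> x = map_prod \<theta> D ` x" for x
  have \<theta>L: "\<theta> e \<in> links I" if "e \<in> links I" for e using \<theta>(1) that by (auto simp: bij_betw_def)
  have \<pi>_lk: "\<pi> (lk e v) = lk (\<theta> e) (D v)" if "e \<in> links I" "v \<in> V" "src I e = fst v" for e v
    using that \<theta>(2) D_mv by (simp add: \<pi>_def lk_def)
  have "\<pi> ` L \<subseteq> L"
  proof
    fix y assume "y \<in> \<pi> ` L"
    then obtain e v where e: "e \<in> links I" "v \<in> V" "src I e = fst v" "y = \<pi> (lk e v)"
      unfolding L_def by blast
    then show "y \<in> L" using \<pi>_lk[OF e(1-3)] lk_L[of "\<theta> e" "D v"] \<theta>L D(1) D_mv by auto
  qed
  moreover have "inj_on \<pi> L"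
  proof (rule inj_onI)
    fix x y assume xy: "x \<in> L" "y \<in> L" "\<pi> x = \<pi> y"
    have "x \<subseteq> links I \<times> V" "y \<subseteq> links I \<times> V" using xy L_cases by auto
    moreover have "inj_on (map_prod \<theta> D) (links I \<times> V)"
      using \<theta>(1) D(2) by (intro map_prod_inj_on) (auto simp: bij_betw_def)
    ultimately show "x = y" using xy(3) inj_on_image_eq_iff unfolding \<pi>_def by metis
  qed
  ultimately have bij: "bij_betw \<pi> L L"
    using endo_inj_surj[OF finite_L] by (simp add: bij_betw_def)
  have lift: "lift (map \<theta> w) (D v) = map \<pi> (lift w v)" if "walk I (fst v) w s" "v \<in> V" for w v s
    using that
  proof (induction w arbitrary: v)
    case (Cons e w)
    then have e: "e \<in> links I" "src I e = fst v" by auto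
    note m = mv[OF e(1) Cons.prems(2) e(2)]
    show ?case using Cons.IH[of "mv e v"] Cons.prems m D_mv[OF e(1) Cons.prems(2) e(2)]
      \<pi>_lk[OF e(1) Cons.prems(2) e(2)] by simp
  qed simp
  show ?thesis
    using eqv_map[OF w(4) lift_walk(5)[OF w(1,3)] lift_walk(5)[OF w(2,3)] bij]
      lift[OF w(1,3)] lift[OF w(2,3)] by simp
qed

text \<open>Any two vertices over the same site are related by a deck transformation.\<close>

lemma lift_deck:
  assumes v: "v \<in> V" "v' \<in> V" "fst v = fst v'"
    and w: "walk I (fst v) w1 s1" "walk I (fst v) w2 s2" "lift w1 v \<approx> lift w2 v"
  shows "lift w1 v' \<approx> lift w2 v'"
proof -
  obtain s \<tau> b where v_eq: "v = (s, \<tau>, b)" by (metis surj_pair)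
  obtain \<tau>' b' where v'_eq: "v' = (s, \<tau>', b')" using v(3) v_eq by (metis fst_conv surj_pair)
  have \<tau>: "\<tau> permutes M" "\<tau>' permutes M" using v by (auto simp: v_eq v'_eq V_def)
  \<comment> \<open>Moves compose on the left, so composition on the right commutes with them. The
    parity is flipped precisely if \<open>b\<close> and \<open>b'\<close> differ.\<close>
  define \<kappa> where "\<kappa> = inv \<tau> \<circ> \<tau>'"
  have \<kappa>: "\<kappa> permutes M" unfolding \<kappa>_def by (intro permutes_compose permutes_inv \<tau>)
  define D where "D x = (fst x, fst (snd x) \<circ> \<kappa>, snd (snd x) \<noteq> (b \<noteq> b'))"
    for x :: "'s \<times> ('h \<times> bool \<Rightarrow> 'h \<times> bool) \<times> bool"
  have "\<tau> \<circ> \<kappa> = \<tau>'" unfolding \<kappa>_def comp_assoc[symmetric] permutes_inv_o[OF \<tau>(1)] by simp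
  then have Dv: "D v = v'" by (auto simp: D_def v_eq v'_eq)
  have "lift (map id w1) (D v) \<approx> lift (map id w2) (D v)"
  proof (rule lift_automorphism[OF _ _ _ _ _ w(1,2) v(1) w(3)])
    show "bij_betw id (links I) (links I)" by simp
    show "linv I (id e) = id (linv I e)" for e by simp
    show "D ` V \<subseteq> V" using permutes_compose[OF \<kappa>] by (auto simp: D_def V_def)
    show "inj_on D V"
    proof (rule inj_onI)
      fix x y assume "D x = D y"
      moreover from this have "fst (snd x) \<circ> \<kappa> \<circ> inv \<kappa> = fst (snd y) \<circ> \<kappa> \<circ> inv \<kappa>" by (simp add: D_def)
      then have "fst (snd x) = fst (snd y)" by (simp add: comp_assoc permutes_inv_o(1)[OF \<kappa>])
      ultimately show "x = y" by (auto simp: D_def prod_eq_iff)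
    qed
    show "src I (id e) = fst (D x) \<and> D (mv e x) = mv (id e) (D x)" if "src I e = fst x" for e x
      using that by (auto simp: D_def mv_def comp_assoc)
  qed
  then show ?thesis by (simp add: Dv)
qed

lemma weq_iff:
  assumes "v \<in> V" "walk I (fst v) w1 s1" "walk I (fst v) w2 s2"
  shows "weq (fst v) w1 w2 \<longleftrightarrow> lift w1 v \<approx> lift w2 v"
  using assms lift_deck[OF assms(1)] unfolding weq_def by metis

lemma weq_refl [simp]: "weq s w w"
  by (simp add: weq_def)

lemma weq_sym: "weq s w1 w2 \<Longrightarrow> weq s w2 w1"
  unfolding weq_def using eqv_sym by blast

lemma weq_trans: "weq s w1 w2 \<Longrightarrow> weq s w2 w3 \<Longrightarrow> weq s w1 w3"
  unfolding weq_def using eqv_trans by blast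

text \<open>Words of value 1 fix all vertices, hence lifts of equal value lead to the same
  vertex.\<close>

lemma weq_mv:
  assumes "weq (fst v) w1 w2" "v \<in> V" "walk I (fst v) w1 s1" "walk I (fst v) w2 s2"
  shows "fold mv w1 v = fold mv w2 v"
  using eqv_fold_jact[of "lift w1 v" "lift w2 v" v] lift_walk(2)[OF assms(3,2)]
    lift_walk(2)[OF assms(4,2)] assms by (simp add: weq_def)

lemma weq_end:
  assumes "weq s w1 w2" "walk I s w1 s1" "walk I s w2 s2"
  shows "s1 = s2"
proof -
  have "s \<in> sites I" using walk_sites assms(2) by blast
  then show ?thesis
    using weq_mv[of "base s" w1 w2 s1 s2] lift_walk(4)[of "base s" w1 s1] lift_walk(4)[of "base s" w2 s2]
      base assms by simp
qed

lemma weq_append: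
  assumes "weq s w1 w2" "walk I s w1 t" "walk I s w2 t" "weq t u1 u2"
  shows "weq s (w1 @ u1) (w2 @ u2)"
  unfolding weq_def
proof (intro ballI impI)
  fix v assume v: "v \<in> V" "fst v = s"
  have "fold mv w1 v = fold mv w2 v" using weq_mv[of v w1 w2 t t] assms v by simp
  moreover have "fst (fold mv w1 v) = t" "fold mv w1 v \<in> V" using lift_walk[of v w1 t] assms v by auto
  ultimately show "lift (w1 @ u1) v \<approx> lift (w2 @ u2) v"
    using assms v by (auto simp: weq_def lift_append intro!: eqv_app)
qed

lemma weq_winv_right:
  assumes "walk I s w t"
  shows "weq s (w @ winv I w) []"
  unfolding weq_def
proof (intro ballI impI)
  fix v assume v: "v \<in> V" "fst v = s"
  then show "lift (w @ winv I w) v \<approx> lift [] v"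
    using lift_winv(1)[of v w t] assms app_rev by (simp add: lift_append eqv_nil)
qed

lemma weq_winv_left:
  assumes "walk I s w t"
  shows "weq t (winv I w @ w) []"
  using weq_winv_right[OF walk_winv[OF assms]] winv_winv[OF walk_links[OF assms]] by simp

definition walk_rel :: "(('s \<times> 'e list \<times> 's) \<times> ('s \<times> 'e list \<times> 's)) set" where
  "walk_rel = {((s, w, t), (s', w', t')). walk I s w t \<and> walk I s w' t \<and> s' = s \<and> t' = t \<and> weq s w w'}"

lemma equiv_walk_rel: "equiv {(s, w, t). walk I s w t} walk_rel"
  by (rule equivI) (auto simp: walk_rel_def refl_on_def sym_def trans_def intro: weq_sym weq_trans)

text \<open>A class is determined by the two end points and the value of the lift at the base
  vertex, and there are only finitely many values.\<close>

lemma finite_walk_classes: "finite ({(s, w, t). walk I s w t} // walk_rel)"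
proof -
  let ?W = "{(s, w, t). walk I s w t}"
  define f :: "'s \<times> 'e list \<times> 's \<Rightarrow> _" where "f = (\<lambda>(s, w, t). (s, t, eqw K `` {lift w (base s)}))"
  define g where "g y = walk_rel `` {SOME x. x \<in> ?W \<and> f x = y}" for y
  have "f ` ?W \<subseteq> sites I \<times> sites I \<times> (UNIV // eqw K)"
    using walk_sites by (auto simp: f_def intro: quotientI)
  then have "finite (f ` ?W)" using finite_subset finite_inc finite_index by blast
  moreover have "?W // walk_rel \<subseteq> g ` f ` ?W"
  proof
    fix C assume "C \<in> ?W // walk_rel"
    then obtain x where x: "x \<in> ?W" "C = walk_rel `` {x}" by (rule quotientE)
    define y where "y = (SOME y. y \<in> ?W \<and> f y = f x)"
    have y: "y \<in> ?W \<and> f y = f x" unfolding y_def by (rule someI[of _ x]) (use x in simp)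
    obtain s w t s' w' t' where eq: "x = (s, w, t)" "y = (s', w', t')" by (metis surj_pair)
    have "s' = s" "t' = t" and e: "eqw K `` {lift w' (base s')} = eqw K `` {lift w (base s)}"
      using y by (auto simp: f_def eq)
    have "lift w' (base s) \<approx> lift w (base s)"
      using eq_equiv_class[OF e equiv_eqw] \<open>s' = s\<close> by (simp add: eqw_iff)
    then have "weq s w' w"
      using weq_iff[of "base s" w' t w t] base walk_sites x y \<open>s' = s\<close> \<open>t' = t\<close> by (auto simp: eq)
    then have "(y, x) \<in> walk_rel" using x y \<open>s' = s\<close> \<open>t' = t\<close> by (auto simp: walk_rel_def eq)
    then have "walk_rel `` {y} = C"
      unfolding x(2) by (rule equiv_class_eq[OF equiv_walk_rel])
    then have "g (f x) = C" unfolding g_def y_def .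
    then show "C \<in> g ` f ` ?W" using x(1) by blast
  qed
  ultimately show ?thesis using finite_surj by blast
qed

lemma weq_coherent:
  assumes "weq s w1 w2" "walk I s w1 t" "walk I s w2 t"
    and "(a, a1) \<in> rho_walk P s w1" "(a, a2) \<in> rho_walk P s w2"
  shows "a1 = a2"
proof -
  have s: "s \<in> sites I" using walk_sites assms(2) by blast
  have "fold mv w1 (base s) = fold mv w2 (base s)"
    using weq_mv[of "base s" w1 w2 t t] assms base s by simp
  then show ?thesis using rho_walk_coherent[of "base s" w1 t w2 t a a1 a2] assms base s by simp
qed

section \<open>Domains of partial isomorphisms in terms of letters\<close>

definition crossed where
  "crossed v a = {lk e (fold mv w v) | e w b. e \<in> links I \<and> walk I (fst v) w (src I e) \<and>
     (a, b) \<in> rho_walk P (fst v) w \<and> b \<in> Domain (rho P e)}"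

text \<open>The vertex reached determines the image of \<open>a\<close>. So whether the next link is
  defined there depends on the letter and not on the walk that led to it, and a walk with admissible
  letters only can be followed to its end.\<close>

lemma Domain_rho_walk_iff:
  assumes "walk I (fst v) w t" "v \<in> V" "a \<in> univ (part P (fst v))"
  shows "a \<in> Domain (rho_walk P (fst v) w) \<longleftrightarrow> set (lift w v) \<subseteq> crossed v a"
  using assms(1)
proof (induction w arbitrary: t rule: rev_induct)
  case Nil
  then show ?case using assms by auto
next
  case (snoc e w)
  then have w: "walk I (fst v) w (src I e)" and e: "e \<in> links I"
    by (auto simp: walk_append)
  define u where "u = fold mv w v"
  have u: "u \<in> V" "src I e = fst u" using lift_walk[OF w assms(2)] by (auto simp: u_def)
  have rho_e: "rho_walk P (src I e) [e] = rho P e"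
    using rho(1)[OF e] by auto
  have rho_we: "rho_walk P (fst v) (w @ [e]) = rho_walk P (fst v) w O rho P e"
    using rho_walk_append[OF w, of "[e]" "tgt I e"] e rho_e link by simp
  show ?case
  proof
    assume "a \<in> Domain (rho_walk P (fst v) (w @ [e]))"
    then obtain b where b: "(a, b) \<in> rho_walk P (fst v) w" "b \<in> Domain (rho P e)"
      unfolding rho_we by blast
    then have "lk e u \<in> crossed v a" using e w unfolding crossed_def u_def by blast
    then show "set (lift (w @ [e]) v) \<subseteq> crossed v a"
      using snoc.IH[OF w] b(1) by (auto simp: lift_append u_def)
  next
    assume sub: "set (lift (w @ [e]) v) \<subseteq> crossed v a"
    then have "a \<in> Domain (rho_walk P (fst v) w)" using snoc.IH[OF w] by (simp add: lift_append)
    then obtain b where b: "(a, b) \<in> rho_walk P (fst v) w" by blast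
    have "lk e u \<in> crossed v a" using sub by (simp add: lift_append u_def)
    then obtain e' w' b' where e': "lk e u = lk e' (fold mv w' v)" "e' \<in> links I"
      "walk I (fst v) w' (src I e')" "(a, b') \<in> rho_walk P (fst v) w'" "b' \<in> Domain (rho P e')"
      unfolding crossed_def by blast
    have "(e, u) = (e', fold mv w' v) \<or> (e, u) = (linv I e', mv e' (fold mv w' v))"
      using e'(1) by (auto simp: lk_def doubleton_eq_iff)
    then show "a \<in> Domain (rho_walk P (fst v) (w @ [e]))"
    proof
      assume 1: "(e, u) = (e', fold mv w' v)"
      then have "b = b'" using rho_walk_coherent[OF w e'(3) assms(2) _ b e'(4)] by (simp add: u_def)
      then show ?thesis using 1 b e'(5) unfolding rho_we by blast
    next
      \<comment> \<open>The letter was crossed from its other end. Then \<open>b\<close> is the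
        image of \<open>a\<close> beyond \<open>e'\<close>, where the converse of the partial
        isomorphism is defined.\<close>
      assume 1: "(e, u) = (linv I e', mv e' (fold mv w' v))"
      obtain b'' where b'': "(b', b'') \<in> rho P e'" using e'(5) by blast
      have w'': "walk I (fst v) (w' @ [e']) (tgt I e')"
        using e'(2,3) link by (auto simp: walk_append)
      have "rho_walk P (src I e') [e'] = rho P e'" using rho(1)[OF e'(2)] by auto
      then have "(a, b'') \<in> rho_walk P (fst v) (w' @ [e'])"
        using rho_walk_append[OF e'(3), of "[e']" "tgt I e'"] e'(2,4) b'' link by auto
      then have "b = b''"
        using rho_walk_coherent[OF w w'' assms(2) _ b] 1 by (simp add: u_def)
      then have "b \<in> Domain (rho P e)" using b'' 1 rho_linv[OF e'(2)] by auto
      then show ?thesis using b unfolding rho_we by blast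
    qed
  qed
qed

text \<open>\<open>T w'\<close> collects the letters that all elements of the domain can cross. The
  common value of both walks is taken over \<open>T w1 \<inter> T w2\<close>, hence also by a walk
  over these letters, and such a walk is defined on both domains.\<close>

lemma strongly_coherent_walks:
  assumes w: "walk I s w1 t" "walk I s w2 t" "weq s w1 w2"
  obtains w where "walk I s w t" "weq s w w1" "rho_walk P s w1 \<subseteq> rho_walk P s w"
    "rho_walk P s w2 \<subseteq> rho_walk P s w"
proof -
  have s: "s \<in> sites I" using walk_sites w(1) by blast
  let ?v = "base s"
  note b = base(1)[OF s] base(2)[of s]
  have walks: "walk I (fst ?v) w1 t" "walk I (fst ?v) w2 t" using w b by simp_all
  define T where "T w' = {x \<in> L. \<forall>a\<in>Domain (rho_walk P s w'). x \<in> crossed ?v a}" for w'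
  have part: "Domain (rho_walk P s w') \<subseteq> univ (part P s)" if "walk I s w' t" for w'
    using rho_walk_range[OF that] by blast
  have in_T: "set (lift w' ?v) \<subseteq> T w'" if w': "walk I s w' t" for w'
  proof
    fix x assume x: "x \<in> set (lift w' ?v)"
    have "x \<in> crossed ?v a" if a: "a \<in> Domain (rho_walk P s w')" for a
      using Domain_rho_walk_iff[of ?v w' t a] w' b a part[OF w'] x by auto
    then show "x \<in> T w'" using lift_walk(5)[of ?v w' t] w' b x by (auto simp: T_def)
  qed
  have eq: "lift w1 ?v \<approx> lift w2 ?v" using w(3) b by (simp add: weq_def)
  then obtain g where g: "set g \<subseteq> T w1 \<inter> T w2" "g \<approx> lift w1 ?v"
    using eqv_inter in_T[OF w(1)] in_T[OF w(2)] by metis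
  have "T w1 \<inter> T w2 \<subseteq> L" by (auto simp: T_def)
  then obtain q where q: "set q \<subseteq> T w1 \<inter> T w2" "jwalk ?v q" "fold jact q ?v = fold jact (lift w1 ?v) ?v"
    "q \<approx> lift w1 ?v"
    using jwalk_reduce[OF _ b(1) lift_walk(1)[OF walks(1) b(1)] eqv_sym[OF g(2)] g(1)] by blast
  obtain w' t' where w': "walk I s w' t'" "lift w' ?v = q" using jwalk_lift[OF q(2) b(1)] b(2) by metis
  have "fold mv w' ?v = fold mv w1 ?v"
    using lift_walk(2)[of ?v w' t'] lift_walk(2)[OF walks(1) b(1)] w' q(3) b by simp
  then have "t' = t" using lift_walk(4)[of ?v w' t'] lift_walk(4)[OF walks(1) b(1)] w' b by simp
  have weq: "weq s w' w1"
    using weq_iff[of ?v w' t w1 t] w' q(4) b w(1) \<open>t' = t\<close> by simp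
  have "rho_walk P s u \<subseteq> rho_walk P s w'" if u: "u = w1 \<or> u = w2" for u
  proof
    fix p assume p: "p \<in> rho_walk P s u"
    obtain a a1 where p_eq: "p = (a, a1)" by (metis surj_pair)
    have wu: "walk I s u t" "weq s w' u" using u w weq weq_trans by auto
    have a: "a \<in> Domain (rho_walk P s u)" using p p_eq by blast
    have "T u \<subseteq> crossed ?v a" using a unfolding T_def by blast
    then have "set q \<subseteq> crossed ?v a" using q(1) u by blast
    then have "a \<in> Domain (rho_walk P s w')"
      using Domain_rho_walk_iff[of ?v w' t' a] w' b part[OF wu(1)] a by auto
    then obtain a2 where "(a, a2) \<in> rho_walk P s w'" by blast
    moreover from this have "a1 = a2"
      using weq_coherent[of s u w' t a a1 a2] wu w'(1) \<open>t' = t\<close> p p_eq weq_sym by blast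
    ultimately show "p \<in> rho_walk P s w'" using p_eq by simp
  qed
  then show thesis using that[of w'] w'(1) \<open>t' = t\<close> weq by blast
qed

text \<open>If \<open>a\<close> could not cross the letter of \<open>e\<close>, this letter would be
  equivalent to a word over no letters at all, that is to 1; but it moves the base vertex.\<close>

lemma simple_walks:
  assumes e: "e \<in> links I" and w: "walk I (src I e) w (tgt I e)" "weq (src I e) w [e]"
  shows "rho_walk P (src I e) w \<subseteq> rho P e"
proof
  fix p assume p: "p \<in> rho_walk P (src I e) w"
  obtain a a1 where p_eq: "p = (a, a1)" by (metis surj_pair)
  let ?v = "base (src I e)"
  have b: "?v \<in> V" "fst ?v = src I e" using base link(1)[OF e] by auto
  have we: "walk I (src I e) [e] (tgt I e)" using e link by simp
  have rho_e: "rho_walk P (src I e) [e] = rho P e" using rho(1)[OF e] by auto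
  have a: "a \<in> univ (part P (src I e))" using rho_walk_range[OF w(1)] p p_eq by auto
  have "set (lift w ?v) \<subseteq> crossed ?v a"
    using Domain_rho_walk_iff[of ?v w "tgt I e" a] w(1) b a p p_eq by auto
  moreover have "[lk e ?v] \<approx> lift w ?v" using w(2) b eqv_sym by (simp add: weq_def)
  ultimately obtain g where g: "set g \<subseteq> {lk e ?v} \<inter> crossed ?v a" "g \<approx> [lk e ?v]"
    using eqv_inter[of "[lk e ?v]" "lift w ?v" "{lk e ?v}" "crossed ?v a"] by auto
  have "lk e ?v \<in> crossed ?v a"
  proof (rule ccontr)
    assume "lk e ?v \<notin> crossed ?v a"
    then have "g = []" using g(1) by auto
    then have "fold jact [] ?v = fold jact [lk e ?v] ?v" using eqv_fold_jact[OF g(2) b(1)] by simp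
    then show False using jact_lk[OF e b(1)] mv(4)[OF e b(1)] b(2) by simp
  qed
  then have "a \<in> Domain (rho P e)"
    using Domain_rho_walk_iff[of ?v "[e]" "tgt I e" a] we b a rho_e by simp
  then obtain a2 where "(a, a2) \<in> rho P e" by blast
  moreover from this have "a1 = a2"
    using weq_coherent[OF w(2,1) we, of a a1 a2] p p_eq rho_e by simp
  ultimately show "p \<in> rho P e" using p_eq by simp
qed

section \<open>Acyclicity in terms of walks\<close>

definition lifts where
  "lifts \<alpha> = {lk e v | e v. e \<in> \<alpha> \<and> v \<in> V \<and> src I e = fst v}"

text \<open>A letter represents a link together with its inverse, so it belongs to one set of links
  only up to inversion.\<close>

lemma lk_lifts:
  assumes "link_closed I \<alpha>" "lk e v \<in> lifts \<alpha>"
  shows "e \<in> \<alpha>"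
proof -
  obtain e' v' where e': "lk e v = lk e' v'" "e' \<in> \<alpha>" using assms(2) by (auto simp: lifts_def)
  then have "e = e' \<or> e = linv I e'" by (auto simp: lk_def doubleton_eq_iff)
  then show ?thesis using e'(2) assms(1) by (auto simp: link_closed_def)
qed

lemma lifts_L: "link_closed I \<alpha> \<Longrightarrow> lifts \<alpha> \<subseteq> L"
  unfolding lifts_def L_def link_closed_def by blast

lemma lift_lifts:
  assumes "walk I (fst v) w t" "v \<in> V" "set w \<subseteq> \<alpha>"
  shows "set (lift w v) \<subseteq> lifts \<alpha>"
  using assms
proof (induction w arbitrary: v)
  case (Cons e w)
  then have e: "e \<in> links I" "src I e = fst v" by auto
  note m = mv[OF e(1) Cons.prems(2) e(2)]
  have "e \<in> \<alpha>" using Cons.prems(3) by simp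
  then have "lk e v \<in> lifts \<alpha>" using e(2) Cons.prems(2) unfolding lifts_def by blast
  then show ?case using Cons.IH[of "mv e v"] Cons.prems m by auto
qed simp

lemma lift_lifts_conv: "link_closed I \<alpha> \<Longrightarrow> set (lift w v) \<subseteq> lifts \<alpha> \<Longrightarrow> set w \<subseteq> \<alpha>"
proof (induction w arbitrary: v)
  case (Cons e w)
  then show ?case using lk_lifts[OF Cons.prems(1), of e v] Cons.IH[of "mv e v"] by simp
qed simp

text \<open>\<open>acyclic_words\<close> splits one of the lifts into two words, which need not be
  walks; \<open>jwalk_factor\<close> replaces them by walks over the same letters, which project to
  walks of the incidence pattern.\<close>

lemma acyclic_walks:
  assumes n: "2 \<le> n" "n \<le> N"
    and w: "\<And>i. i < n \<Longrightarrow> walk I (s i) (w i) (s ((i + 1) mod n)) \<and> set (w i) \<subseteq> \<alpha> i \<and> link_closed I (\<alpha> i)"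
    and closed: "weq (s 0) (concat (map w [0..<n])) []"
  shows "\<exists>i<n. \<exists>u v t. walk I (s i) u t \<and> walk I t v (s ((i + 1) mod n)) \<and>
    set u \<subseteq> \<alpha> ((i + n - 1) mod n) \<inter> \<alpha> i \<and> set v \<subseteq> \<alpha> i \<inter> \<alpha> ((i + 1) mod n) \<and>
    weq (s i) (u @ v) (w i)"
proof -
  define p where "p i = concat (map w [0..<i])" for i
  define x where "x i = fold mv (p i) (base (s 0))" for i
  have s0: "s 0 \<in> sites I" using w[of 0] walk_sites n by fastforce
  note b = base(1)[OF s0] base(2)[of "s 0"]
  have p: "walk I (s 0) (p i) (s (i mod n))" if "i \<le> n" for i
    using that
  proof (induction i)
    case 0
    then show ?case using s0 by (simp add: p_def)
  next
    case (Suc i)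
    have "walk I (s 0) (p i @ w i) (s ((i + 1) mod n))"
      unfolding walk_append using Suc w[of i] by auto
    then show ?case by (simp add: p_def)
  qed
  have x: "x i \<in> V" "fst (x i) = s i" if "i < n" for i
    using lift_walk(3,4)[of "base (s 0)" "p i" "s (i mod n)"] p[of i] b that by (auto simp: x_def)
  define h where "h i = lift (w i) (x i)" for i
  have "concat (map h [0..<i]) = lift (p i) (base (s 0))" for i
    by (induction i) (auto simp: p_def h_def lift_append x_def)
  then have K: "concat (map h [0..<n]) \<in> K"
    using closed b by (simp add: weq_def p_def[symmetric] eqv_nil)
  have h: "set (h i) \<subseteq> lifts (\<alpha> i) \<and> lifts (\<alpha> i) \<subseteq> L" if "i < n" for i
    using lift_lifts[of "x i" "w i"] w[OF that] x[OF that] lifts_L by (auto simp: h_def)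
  have "n \<le> c" using n by (simp add: c_def)
  from acyclic_words[OF n(1) this, of h "\<lambda>i. lifts (\<alpha> i)", OF h K]
  obtain i u v where i: "i < n"
    and u: "set u \<subseteq> lifts (\<alpha> ((i + n - 1) mod n)) \<inter> lifts (\<alpha> i)"
    and v: "set v \<subseteq> lifts (\<alpha> i) \<inter> lifts (\<alpha> ((i + 1) mod n))" and uv: "h i \<approx> u @ v" by blast
  have lc: "link_closed I (\<alpha> i)" "link_closed I (\<alpha> ((i + n - 1) mod n))" "link_closed I (\<alpha> ((i + 1) mod n))"
    using w i n by auto
  have walk_i: "walk I (fst (x i)) (w i) (s ((i + 1) mod n))" using w[OF i] x[OF i] by simp
  obtain q1 q2 where q: "set q1 \<subseteq> lifts (\<alpha> ((i + n - 1) mod n)) \<inter> lifts (\<alpha> i)"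
    "set q2 \<subseteq> lifts (\<alpha> i) \<inter> lifts (\<alpha> ((i + 1) mod n))" "jwalk (x i) (q1 @ q2)"
    "fold jact (q1 @ q2) (x i) = fold jact (h i) (x i)" "q1 @ q2 \<approx> h i"
  proof (rule jwalk_factor[OF _ _ x(1)[OF i] _ uv u v])
    show "lifts (\<alpha> ((i + n - 1) mod n)) \<inter> lifts (\<alpha> i) \<subseteq> L" using lifts_L[OF lc(1)] by blast
    show "lifts (\<alpha> i) \<inter> lifts (\<alpha> ((i + 1) mod n)) \<subseteq> L" using lifts_L[OF lc(1)] by blast
    show "jwalk (x i) (h i)" unfolding h_def by (rule lift_walk(1)[OF walk_i x(1)[OF i]])
  qed
  have jw: "jwalk (x i) q1" "jwalk (fold jact q1 (x i)) q2" using q(3) by (auto simp: jwalk_append)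
  obtain u' t where u': "walk I (s i) u' t" "lift u' (x i) = q1"
    using jwalk_lift[OF jw(1) x(1)[OF i]] x(2)[OF i] by metis
  define y where "y = fold mv u' (x i)"
  have y: "y \<in> V" "fst y = t" "fold jact q1 (x i) = y"
    using lift_walk[of "x i" u' t] u' x[OF i] by (auto simp: y_def)
  obtain v' t' where v': "walk I t v' t'" "lift v' y = q2"
    using jwalk_lift[of y q2] jw(2) y by metis
  have walk_uv: "walk I (fst (x i)) (u' @ v') t'" using u'(1) v'(1) x(2)[OF i] by (auto simp: walk_append)
  have lift_uv: "lift (u' @ v') (x i) = q1 @ q2" using u'(2) v'(2) by (simp add: lift_append y_def)
  have weq: "weq (s i) (u' @ v') (w i)"
    using weq_iff[OF x(1)[OF i] walk_uv walk_i] lift_uv q(5) x(2)[OF i] by (simp add: h_def)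
  have "t' = s ((i + 1) mod n)" using weq_end[OF weq] walk_uv walk_i x(2)[OF i] by simp
  moreover have "set u' \<subseteq> \<alpha> ((i + n - 1) mod n) \<inter> \<alpha> i"
    using lift_lifts_conv[OF lc(1), of u' "x i"] lift_lifts_conv[OF lc(2), of u' "x i"] u'(2) q(1) by auto
  moreover have "set v' \<subseteq> \<alpha> i \<inter> \<alpha> ((i + 1) mod n)"
    using lift_lifts_conv[OF lc(1), of v' y] lift_lifts_conv[OF lc(3), of v' y] v'(2) q(2) by auto
  ultimately show ?thesis using i u'(1) v'(1) weq by blast
qed

end

section \<open>Isomorphisms given by maps\<close>

lemma list_all2_graph_on:
  "list_all2 (\<lambda>x y. (x, y) \<in> graph_on f X) xs ys \<longleftrightarrow> set xs \<subseteq> X \<and> ys = map f xs"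
proof (induction xs arbitrary: ys)
  case (Cons x xs)
  then show ?case by (cases ys) (auto simp: graph_on_def)
qed auto

lemma isomorphism_graph_on:
  "isomorphism \<sigma> (graph_on f (univ A)) A B \<longleftrightarrow> bij_betw f (univ A) (univ B) \<and>
     (\<forall>R\<in>syms \<sigma>. \<forall>xs. set xs \<subseteq> univ A \<longrightarrow> (xs \<in> rel A R \<longleftrightarrow> map f xs \<in> rel B R))"
proof -
  have 1: "Domain (graph_on f X) = X" "Range (graph_on f X) = f ` X" "single_valued (graph_on f X)"
    "single_valued ((graph_on f X)\<inverse>) \<longleftrightarrow> inj_on f X" for X
    by (auto simp: graph_on_def single_valued_def inj_on_def)
  show ?thesis
    unfolding isomorphism_def 1 list_all2_graph_on bij_betw_def using 1(3)[of "univ A"] by auto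
qed

context pattern_cover
begin

section \<open>The action of pattern symmetries on walks and on the cover\<close>

lemma symmetryD:
  assumes "pattern_symmetry \<sigma> P \<pi>S \<pi>E \<pi>H"
  shows "bij_betw \<pi>S (sites I) (sites I)" "bij_betw \<pi>E (links I) (links I)" "bij_betw \<pi>H H H"
    "e \<in> links I \<Longrightarrow> src I (\<pi>E e) = \<pi>S (src I e)" "e \<in> links I \<Longrightarrow> tgt I (\<pi>E e) = \<pi>S (tgt I e)"
    "e \<in> links I \<Longrightarrow> linv I (\<pi>E e) = \<pi>E (linv I e)"
    "e \<in> links I \<Longrightarrow> map_prod \<pi>H \<pi>H ` rho P e = rho P (\<pi>E e)"
    "a \<in> H \<Longrightarrow> delta P (\<pi>H a) = \<pi>S (delta P a)"
    "R \<in> syms \<sigma> \<Longrightarrow> set xs \<subseteq> H \<Longrightarrow> xs \<in> rel (str P) R \<longleftrightarrow> map \<pi>H xs \<in> rel (str P) R"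
  using assms unfolding pattern_symmetry_def incidence_symmetry_def isomorphism_graph_on by auto

lemma walk_symmetry:
  assumes "pattern_symmetry \<sigma> P \<pi>S \<pi>E \<pi>H" "walk I s w t"
  shows "walk I (\<pi>S s) (map \<pi>E w) (\<pi>S t)"
  using assms(2)
proof (induction w arbitrary: s)
  case Nil
  then show ?case using symmetryD(1)[OF assms(1)] by (auto simp: bij_betw_def)
next
  case (Cons e w)
  then have "\<pi>E e \<in> links I" using symmetryD(2)[OF assms(1)] by (auto simp: bij_betw_def)
  then show ?case using Cons symmetryD(4,5)[OF assms(1), of e] by auto
qed

text \<open>Conjugating the recorded permutations by \<open>hat \<pi>H\<close> extends the symmetry
  to an automorphism of the covering graph.\<close>

lemma weq_symmetry:
  assumes sym: "pattern_symmetry \<sigma> P \<pi>S \<pi>E \<pi>H"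
    and w: "walk I s w1 t1" "walk I s w2 t2" "weq s w1 w2"
  shows "weq (\<pi>S s) (map \<pi>E w1) (map \<pi>E w2)"
proof -
  note D = symmetryD[OF sym]
  have s: "s \<in> sites I" using walk_sites w(1) by blast
  note hat = hat_permutes[OF D(3)]
  note b = base(1)[OF s] base(2)[of s]
  define D where "D v = (\<pi>S (fst v), hat \<pi>H \<circ> fst (snd v) \<circ> inv (hat \<pi>H), snd (snd v))"
    for v :: "'s \<times> ('h \<times> bool \<Rightarrow> 'h \<times> bool) \<times> bool"
  have DV: "D ` V \<subseteq> V"
    using D(1) permutes_compose[OF permutes_inv[OF hat]] permutes_compose[OF _ hat]
    by (auto simp: D_def V_def bij_betw_def)
  have "lift (map \<pi>E w1) (D (base s)) \<approx> lift (map \<pi>E w2) (D (base s))"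
  proof (rule lift_automorphism[OF D(2) _ DV])
    show "linv I (\<pi>E e) = \<pi>E (linv I e)" if "e \<in> links I" for e using D(6) that .
    show "inj_on D V"
    proof (rule inj_onI)
      fix x y assume xy: "x \<in> V" "y \<in> V" "D x = D y"
      have "hat \<pi>H \<circ> fst (snd x) \<circ> inv (hat \<pi>H) = hat \<pi>H \<circ> fst (snd y) \<circ> inv (hat \<pi>H)"
        using xy(3) by (simp add: D_def)
      then have "inv (hat \<pi>H) \<circ> (hat \<pi>H \<circ> fst (snd x) \<circ> inv (hat \<pi>H)) \<circ> hat \<pi>H =
        inv (hat \<pi>H) \<circ> (hat \<pi>H \<circ> fst (snd y) \<circ> inv (hat \<pi>H)) \<circ> hat \<pi>H" by simp
      then have "fst (snd x) = fst (snd y)"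
        using permutes_inv_o[OF hat] by (metis comp_assoc comp_id id_comp)
      moreover have "fst x = fst y"
        using xy D(1) by (auto simp: D_def V_def bij_betw_def inj_on_def)
      ultimately show "x = y" using xy(3) by (auto simp: D_def prod_eq_iff)
    qed
    show "src I (\<pi>E e) = fst (D v) \<and> D (mv e v) = mv (\<pi>E e) (D v)"
      if e: "e \<in> links I" "v \<in> V" "src I e = fst v" for e v
    proof -
      have "hat \<pi>H \<circ> ext (rho P e) = ext (rho P (\<pi>E e)) \<circ> hat \<pi>H"
        using ext_hat[OF partial_injection_rho[OF e(1)] D(3)] D(7)[OF e(1)] by auto
      then have "hat \<pi>H \<circ> (ext (rho P e) \<circ> fst (snd v)) \<circ> inv (hat \<pi>H) =
        ext (rho P (\<pi>E e)) \<circ> (hat \<pi>H \<circ> fst (snd v) \<circ> inv (hat \<pi>H))"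
        by (simp only: comp_assoc[symmetric])
      then show ?thesis using D(4,5)[OF e(1)] e(3) by (simp add: D_def mv_def)
    qed
    show "walk I (fst (base s)) w1 t1" "walk I (fst (base s)) w2 t2" "base s \<in> V"
      "lift w1 (base s) \<approx> lift w2 (base s)"
      using w b by (simp_all add: weq_def)
  qed
  moreover have "D (base s) \<in> V" "fst (D (base s)) = \<pi>S s" using DV b by (auto simp: D_def)
  ultimately show ?thesis
    using weq_iff[of "D (base s)"] walk_symmetry[OF sym w(1)] walk_symmetry[OF sym w(2)] by metis
qed

section \<open>The groupoid of classes of walks\<close>

abbreviation "Walks \<equiv> {(s, w, t). walk I s w t}"

text \<open>The finitely many classes of walks are numbered, so that arrows have type
  \<open>nat\<close> for every type of sites and links.\<close>

definition code :: "('s \<times> 'e list \<times> 's) set \<Rightarrow> nat" where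
  "code = (SOME f. inj_on f (Walks // walk_rel))"

definition val :: "'s \<times> 'e list \<times> 's \<Rightarrow> nat" where
  "val x = code (walk_rel `` {x})"

definition rep :: "nat \<Rightarrow> 's \<times> 'e list \<times> 's" where
  "rep g = (SOME x. x \<in> Walks \<and> val x = g)"

definition G :: "(nat, 's, 'e) groupoid" where
  "G = \<lparr>arrows = val ` Walks, gsrc = (\<lambda>g. fst (rep g)), gtgt = (\<lambda>g. snd (snd (rep g))),
     gcomp = (\<lambda>g h. val (fst (rep g), fst (snd (rep g)) @ fst (snd (rep h)), snd (snd (rep h)))),
     gunit = (\<lambda>s. val (s, [], s)),
     ginv = (\<lambda>g. val (snd (snd (rep g)), winv I (fst (snd (rep g))), fst (rep g))),
     gen = (\<lambda>e. val (src I e, [e], tgt I e))\<rparr>"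

lemma inj_code: "inj_on code (Walks // walk_rel)"
proof -
  have "\<exists>f :: ('s \<times> 'e list \<times> 's) set \<Rightarrow> nat. inj_on f (Walks // walk_rel)"
    using finite_imp_inj_to_nat_seg[OF finite_walk_classes] by blast
  then show ?thesis unfolding code_def by (rule someI_ex)
qed

lemma val_eq:
  assumes "walk I s w t" "walk I s' w' t'"
  shows "val (s, w, t) = val (s', w', t') \<longleftrightarrow> s = s' \<and> t = t' \<and> weq s w w'"
proof -
  have W: "(s, w, t) \<in> Walks" "(s', w', t') \<in> Walks" using assms by auto
  then have "val (s, w, t) = val (s', w', t') \<longleftrightarrow> walk_rel `` {(s, w, t)} = walk_rel `` {(s', w', t')}"
    unfolding val_def using inj_on_eq_iff[OF inj_code] by (simp add: quotientI)
  also have "\<dots> \<longleftrightarrow> ((s, w, t), (s', w', t')) \<in> walk_rel"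
    using eq_equiv_class_iff[OF equiv_walk_rel W] .
  also have "\<dots> \<longleftrightarrow> s = s' \<and> t = t' \<and> weq s w w'"
    using assms by (auto simp: walk_rel_def)
  finally show ?thesis .
qed

lemma rep_val:
  assumes "walk I s w t"
  obtains w' where "rep (val (s, w, t)) = (s, w', t)" "walk I s w' t" "weq s w' w"
proof -
  let ?x = "rep (val (s, w, t))"
  have "?x \<in> Walks \<and> val ?x = val (s, w, t)"
    unfolding rep_def by (rule someI[of _ "(s, w, t)"]) (use assms in simp)
  moreover obtain s' w' t' where "?x = (s', w', t')" by (metis surj_pair)
  ultimately show thesis using that val_eq[of s' w' t' s w t] assms by auto
qed

lemma G_val:
  assumes "walk I s w t"
  shows "val (s, w, t) \<in> arrows G" "gsrc G (val (s, w, t)) = s" "gtgt G (val (s, w, t)) = t"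
    "ginv G (val (s, w, t)) = val (t, winv I w, s)"
proof -
  obtain w' where w': "rep (val (s, w, t)) = (s, w', t)" "walk I s w' t" "weq s w' w"
    using rep_val[OF assms] .
  show "val (s, w, t) \<in> arrows G" using assms by (auto simp: G_def)
  show "gsrc G (val (s, w, t)) = s" "gtgt G (val (s, w, t)) = t" using w'(1) by (auto simp: G_def)
  \<comment> \<open>Uniqueness of inverses: both sides are compared with
    \<open>winv I w @ w @ winv I w'\<close>.\<close>
  have "weq t (winv I w') (winv I w)"
  proof -
    have 1: "weq t (winv I w @ w @ winv I w') (winv I w @ w' @ winv I w')"
      using weq_append[OF weq_refl walk_winv[OF assms] walk_winv[OF assms]
        weq_append[OF weq_sym[OF w'(3)] assms w'(2) weq_refl]] .
    have 2: "weq t (winv I w @ w' @ winv I w') (winv I w @ [])"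
      by (rule weq_append[OF weq_refl walk_winv[OF assms] walk_winv[OF assms] weq_winv_right[OF w'(2)]])
    have 3: "weq t ((winv I w @ w) @ winv I w') ([] @ winv I w')"
      by (rule weq_append[OF weq_winv_left[OF assms]])
        (use walk_winv[OF assms] assms walk_sites in \<open>auto simp: walk_append\<close>)
    show ?thesis using weq_trans[OF weq_sym[OF 3]] weq_trans[OF 1 2] by simp
  qed
  then show "ginv G (val (s, w, t)) = val (t, winv I w, s)"
    using w'(1) val_eq[OF walk_winv[OF w'(2)] walk_winv[OF assms]] by (simp add: G_def)
qed

lemma gcomp_val:
  assumes "walk I s u t" "walk I t w r"
  shows "gcomp G (val (s, u, t)) (val (t, w, r)) = val (s, u @ w, r)"
proof -
  obtain u' where u': "rep (val (s, u, t)) = (s, u', t)" "walk I s u' t" "weq s u' u"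
    using rep_val[OF assms(1)] .
  obtain w' where w': "rep (val (t, w, r)) = (t, w', r)" "walk I t w' r" "weq t w' w"
    using rep_val[OF assms(2)] .
  have "weq s (u' @ w') (u @ w)" by (rule weq_append[OF u'(3,2) assms(1) w'(3)])
  moreover have "walk I s (u' @ w') r" "walk I s (u @ w) r" using u' w' assms by (auto simp: walk_append)
  ultimately show ?thesis using u'(1) w'(1) val_eq by (simp add: G_def)
qed

lemma arrowE:
  assumes "g \<in> arrows G"
  obtains w where "walk I (gsrc G g) w (gtgt G g)" "g = val (gsrc G g, w, gtgt G g)"
proof -
  obtain s w t where "walk I s w t" "g = val (s, w, t)" using assms by (auto simp: G_def)
  then show thesis using that G_val by metis
qed

lemma gunit_G: "gunit G s = val (s, [], s)"
  by (simp add: G_def)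

lemma gen_G: "gen G e = val (src I e, [e], tgt I e)"
  by (simp add: G_def)

lemma walk_val_G: "walk I s w t \<Longrightarrow> walk_val I G s w = val (s, w, t)"
proof (induction w arbitrary: s)
  case (Cons e w)
  then have "walk I s [e] (tgt I e)" "walk I (tgt I e) w t" by (auto simp: link)
  then show ?case using Cons gcomp_val[of s "[e]" "tgt I e" w t] by (auto simp: gen_G)
qed (simp add: gunit_G)

lemma is_groupoid_G: "is_groupoid I G"
  unfolding is_groupoid_def
proof (intro conjI ballI impI)
  fix g assume g: "g \<in> arrows G"
  obtain w where w: "walk I (gsrc G g) w (gtgt G g)" "g = val (gsrc G g, w, gtgt G g)" using arrowE[OF g] .
  define s t where "s = gsrc G g" and "t = gtgt G g"
  have w: "walk I s w t" "g = val (s, w, t)" using w by (simp_all add: s_def t_def)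
  note st = walk_sites[OF w(1)]
  have unit: "walk I s [] s" "walk I t [] t" using st by auto
  show "gsrc G g \<in> sites I" "gtgt G g \<in> sites I" using st by (simp_all add: s_def t_def)
  have "gcomp G (gunit G s) g = g" "gcomp G g (gunit G t) = g"
    using gcomp_val[OF unit(1) w(1)] gcomp_val[OF w(1) unit(2)] by (simp_all add: gunit_G w(2))
  then show "gcomp G (gunit G (gsrc G g)) g = g" "gcomp G g (gunit G (gtgt G g)) = g"
    by (simp_all add: s_def t_def)
  note wi = walk_winv[OF w(1)]
  have inv: "ginv G g = val (t, winv I w, s)" using G_val(4)[OF w(1)] w(2) by simp
  show "ginv G g \<in> hom_set G (gtgt G g) (gsrc G g)"
    using G_val(1-3)[OF wi] inv by (simp add: hom_set_def s_def t_def)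
  have "walk I s (w @ winv I w) s" "walk I t (winv I w @ w) t" using w(1) wi by (auto simp: walk_append)
  then have "gcomp G g (ginv G g) = gunit G s" "gcomp G (ginv G g) g = gunit G t"
    using gcomp_val[OF w(1) wi] gcomp_val[OF wi w(1)] val_eq[OF _ unit(1)] val_eq[OF _ unit(2)]
      weq_winv_right[OF w(1)] weq_winv_left[OF w(1)] unfolding inv unfolding gunit_G w(2) by simp_all
  then show "gcomp G g (ginv G g) = gunit G (gsrc G g)" "gcomp G (ginv G g) g = gunit G (gtgt G g)"
    by (simp_all add: s_def t_def)
  show "\<exists>s w s'. walk I s w s' \<and> g = walk_val I G s w"
    using w walk_val_G by metis
  fix h assume h: "h \<in> arrows G"
  obtain u where u: "walk I (gsrc G h) u (gtgt G h)" "h = val (gsrc G h, u, gtgt G h)" using arrowE[OF h] .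
  show "gcomp G g h \<in> hom_set G (gsrc G g) (gtgt G h)" if gh: "gtgt G g = gsrc G h"
  proof -
    define t' where "t' = gtgt G h"
    have u': "walk I t u t'" "h = val (t, u, t')" using u gh by (simp_all add: t_def t'_def)
    have wu: "walk I s (w @ u) t'" using w(1) u'(1) unfolding walk_append by blast
    have "gcomp G g h = val (s, w @ u, t')" using gcomp_val[OF w(1) u'(1)] w(2) u'(2) by simp
    then have "gcomp G g h \<in> hom_set G s t'" using G_val(1-3)[OF wu] by (simp add: hom_set_def)
    then show ?thesis by (simp add: s_def t'_def)
  qed
  fix k assume k: "k \<in> arrows G"
  obtain v where v: "walk I (gsrc G k) v (gtgt G k)" "k = val (gsrc G k, v, gtgt G k)" using arrowE[OF k] .
  show "gcomp G (gcomp G g h) k = gcomp G g (gcomp G h k)"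
    if gh: "gtgt G g = gsrc G h \<and> gtgt G h = gsrc G k"
  proof -
    define t' t'' where "t' = gtgt G h" and "t'' = gtgt G k"
    have u': "walk I t u t'" "h = val (t, u, t')" and v': "walk I t' v t''" "k = val (t', v, t'')"
      using u v gh by (simp_all add: t_def t'_def t''_def)
    have 1: "walk I s (w @ u) t'" "walk I t (u @ v) t''" using w(1) u'(1) v'(1) by (auto simp: walk_append)
    show ?thesis
      unfolding w(2) u'(2) v'(2) gcomp_val[OF w(1) u'(1)] gcomp_val[OF u'(1) v'(1)]
        gcomp_val[OF 1(1) v'(1)] gcomp_val[OF w(1) 1(2)] by simp
  qed
next
  fix s assume "s \<in> sites I"
  then show "gunit G s \<in> hom_set G s s" using G_val[of s "[]" s] by (simp add: gunit_G hom_set_def)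
next
  fix e assume e: "e \<in> links I"
  have we: "walk I (src I e) [e] (tgt I e)" using e link by simp
  show "gen G e \<in> hom_set G (src I e) (tgt I e)" using G_val[OF we] by (simp add: gen_G hom_set_def)
  show "gen G (linv I e) = ginv G (gen G e)"
    using G_val(4)[OF we] link[OF e] by (simp add: gen_G winv_def)
qed

lemma finite_arrows: "finite (arrows G)"
proof -
  have "arrows G \<subseteq> code ` (Walks // walk_rel)" by (auto simp: G_def val_def quotientI)
  then show ?thesis using finite_walk_classes finite_subset by blast
qed

lemma walk_val_eq:
  assumes "walk I s w t" "walk I s w' t'"
  shows "walk_val I G s w = walk_val I G s w' \<longleftrightarrow> weq s w w'"
  using walk_val_G[OF assms(1)] walk_val_G[OF assms(2)] val_eq[OF assms] weq_end assms by metis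

text \<open>A walk of value 1 is equivalent to the empty walk, and equivalent walks agree where both
  are defined.\<close>

lemma compatible_G: "compatible G P"
  unfolding compatible_def
proof (intro allI impI, elim conjE)
  fix s w assume w: "walk I s w s" "walk_val I G s w = gunit G s"
  have s: "walk I s [] s" using walk_sites[OF w(1)] by simp
  have eq: "weq s w []" using walk_val_eq[OF w(1) s] w(2) by simp
  show "rho_walk P s w \<subseteq> Id_on (univ (part P s))"
  proof
    fix p assume p: "p \<in> rho_walk P s w"
    then obtain a b where ab: "p = (a, b)" "a \<in> univ (part P s)" using rho_walk_range[OF w(1)] by auto
    then have "b = a" using weq_coherent[OF eq w(1) s, of a b a] p by auto
    then show "p \<in> Id_on (univ (part P s))" using ab by auto
  qed
qed

lemma gcosetI:
  assumes "walk I s p t" "walk I t u r" "set u \<subseteq> \<alpha>"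
  shows "val (s, p @ u, r) \<in> gcoset I G (val (s, p, t)) \<alpha>"
proof -
  have "val (t, u, r) \<in> subgroupoid I G \<alpha>"
    unfolding subgroupoid_def walk_val_G[OF assms(2), symmetric] using assms(2,3) by blast
  then show ?thesis
    unfolding gcoset_def using gcomp_val[OF assms(1,2)] G_val[OF assms(1)] G_val[OF assms(2)] by force
qed

lemma gcosetE:
  assumes "h \<in> gcoset I G (val (s, p, t)) \<alpha>" "walk I s p t"
  obtains u r where "walk I t u r" "set u \<subseteq> \<alpha>" "h = val (s, p @ u, r)"
proof -
  obtain k where k: "k \<in> subgroupoid I G \<alpha>" "gsrc G k = t" "h = gcomp G (val (s, p, t)) k"
    using assms G_val(3)[OF assms(2)] by (auto simp: gcoset_def)
  obtain s' u r where u: "walk I s' u r" "set u \<subseteq> \<alpha>" "k = walk_val I G s' u"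
    using k(1) by (auto simp: subgroupoid_def)
  have "k = val (s', u, r)" using u walk_val_G by simp
  then have "s' = t" using k(2) G_val(2)[OF u(1)] by simp
  then have u': "walk I t u r" "k = val (t, u, r)" using u(1) \<open>k = val (s', u, r)\<close> by simp_all
  have "h = val (s, p @ u, r)" unfolding k(3) u'(2) by (rule gcomp_val[OF assms(2) u'(1)])
  then show thesis by (rule that[OF u'(1) u(2)])
qed

text \<open>A coset cycle provides walks \<open>w i\<close> from each \<open>g i\<close> to the
  next, whose concatenation has value 1. If \<open>w i\<close> splits into \<open>u @ v\<close>,
  then \<open>g i\<close> times \<open>u\<close> is also the next element times the inverse of
  \<open>v\<close>, a common element of the two cosets required to be disjoint.\<close>

lemma acyclic_G: "acyclic_up_to N I G"
  unfolding acyclic_up_to_def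
proof (intro allI impI, elim conjE, rule notI)
  fix n g \<alpha> assume n: "2 \<le> n" "n \<le> N" and cyc: "coset_cycle I G n g \<alpha>"
  define s where "s i = gtgt G (g i)" for i
  have mod: "(i + 1) mod n < n" for i using n by simp
  have cyc_i: "g i \<in> arrows G" "link_closed I (\<alpha> i)"
    "g ((i + 1) mod n) \<in> gcoset I G (g i) (\<alpha> i)"
    "gcoset I G (g i) (\<alpha> i \<inter> \<alpha> ((i + n - 1) mod n)) \<inter>
       gcoset I G (g ((i + 1) mod n)) (\<alpha> i \<inter> \<alpha> ((i + 1) mod n)) = {}" if "i < n" for i
    using cyc that unfolding coset_cycle_def by blast+
  have "\<exists>p. walk I (gsrc G (g i)) p (s i) \<and> g i = val (gsrc G (g i), p, s i)" if "i < n" for i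
    using arrowE[OF cyc_i(1)[OF that]] unfolding s_def by metis
  then obtain p where p: "\<And>i. i < n \<Longrightarrow> walk I (gsrc G (g i)) (p i) (s i)"
    "\<And>i. i < n \<Longrightarrow> g i = val (gsrc G (g i), p i, s i)" by metis
  have "\<exists>w. walk I (s i) w (s ((i + 1) mod n)) \<and> set w \<subseteq> \<alpha> i \<and>
      g ((i + 1) mod n) = val (gsrc G (g i), p i @ w, s ((i + 1) mod n))" if i: "i < n" for i
  proof -
    have "g ((i + 1) mod n) \<in> gcoset I G (val (gsrc G (g i), p i, s i)) (\<alpha> i)"
      using cyc_i(3)[OF i] p(2)[OF i] by simp
    then obtain w r where w: "walk I (s i) w r" "set w \<subseteq> \<alpha> i"
      "g ((i + 1) mod n) = val (gsrc G (g i), p i @ w, r)" using gcosetE p(1)[OF i] by metis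
    have "walk I (gsrc G (g i)) (p i @ w) r" using p(1)[OF i] w(1) by (auto simp: walk_append)
    then have "s ((i + 1) mod n) = r" using w(3) G_val(3) by (simp add: s_def)
    then show ?thesis using w by blast
  qed
  then obtain w where w: "\<And>i. i < n \<Longrightarrow> walk I (s i) (w i) (s ((i + 1) mod n))"
    "\<And>i. i < n \<Longrightarrow> set (w i) \<subseteq> \<alpha> i"
    "\<And>i. i < n \<Longrightarrow> g ((i + 1) mod n) = val (gsrc G (g i), p i @ w i, s ((i + 1) mod n))" by metis
  define q where "q i = concat (map w [0..<i])" for i
  define r where "r = gsrc G (g 0)"
  have p0: "walk I r (p 0) (s 0)" "g 0 = val (r, p 0, s 0)" using p[of 0] n by (simp_all add: r_def)
  have q: "walk I (s 0) (q i) (s (i mod n)) \<and> g (i mod n) = val (r, p 0 @ q i, s (i mod n))" if "i \<le> n" for i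
    using that
  proof (induction i)
    case 0
    then show ?case using p0 walk_sites[OF p0(1)] by (simp add: q_def)
  next
    case (Suc i)
    then have i: "i < n" "i mod n = i" by auto
    have qi: "walk I (s 0) (q i) (s i)" "g i = val (r, p 0 @ q i, s i)" using Suc i by auto
    have w1: "walk I r (p 0 @ q i) (s i)" using p0(1) qi(1) by (auto simp: walk_append)
    have "gsrc G (g i) = r" using G_val(2)[OF w1] qi(2) by simp
    then have "val (r, p 0 @ q i, s i) = val (r, p i, s i)" using p(2)[OF i(1)] qi(2) by simp
    moreover have pi: "walk I r (p i) (s i)" using p(1)[OF i(1)] \<open>gsrc G (g i) = r\<close> by simp
    \<comment> \<open>\<open>w i\<close> was chosen relative to the representative
      \<open>p i\<close> of \<open>g i\<close>; the path around the cycle provides another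
      one.\<close>
    ultimately have "weq r (p 0 @ q i) (p i)" using val_eq[OF w1 pi] by blast
    then have A: "weq r ((p 0 @ q i) @ w i) (p i @ w i)"
      using weq_append[OF _ w1 pi weq_refl] by blast
    have W: "walk I r ((p 0 @ q i) @ w i) (s ((i + 1) mod n))" "walk I r (p i @ w i) (s ((i + 1) mod n))"
      using w1 pi w(1)[OF i(1)] unfolding walk_append by blast+
    have "val (r, (p 0 @ q i) @ w i, s ((i + 1) mod n)) = val (r, p i @ w i, s ((i + 1) mod n))"
      using val_eq[OF W] A by blast
    then have "g ((i + 1) mod n) = val (r, (p 0 @ q i) @ w i, s ((i + 1) mod n))"
      using w(3)[OF i(1)] \<open>gsrc G (g i) = r\<close> by simp
    moreover have "q (Suc i) = q i @ w i" by (simp add: q_def)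
    moreover have "walk I (s 0) (q i @ w i) (s ((i + 1) mod n))"
      unfolding walk_append using qi(1) w(1)[OF i(1)] by blast
    ultimately show ?case by simp
  qed
  have qn: "walk I (s 0) (q n) (s 0)" "g 0 = val (r, p 0 @ q n, s 0)" using q[of n] n by auto
  have s00: "walk I (s 0) [] (s 0)" using walk_sites[OF qn(1)] by simp
  have w2: "walk I r (p 0 @ q n) (s 0)" using p0(1) qn(1) by (auto simp: walk_append)
  have "weq r (p 0 @ q n) (p 0)" using val_eq[OF w2 p0(1)] qn(2) p0(2) by metis
  \<comment> \<open>Cancelling \<open>p 0\<close> on the left leaves the concatenation equivalent to
    the empty walk.\<close>
  then have 1: "weq (s 0) (winv I (p 0) @ p 0 @ q n) (winv I (p 0) @ p 0)"
    using weq_append[OF weq_refl walk_winv[OF p0(1)] walk_winv[OF p0(1)]] by simp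
  have w3: "walk I (s 0) (winv I (p 0) @ p 0) (s 0)" using walk_winv[OF p0(1)] p0(1) by (auto simp: walk_append)
  have 2: "weq (s 0) ((winv I (p 0) @ p 0) @ q n) ([] @ q n)"
    by (rule weq_append[OF weq_winv_left[OF p0(1)] w3 s00 weq_refl])
  have closed: "weq (s 0) (q n) []"
    using weq_trans[OF weq_sym[OF 2]] weq_trans[OF 1 weq_winv_left[OF p0(1)]] by simp
  have "walk I (s i) (w i) (s ((i + 1) mod n)) \<and> set (w i) \<subseteq> \<alpha> i \<and> link_closed I (\<alpha> i)" if "i < n" for i
    using w that cyc_i(2) by blast
  from acyclic_walks[OF n this closed[unfolded q_def]]
  obtain i u v t where i: "i < n" and u: "walk I (s i) u t" "set u \<subseteq> \<alpha> ((i + n - 1) mod n) \<inter> \<alpha> i"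
    and v: "walk I t v (s ((i + 1) mod n))" "set v \<subseteq> \<alpha> i \<inter> \<alpha> ((i + 1) mod n)"
    and uv: "weq (s i) (u @ v) (w i)" by blast
  define a b where "a = gsrc G (g i)" and "b = s ((i + 1) mod n)"
  have pi: "walk I a (p i) (s i)" "g i = val (a, p i, s i)" using p[OF i] by (simp_all add: a_def)
  have pw: "walk I a (p i @ w i) b" using pi(1) w(1)[OF i] by (auto simp: walk_append b_def)
  have vi: "walk I b (winv I v) t" using walk_winv[OF v(1)] by (simp add: b_def)
  have set_vi: "set (winv I v) \<subseteq> \<alpha> i \<inter> \<alpha> ((i + 1) mod n)"
  proof -
    have "linv I ` (\<alpha> i) = \<alpha> i" "linv I ` (\<alpha> ((i + 1) mod n)) = \<alpha> ((i + 1) mod n)"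
      using cyc_i(2)[OF i] cyc_i(2)[OF mod] by (simp_all add: link_closed_def)
    then have "linv I ` set v \<subseteq> \<alpha> i \<inter> \<alpha> ((i + 1) mod n)" using v(2) by blast
    then show ?thesis by (simp add: winv_def)
  qed
  have "val (a, p i @ u, t) \<in> gcoset I G (g i) (\<alpha> i \<inter> \<alpha> ((i + n - 1) mod n))"
    unfolding pi(2) by (rule gcosetI[OF pi(1) u(1)]) (use u(2) in blast)
  moreover have "val (a, (p i @ w i) @ winv I v, t) \<in> gcoset I G (g ((i + 1) mod n)) (\<alpha> i \<inter> \<alpha> ((i + 1) mod n))"
    using gcosetI[OF pw vi set_vi] w(3)[OF i] by (simp add: a_def b_def)
  moreover have "val (a, (p i @ w i) @ winv I v, t) = val (a, p i @ u, t)"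
  proof -
    have uvb: "walk I (s i) (u @ v) b" using u(1) v(1) by (auto simp: walk_append b_def)
    have "weq (s i) (w i @ winv I v) ((u @ v) @ winv I v)"
      using weq_append[OF weq_sym[OF uv] _ uvb weq_refl] w(1)[OF i] by (simp add: b_def)
    moreover have "weq (s i) (u @ v @ winv I v) (u @ [])"
      by (rule weq_append[OF weq_refl u(1) u(1)]) (use weq_winv_right[OF v(1)] in simp)
    ultimately have "weq (s i) (w i @ winv I v) u" using weq_trans by simp
    then have "weq a (p i @ w i @ winv I v) (p i @ u)"
      by (rule weq_append[OF weq_refl pi(1) pi(1)])
    moreover have W: "walk I a ((p i @ w i) @ winv I v) t" "walk I a (p i @ u) t"
      using pw vi pi(1) u(1) unfolding walk_append by blast+
    ultimately show ?thesis using val_eq[OF W] by simp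
  qed
  ultimately show False using cyc_i(4)[OF i] by auto
qed

end

lemma partial_isomorphism_iff:
  "partial_isomorphism \<sigma> p A B \<longleftrightarrow> p \<subseteq> univ A \<times> univ B \<and> single_valued p \<and> single_valued (p\<inverse>) \<and>
     (\<forall>R\<in>syms \<sigma>. \<forall>xs ys. list_all2 (\<lambda>x y. (x, y) \<in> p) xs ys \<longrightarrow> (xs \<in> rel A R \<longleftrightarrow> ys \<in> rel B R))"
proof -
  have 1: "set xs \<subseteq> Domain p \<and> set ys \<subseteq> Range p" if "list_all2 (\<lambda>x y. (x, y) \<in> p) xs ys" for xs ys
    using that by (induction rule: list_all2_induct) auto
  have 2: "univ A \<inter> Domain p = Domain p" "univ B \<inter> Range p = Range p" if "p \<subseteq> univ A \<times> univ B"
    using that by auto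
  show ?thesis
    unfolding partial_isomorphism_def isomorphism_def induced_def using 1 2 by auto
qed

context pattern_cover
begin

section \<open>Calculation in the groupoid\<close>

lemmas groupoid = is_groupoid_G[unfolded is_groupoid_def]

lemma gcomp:
  assumes "g \<in> arrows G" "h \<in> arrows G" "gtgt G g = gsrc G h"
  shows "gcomp G g h \<in> arrows G" "gsrc G (gcomp G g h) = gsrc G g" "gtgt G (gcomp G g h) = gtgt G h"
  using groupoid assms unfolding hom_set_def by auto

lemma gassoc:
  assumes "g \<in> arrows G" "h \<in> arrows G" "k \<in> arrows G" "gtgt G g = gsrc G h" "gtgt G h = gsrc G k"
  shows "gcomp G (gcomp G g h) k = gcomp G g (gcomp G h k)"
  using groupoid assms by blast

lemma gunit:
  assumes "s \<in> sites I"
  shows "gunit G s \<in> arrows G" "gsrc G (gunit G s) = s" "gtgt G (gunit G s) = s"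
  using groupoid assms unfolding hom_set_def by auto

lemma gunit_comp:
  assumes "g \<in> arrows G"
  shows "gcomp G (gunit G (gsrc G g)) g = g" "gcomp G g (gunit G (gtgt G g)) = g"
  using groupoid assms by auto

lemma ginv:
  assumes "g \<in> arrows G"
  shows "ginv G g \<in> arrows G" "gsrc G (ginv G g) = gtgt G g" "gtgt G (ginv G g) = gsrc G g"
    "gcomp G g (ginv G g) = gunit G (gsrc G g)" "gcomp G (ginv G g) g = gunit G (gtgt G g)"
  using groupoid assms unfolding hom_set_def by auto

lemma gen:
  assumes "e \<in> links I"
  shows "gen G e \<in> arrows G" "gsrc G (gen G e) = src I e" "gtgt G (gen G e) = tgt I e"
    "gen G (linv I e) = ginv G (gen G e)"
  using groupoid assms unfolding hom_set_def by auto

lemma arrow_sites: "g \<in> arrows G \<Longrightarrow> gsrc G g \<in> sites I \<and> gtgt G g \<in> sites I"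
  using groupoid by blast

lemma gcomp_cancel:
  assumes "g \<in> arrows G" "h \<in> arrows G" "gsrc G g = gsrc G h"
  shows "gcomp G g (gcomp G (ginv G g) h) = h"
  using assms gassoc[of g "ginv G g" h] ginv[of g] gunit_comp[of h] by simp

lemma gcomp_cancel':
  assumes "g \<in> arrows G" "h \<in> arrows G" "gtgt G g = gsrc G h"
  shows "gcomp G (ginv G g) (gcomp G g h) = h"
  using assms gassoc[of "ginv G g" g h] ginv[of g] gunit_comp[of h] by simp

definition ext_link :: "nat \<Rightarrow> 'e \<Rightarrow> nat" where
  "ext_link g e = gcomp G g (gen G e)"

lemma ext_link:
  assumes "g \<in> arrows G" "e \<in> links I" "src I e = gtgt G g"
  shows "ext_link g e \<in> arrows G" "gsrc G (ext_link g e) = gsrc G g" "gtgt G (ext_link g e) = tgt I e"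
    "ext_link (ext_link g e) (linv I e) = g"
proof -
  show "ext_link g e \<in> arrows G" "gsrc G (ext_link g e) = gsrc G g" "gtgt G (ext_link g e) = tgt I e"
    using gcomp[OF assms(1) gen(1)[OF assms(2)]] gen[OF assms(2)] assms(3) by (simp_all add: ext_link_def)
  show "ext_link (ext_link g e) (linv I e) = g"
    using assms gen[OF assms(2)] ginv[OF gen(1)[OF assms(2)]] gunit_comp(2)[OF assms(1)]
      gassoc[OF assms(1) gen(1)[OF assms(2)] ginv(1)[OF gen(1)[OF assms(2)]]]
    by (simp add: ext_link_def)
qed

section \<open>The direct product\<close>

abbreviation "DP \<equiv> direct_product P G"

lemma DP_simps:
  "sites (inc DP) = arrows G"
  "links (inc DP) = {(e, g). e \<in> links I \<and> g \<in> arrows G \<and> gtgt G g = src I e}"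
  "src (inc DP) (e, g) = g" "tgt (inc DP) (e, g) = ext_link g e"
  "linv (inc DP) (e, g) = (linv I e, ext_link g e)"
  "univ (str DP) = {(a, g). a \<in> H \<and> g \<in> arrows G \<and> delta P a = gtgt G g}"
  "rel (str DP) R = {map (\<lambda>a. (a, g)) t | t g. g \<in> arrows G \<and> t \<in> rel (part P (gtgt G g)) R}"
  "delta DP = snd"
  "rho DP (e, g) = {((a, g), (b, ext_link g e)) | a b. (a, b) \<in> rho P e}"
  by (auto simp: direct_product_def product_incidence_def ext_link_def)

lemma rel_part: "rel (part P s) R = {t \<in> rel (str P) R. \<forall>a\<in>set t. delta P a = s}"
  by (auto simp: Defs.part_def Defs.induced_def)

lemma univ_DP_iff: "(a, g) \<in> univ (str DP) \<longleftrightarrow> g \<in> arrows G \<and> a \<in> univ (part P (gtgt G g))"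
  by (auto simp: DP_simps univ_part)

lemma univ_part_DP: "g \<in> arrows G \<Longrightarrow> univ (part DP g) = (\<lambda>a. (a, g)) ` univ (part P (gtgt G g))"
  by (auto simp: Defs.part_def Defs.induced_def DP_simps)

lemma rel_part_DP:
  assumes "g \<in> arrows G"
  shows "rel (part DP g) R = map (\<lambda>a. (a, g)) ` rel (part P (gtgt G g)) R"
proof -
  have "t \<in> map (\<lambda>a. (a, g)) ` rel (part P (gtgt G g)) R"
    if t: "t \<in> rel (str DP) R" "\<forall>x\<in>set t. snd x = g" for t
  proof -
    obtain u h where u: "t = map (\<lambda>a. (a, h)) u" "u \<in> rel (part P (gtgt G h)) R"
      using t(1) by (auto simp: DP_simps)
    show ?thesis
    proof (cases u)
      \<comment> \<open>An empty tuple carries no trace of the copy \<open>h\<close>, but it belongs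
        to every part as soon as it belongs to one.\<close>
      case Nil
      then have "u \<in> rel (part P (gtgt G g)) R" using u(2) by (simp add: rel_part)
      then show ?thesis using u(1) Nil by force
    next
      case (Cons a v)
      then have "h = g" using t(2) u(1) by simp
      then show ?thesis using u by blast
    qed
  qed
  moreover have "map (\<lambda>a. (a, g)) u \<in> rel (str DP) R" if "u \<in> rel (part P (gtgt G g)) R" for u
    using assms that by (auto simp: DP_simps)
  moreover have "rel (part DP g) R = {t \<in> rel (str DP) R. \<forall>x\<in>set t. snd x = g}"
    unfolding Defs.part_def Defs.induced_def DP_simps(8) by (auto simp del: split_paired_All split_paired_Ball_Sigma)
  ultimately show ?thesis by auto
qed

lemma part_in_str: "t \<in> rel (part P s) R \<Longrightarrow> R \<in> syms \<sigma> \<Longrightarrow> length t = arity \<sigma> R \<and> set t \<subseteq> univ (part P s)"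
  using pat unfolding amalgamation_pattern_def is_structure_def by (auto simp: rel_part univ_part)

lemma incidence_DP: "incidence_pattern (inc DP)"
proof -
  have "finite (links (inc DP))"
    by (rule finite_subset[of _ "links I \<times> arrows G"]) (use finite_inc finite_arrows in \<open>auto simp: DP_simps\<close>)
  then show ?thesis
    unfolding incidence_pattern_def
    using finite_arrows ext_link link by (auto simp: DP_simps)
qed

lemma list_all2_rho_DP:
  assumes "list_all2 (\<lambda>x y. (x, y) \<in> rho DP (e, g)) xs ys"
  obtains as bs where "xs = map (\<lambda>a. (a, g)) as" "ys = map (\<lambda>b. (b, ext_link g e)) bs"
    "list_all2 (\<lambda>x y. (x, y) \<in> rho P e) as bs"
proof -
  have "\<exists>as bs. xs = map (\<lambda>a. (a, g)) as \<and> ys = map (\<lambda>b. (b, ext_link g e)) bs \<and>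
    list_all2 (\<lambda>x y. (x, y) \<in> rho P e) as bs"
    using assms
  proof (induction rule: list_all2_induct)
    case (Cons x xs y ys)
    then obtain as bs a b where "xs = map (\<lambda>a. (a, g)) as" "ys = map (\<lambda>b. (b, ext_link g e)) bs"
      "list_all2 (\<lambda>x y. (x, y) \<in> rho P e) as bs" "x = (a, g)" "y = (b, ext_link g e)" "(a, b) \<in> rho P e"
      by (auto simp: DP_simps)
    then show ?case by (intro exI[of _ "a # as"] exI[of _ "b # bs"]) simp
  qed simp
  then show thesis using that by blast
qed

lemma inj_pair: "inj (\<lambda>a. (a, g))"
  by (simp add: inj_on_def)

lemma rho_DP:
  assumes e: "e \<in> links I" and g: "g \<in> arrows G" "gtgt G g = src I e"
  shows "partial_isomorphism \<sigma> (rho DP (e, g)) (part DP g) (part DP (ext_link g e))"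
    "rho DP (linv I e, ext_link g e) = (rho DP (e, g))\<inverse>"
proof -
  note x = ext_link[OF g(1) e g(2)[symmetric]]
  note iso = rho_iso[OF e, unfolded partial_isomorphism_iff]
  show "partial_isomorphism \<sigma> (rho DP (e, g)) (part DP g) (part DP (ext_link g e))"
    unfolding partial_isomorphism_iff
  proof (intro conjI ballI allI impI)
    show "rho DP (e, g) \<subseteq> univ (part DP g) \<times> univ (part DP (ext_link g e))"
      using rho(1)[OF e] x g by (auto simp: univ_part_DP DP_simps)
    show "single_valued (rho DP (e, g))" "single_valued ((rho DP (e, g))\<inverse>)"
      using rho(2,3)[OF e] by (auto simp: single_valued_def DP_simps)
    fix R xs ys assume R: "R \<in> syms \<sigma>" and l: "list_all2 (\<lambda>x y. (x, y) \<in> rho DP (e, g)) xs ys"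
    obtain as bs where ab: "xs = map (\<lambda>a. (a, g)) as" "ys = map (\<lambda>b. (b, ext_link g e)) bs"
      "list_all2 (\<lambda>x y. (x, y) \<in> rho P e) as bs" using list_all2_rho_DP[OF l] .
    have "as \<in> rel (part P (src I e)) R \<longleftrightarrow> bs \<in> rel (part P (tgt I e)) R" using iso R ab(3) by blast
    then show "xs \<in> rel (part DP g) R \<longleftrightarrow> ys \<in> rel (part DP (ext_link g e)) R"
      unfolding rel_part_DP[OF g(1)] rel_part_DP[OF x(1)] ab(1,2) x(3) g(2)
      by (simp add: inj_image_mem_iff inj_pair)
  qed
  show "rho DP (linv I e, ext_link g e) = (rho DP (e, g))\<inverse>"
    using rho_linv[OF e] x(4) by (auto simp: DP_simps)
qed

lemma pattern_DP: "amalgamation_pattern \<sigma> DP"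
  unfolding amalgamation_pattern_def
proof (intro conjI ballI)
  show "incidence_pattern (inc DP)" by (rule incidence_DP)
  show "is_structure \<sigma> (str DP)"
    unfolding is_structure_def
  proof (intro ballI)
    fix R t assume "R \<in> syms \<sigma>" "t \<in> rel (str DP) R"
    then obtain u g where "t = map (\<lambda>a. (a, g)) u" "g \<in> arrows G" "length u = arity \<sigma> R"
      "set u \<subseteq> univ (part P (gtgt G g))" using part_in_str by (auto simp: DP_simps)
    then show "length t = arity \<sigma> R \<and> set t \<subseteq> univ (str DP)" by (auto simp: univ_DP_iff)
  qed
  show "delta DP x \<in> sites (inc DP)" if "x \<in> univ (str DP)" for x using that by (auto simp: DP_simps)
  show "univ (part DP g) \<noteq> {}" if "g \<in> sites (inc DP)" for g
  proof -
    have g: "g \<in> arrows G" using that by (simp add: DP_simps)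
    then have "univ (part P (gtgt G g)) \<noteq> {}"
      using pat arrow_sites unfolding amalgamation_pattern_def by blast
    then show ?thesis by (simp add: univ_part_DP[OF g])
  qed
  show "\<exists>g\<in>sites (inc DP). t \<in> rel (part DP g) R" if "t \<in> rel (str DP) R" for R t
  proof -
    obtain u g where "t = map (\<lambda>a. (a, g)) u" "g \<in> arrows G" "u \<in> rel (part P (gtgt G g)) R"
      using \<open>t \<in> rel (str DP) R\<close> by (auto simp: DP_simps)
    then show ?thesis using rel_part_DP[of g R] by (auto simp: DP_simps(1))
  qed
  fix x assume "x \<in> links (inc DP)"
  then obtain e g where x: "x = (e, g)" "e \<in> links I" "g \<in> arrows G" "gtgt G g = src I e"
    by (auto simp: DP_simps)
  show "partial_isomorphism \<sigma> (rho DP x) (part DP (src (inc DP) x)) (part DP (tgt (inc DP) x))"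
    using rho_DP(1)[OF x(2-4)] x(1) by (simp add: DP_simps(3,4))
  show "rho DP (linv (inc DP) x) = (rho DP x)\<inverse>"
    using rho_DP(2)[OF x(2-4)] x(1) by (simp add: DP_simps(5))
qed

lemma covering_DP: "covering \<sigma> DP P (gtgt G) fst fst"
  unfolding covering_def pattern_hom_def
proof (intro conjI ballI impI)
  show "amalgamation_pattern \<sigma> DP" "amalgamation_pattern \<sigma> P" by (rule pattern_DP, rule pat)
  show s: "gtgt G ` sites (inc DP) = sites I"
  proof
    show "gtgt G ` sites (inc DP) \<subseteq> sites I" using arrow_sites by (auto simp: DP_simps)
    show "sites I \<subseteq> gtgt G ` sites (inc DP)" using gunit unfolding DP_simps by force
  qed
  then show "gtgt G ` sites (inc DP) \<subseteq> sites I" by simp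
  show l: "fst ` links (inc DP) = links I"
  proof
    show "fst ` links (inc DP) \<subseteq> links I" by (auto simp: DP_simps)
    show "links I \<subseteq> fst ` links (inc DP)"
    proof
      fix e assume e: "e \<in> links I"
      then have "(e, gunit G (src I e)) \<in> links (inc DP)" using gunit link by (simp add: DP_simps)
      then show "e \<in> fst ` links (inc DP)" by force
    qed
  qed
  then show "fst ` links (inc DP) \<subseteq> links I" by simp
  show u: "fst ` univ (str DP) = H"
  proof
    show "fst ` univ (str DP) \<subseteq> H" by (auto simp: DP_simps)
    show "H \<subseteq> fst ` univ (str DP)"
    proof
      fix a assume "a \<in> H"
      then have "(a, gunit G (delta P a)) \<in> univ (str DP)" using gunit delta_sites by (simp add: DP_simps)
      then show "a \<in> fst ` univ (str DP)" by force
    qed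
  qed
  then show "fst ` univ (str DP) \<subseteq> H" by simp
  show "delta P (fst x) = gtgt G (delta DP x)" if "x \<in> univ (str DP)" for x
    using that by (auto simp: DP_simps)
  show "src I (fst x) = gtgt G (src (inc DP) x)" "tgt I (fst x) = gtgt G (tgt (inc DP) x)"
    "linv I (fst x) = fst (linv (inc DP) x)" if "x \<in> links (inc DP)" for x
    using that ext_link(3) by (auto simp: DP_simps)
  show "rho P (fst x) = map_prod fst fst ` rho DP x" if "x \<in> links (inc DP)" for x
  proof -
    obtain e g where "x = (e, g)" by (metis surj_pair)
    then show ?thesis by (force simp: DP_simps)
  qed
  show "isomorphism \<sigma> (graph_on fst (univ (part DP g))) (part DP g) (part P (gtgt G g))"
    if "g \<in> sites (inc DP)" for g
  proof -
    have g: "g \<in> arrows G" using that by (simp add: DP_simps)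
    show ?thesis
      unfolding isomorphism_graph_on
    proof (intro conjI ballI allI impI)
      show "bij_betw fst (univ (part DP g)) (univ (part P (gtgt G g)))"
        by (auto simp: bij_betw_def inj_on_def univ_part_DP[OF g] image_image)
      fix R xs assume "set xs \<subseteq> univ (part DP g)"
      then have xs: "xs = map (\<lambda>a. (a, g)) (map fst xs)"
        by (auto simp: univ_part_DP[OF g] intro!: map_idI[symmetric])
      show "xs \<in> rel (part DP g) R \<longleftrightarrow> map fst xs \<in> rel (part P (gtgt G g)) R"
        unfolding rel_part_DP[OF g] by (subst xs) (simp only: inj_image_mem_iff[OF inj_mapI[OF inj_pair]])
    qed
  qed
  show "\<exists>e'\<in>links (inc DP). src (inc DP) e' = g \<and> fst e' = e"
    if "g \<in> sites (inc DP)" "e \<in> links I" "src I e = gtgt G g" for g e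
    using that by (intro bexI[of _ "(e, g)"]) (auto simp: DP_simps)
qed

section \<open>Walks of the direct product\<close>

fun annot :: "nat \<Rightarrow> 'e list \<Rightarrow> ('e \<times> nat) list" where
  "annot g [] = []"
| "annot g (e # w) = (e, g) # annot (ext_link g e) w"

definition gact :: "nat \<Rightarrow> 'e list \<Rightarrow> nat" where
  "gact g w = fold (\<lambda>e h. ext_link h e) w g"

lemma gact_simps [simp]: "gact g [] = g" "gact g (e # w) = gact (ext_link g e) w"
  by (simp_all add: gact_def)

lemma gact_append: "gact g (u @ w) = gact (gact g u) w"
  by (simp add: gact_def)

lemma gact:
  assumes "g \<in> arrows G" "walk I (gtgt G g) w t"
  shows "gact g w \<in> arrows G" "gtgt G (gact g w) = t" "walk (inc DP) g (annot g w) (gact g w)"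
    "rho_walk DP g (annot g w) = {((a, g), (b, gact g w)) | a b. (a, b) \<in> rho_walk P (gtgt G g) w}"
proof -
  have "gact g w \<in> arrows G \<and> gtgt G (gact g w) = t \<and> walk (inc DP) g (annot g w) (gact g w) \<and>
    rho_walk DP g (annot g w) = {((a, g), (b, gact g w)) | a b. (a, b) \<in> rho_walk P (gtgt G g) w}"
    using assms
  proof (induction w arbitrary: g)
    case Nil
    then show ?case by (auto simp: DP_simps(1) univ_part_DP)
  next
    case (Cons e w)
    then have e: "e \<in> links I" "src I e = gtgt G g" by auto
    note x = ext_link[OF Cons.prems(1) e]
    have IH: "gact (ext_link g e) w \<in> arrows G" "gtgt G (gact (ext_link g e) w) = t"
      "walk (inc DP) (ext_link g e) (annot (ext_link g e) w) (gact (ext_link g e) w)"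
      "rho_walk DP (ext_link g e) (annot (ext_link g e) w) =
        {((a, ext_link g e), (b, gact (ext_link g e) w)) | a b. (a, b) \<in> rho_walk P (tgt I e) w}"
      using Cons.IH[OF x(1)] Cons.prems(2) x(3) by simp_all
    have "rho_walk DP g (annot g (e # w)) =
        {((a, g), (b, ext_link g e)) | a b. (a, b) \<in> rho P e} O
        {((a, ext_link g e), (b, gact (ext_link g e) w)) | a b. (a, b) \<in> rho_walk P (tgt I e) w}"
      using IH(4) by (simp add: DP_simps(4,9))
    also have "\<dots> = {((a, g), (b, gact g (e # w))) | a b. (a, b) \<in> rho_walk P (gtgt G g) (e # w)}"
      by auto
    finally show ?case using IH Cons.prems(1) e by (simp add: DP_simps(2-4))
  qed
  then show "gact g w \<in> arrows G" "gtgt G (gact g w) = t" "walk (inc DP) g (annot g w) (gact g w)"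
    "rho_walk DP g (annot g w) = {((a, g), (b, gact g w)) | a b. (a, b) \<in> rho_walk P (gtgt G g) w}" by auto
qed

text \<open>Every walk of the product is the unfolding of a walk of the pattern at its starting
  arrow, so questions about the product become questions about walks and their values.\<close>

lemma walk_DP:
  assumes "walk (inc DP) g ws h" "g \<in> arrows G"
  obtains w where "ws = annot g w" "walk I (gtgt G g) w (gtgt G h)" "h = gact g w"
proof -
  have "\<exists>w. ws = annot g w \<and> walk I (gtgt G g) w (gtgt G h) \<and> h = gact g w"
    using assms
  proof (induction ws arbitrary: g)
    case Nil
    then show ?case using arrow_sites by (intro exI[of _ "[]"]) auto
  next
    case (Cons x ws)
    then obtain e where x: "x = (e, g)" "e \<in> links I" "gtgt G g = src I e" "walk (inc DP) (ext_link g e) ws h"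
      by (auto simp: DP_simps(2-4))
    note y = ext_link[OF Cons.prems(2) x(2) x(3)[symmetric]]
    obtain w where "ws = annot (ext_link g e) w" "walk I (tgt I e) w (gtgt G h)" "h = gact (ext_link g e) w"
      using Cons.IH[OF x(4) y(1)] y(3) by auto
    then show ?case using x by (intro exI[of _ "e # w"]) simp
  qed
  then show thesis using that by blast
qed

lemma gact_val:
  assumes "walk I s p t" "walk I t w r"
  shows "gact (val (s, p, t)) w = val (s, p @ w, r)"
  using assms
proof (induction w arbitrary: p t)
  case Nil
  then show ?case by simp
next
  case (Cons e w)
  then have e: "e \<in> links I" "src I e = t" "walk I (tgt I e) w r" by auto
  have we: "walk I t [e] (tgt I e)" using e link by simp
  have "walk I s (p @ [e]) (tgt I e)" using Cons.prems(1) we unfolding walk_append by blast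
  moreover have "ext_link (val (s, p, t)) e = val (s, p @ [e], tgt I e)"
    using gcomp_val[OF Cons.prems(1) we] e(2) by (simp add: ext_link_def gen_G)
  ultimately show ?case using Cons.IH[OF _ e(3), of "p @ [e]"] by simp
qed

text \<open>Left cancellation by a walk that represents \<open>g\<close>.\<close>

lemma gact_eq_iff:
  assumes g: "g \<in> arrows G" and w: "walk I (gtgt G g) w t" "walk I (gtgt G g) w' t"
  shows "gact g w = gact g w' \<longleftrightarrow> weq (gtgt G g) w w'"
proof -
  obtain p where p: "walk I (gsrc G g) p (gtgt G g)" "g = val (gsrc G g, p, gtgt G g)" using arrowE[OF g] .
  define s r where "s = gsrc G g" and "r = gtgt G g"
  have p: "walk I s p r" "g = val (s, p, r)" using p by (simp_all add: s_def r_def)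
  have w: "walk I r w t" "walk I r w' t" using w by (simp_all add: r_def)
  have pw: "walk I s (p @ w) t" "walk I s (p @ w') t" using p(1) w unfolding walk_append by blast+
  have "gact g w = gact g w' \<longleftrightarrow> weq s (p @ w) (p @ w')"
    unfolding p(2) gact_val[OF p(1) w(1)] gact_val[OF p(1) w(2)] val_eq[OF pw] by simp
  also have "\<dots> \<longleftrightarrow> weq r w w'"
  proof
    assume "weq s (p @ w) (p @ w')"
    then have 1: "weq r (winv I p @ p @ w) (winv I p @ p @ w')"
      using weq_append[OF weq_refl walk_winv[OF p(1)] walk_winv[OF p(1)]] by simp
    have r: "walk I r [] r" "walk I r (winv I p @ p) r"
      using walk_sites[OF p(1)] p(1) walk_winv[OF p(1)] by (auto simp: walk_append)
    have 2: "weq r ((winv I p @ p) @ u) ([] @ u)" for u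
      by (rule weq_append[OF weq_winv_left[OF p(1)] r(2,1) weq_refl])
    show "weq r w w'" using weq_trans[OF weq_sym[OF 2[of w]]] weq_trans[OF 1] 2[of w'] by simp
  qed (rule weq_append[OF weq_refl p(1) p(1)])
  finally show ?thesis by (simp add: r_def)
qed

text \<open>A walk of the product parallel to the link \<open>(e, g)\<close> projects to a walk of
  the same value as \<open>e\<close>.\<close>

lemma simple_DP: "simple_pattern DP"
  unfolding simple_pattern_def
proof (intro ballI allI impI)
  fix x ws assume x: "x \<in> links (inc DP)" and ws: "walk (inc DP) (src (inc DP) x) ws (tgt (inc DP) x)"
  obtain e g where e: "x = (e, g)" "e \<in> links I" "g \<in> arrows G" "gtgt G g = src I e"
    using x by (auto simp: DP_simps)
  note y = ext_link[OF e(3,2) e(4)[symmetric]]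
  have "walk (inc DP) g ws (ext_link g e)" using ws e(1) by (simp add: DP_simps(3,4))
  then obtain w where w: "ws = annot g w" "walk I (gtgt G g) w (tgt I e)" "ext_link g e = gact g w"
    using walk_DP[OF _ e(3)] y(3) by metis
  have we: "walk I (gtgt G g) [e] (tgt I e)" using e link by simp
  have "weq (src I e) w [e]" using gact_eq_iff[OF e(3) w(2) we] w(3) e(4) by simp
  then have "rho_walk P (src I e) w \<subseteq> rho P e" using simple_walks[OF e(2)] w(2) e(4) by simp
  then show "rho_walk DP (src (inc DP) x) ws \<subseteq> rho DP x"
    using gact(4)[OF e(3) w(2)] w(1,3) e(1,4) by (auto simp: DP_simps(3,9))
qed

lemma strongly_coherent_DP: "strongly_coherent DP"
  unfolding strongly_coherent_def
proof (intro allI impI, elim conjE)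
  fix g h u1 u2 assume u: "walk (inc DP) g u1 h" "walk (inc DP) g u2 h"
  have g: "g \<in> arrows G"
    using u(1) by (cases u1) (auto simp: DP_simps(1-3))
  obtain w1 where w1: "u1 = annot g w1" "walk I (gtgt G g) w1 (gtgt G h)" "h = gact g w1"
    using walk_DP[OF u(1) g] .
  obtain w2 where w2: "u2 = annot g w2" "walk I (gtgt G g) w2 (gtgt G h)" "h = gact g w2"
    using walk_DP[OF u(2) g] .
  have "weq (gtgt G g) w1 w2" using gact_eq_iff[OF g w1(2) w2(2)] w1(3) w2(3) by simp
  then obtain w where w: "walk I (gtgt G g) w (gtgt G h)" "weq (gtgt G g) w w1"
    "rho_walk P (gtgt G g) w1 \<subseteq> rho_walk P (gtgt G g) w" "rho_walk P (gtgt G g) w2 \<subseteq> rho_walk P (gtgt G g) w"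
    using strongly_coherent_walks[OF w1(2) w2(2)] by metis
  have h: "gact g w = h" using gact_eq_iff[OF g w(1) w1(2)] w(2) w1(3) by simp
  have "walk (inc DP) g (annot g w) h" using gact(3)[OF g w(1)] h by simp
  moreover have "rho_walk DP g u1 \<subseteq> rho_walk DP g (annot g w)"
    unfolding w1(1) gact(4)[OF g w1(2)] gact(4)[OF g w(1)] h w1(3)[symmetric] using w(3) by auto
  moreover have "rho_walk DP g u2 \<subseteq> rho_walk DP g (annot g w)"
    unfolding w2(1) gact(4)[OF g w2(2)] gact(4)[OF g w(1)] h w2(3)[symmetric] using w(4) by auto
  ultimately show "\<exists>w. walk (inc DP) g w h \<and> rho_walk DP g u1 \<subseteq> rho_walk DP g w \<and>
      rho_walk DP g u2 \<subseteq> rho_walk DP g w" by blast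
qed

end

lemma list_all2_relcomp:
  assumes "list_all2 (\<lambda>x y. (x, y) \<in> r O s) xs ys"
  obtains zs where "list_all2 (\<lambda>x y. (x, y) \<in> r) xs zs" "list_all2 (\<lambda>x y. (x, y) \<in> s) zs ys"
proof -
  have "\<exists>zs. list_all2 (\<lambda>x y. (x, y) \<in> r) xs zs \<and> list_all2 (\<lambda>x y. (x, y) \<in> s) zs ys"
    using assms
  proof (induction rule: list_all2_induct)
    case (Cons x xs y ys)
    then obtain z zs where "(x, z) \<in> r" "(z, y) \<in> s"
      "list_all2 (\<lambda>x y. (x, y) \<in> r) xs zs" "list_all2 (\<lambda>x y. (x, y) \<in> s) zs ys" by blast
    then show ?case by (intro exI[of _ "z # zs"]) simp
  qed simp
  then show thesis using that by blast
qed

lemma isomorphism_converse: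
  assumes "isomorphism \<sigma> p A B"
  shows "isomorphism \<sigma> (p\<inverse>) B A"
proof -
  have flip: "list_all2 (\<lambda>x y. (x, y) \<in> p) ys xs" if "list_all2 (\<lambda>x y. (x, y) \<in> p\<inverse>) xs ys" for xs ys
    using that by (simp add: list_all2_conv_all_nth)
  have "xs \<in> rel B R \<longleftrightarrow> ys \<in> rel A R"
    if "R \<in> syms \<sigma>" "list_all2 (\<lambda>x y. (x, y) \<in> p\<inverse>) xs ys" for R xs ys
    using assms flip[OF that(2)] that(1) unfolding isomorphism_def by blast
  then show ?thesis using assms unfolding isomorphism_def by simp
qed

context pattern_cover
begin

section \<open>The equivalence of the direct product\<close>

lemma rho_walk_single: "e \<in> links I \<Longrightarrow> rho_walk P s [e] = rho P e"
  using rho(1) by fastforce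

text \<open>Each link comes with its inverse, so the generating relation is symmetric
  already.\<close>

lemma approx_DP_eq: "approx DP = Id_on (univ (str DP)) \<union> (\<Union>x\<in>links (inc DP). rho DP x)\<^sup>+"
proof -
  have "(\<Union>x\<in>links (inc DP). rho DP x)\<inverse> \<subseteq> (\<Union>x\<in>links (inc DP). rho DP x)"
  proof
    fix p assume "p \<in> (\<Union>x\<in>links (inc DP). rho DP x)\<inverse>"
    then obtain x where x: "x \<in> links (inc DP)" "p \<in> (rho DP x)\<inverse>" by auto
    have "linv (inc DP) x \<in> links (inc DP)" "rho DP (linv (inc DP) x) = (rho DP x)\<inverse>"
      using pattern_DP x(1) unfolding amalgamation_pattern_def incidence_pattern_def by blast+
    then show "p \<in> (\<Union>x\<in>links (inc DP). rho DP x)" using x(2) by blast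
  qed
  then show ?thesis unfolding approx_def by (simp add: Un_absorb2)
qed

lemma approx_DP_cases:
  "(x, y) \<in> approx DP \<Longrightarrow> x = y \<or> (x, y) \<in> (\<Union>x\<in>links (inc DP). rho DP x)\<^sup>+"
  unfolding approx_DP_eq by (erule UnE) (simp_all add: Id_on_iff)

lemma approx_link:
  assumes "e \<in> links I" "g \<in> arrows G" "gtgt G g = src I e" "(a, b) \<in> rho P e"
  shows "((a, g), (b, ext_link g e)) \<in> (\<Union>x\<in>links (inc DP). rho DP x)"
proof -
  have "(e, g) \<in> links (inc DP)" "((a, g), (b, ext_link g e)) \<in> rho DP (e, g)"
    using assms by (simp_all add: DP_simps)
  then show ?thesis by blast
qed

lemma approx_linkE:
  assumes "(x, y) \<in> (\<Union>x\<in>links (inc DP). rho DP x)"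
  obtains a b e g where "x = (a, g)" "y = (b, ext_link g e)" "e \<in> links I" "g \<in> arrows G"
    "gtgt G g = src I e" "(a, b) \<in> rho P e"
proof -
  obtain l where l: "l \<in> links (inc DP)" "(x, y) \<in> rho DP l" using assms by blast
  obtain e g where eg: "l = (e, g)" by (metis surj_pair)
  show thesis using l that unfolding eg DP_simps by blast
qed

lemma approx_DP:
  "((a, g), (b, h)) \<in> approx DP \<longleftrightarrow> g \<in> arrows G \<and>
     (\<exists>w. walk I (gtgt G g) w (gtgt G h) \<and> h = gact g w \<and> (a, b) \<in> rho_walk P (gtgt G g) w)"
proof
  let ?R = "\<Union>x\<in>links (inc DP). rho DP x"
  assume "((a, g), (b, h)) \<in> approx DP"
  then consider "((a, g), (b, h)) \<in> Id_on (univ (str DP))" | "((a, g), (b, h)) \<in> ?R\<^sup>+"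
    unfolding approx_DP_eq by blast
  then show "g \<in> arrows G \<and>
     (\<exists>w. walk I (gtgt G g) w (gtgt G h) \<and> h = gact g w \<and> (a, b) \<in> rho_walk P (gtgt G g) w)"
  proof cases
    case 1
    then show ?thesis using arrow_sites by (auto simp: univ_DP_iff intro!: exI[of _ "[]"])
  next
    case 2
    have "g \<in> arrows G \<and> (\<exists>w. walk I (gtgt G g) w (gtgt G (snd y)) \<and> snd y = gact g w \<and>
        (a, fst y) \<in> rho_walk P (gtgt G g) w)" if "((a, g), y) \<in> ?R\<^sup>+" for y
      using that
    proof (induction rule: trancl_induct)
      case (base y)
      obtain b e where e: "y = (b, ext_link g e)" "e \<in> links I" "g \<in> arrows G"
        "gtgt G g = src I e" "(a, b) \<in> rho P e" using base by (rule approx_linkE) auto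
      show ?case
        using e ext_link(3)[OF e(3,2)] link[OF e(2)]
        by (auto simp: rho_walk_single simp del: rho_walk.simps intro!: exI[of _ "[e]"])
    next
      case (step y z)
      obtain b c e h where e: "y = (b, h)" "z = (c, ext_link h e)" "e \<in> links I" "h \<in> arrows G"
        "gtgt G h = src I e" "(b, c) \<in> rho P e" using step(2) by (rule approx_linkE)
      obtain w where w: "g \<in> arrows G" "walk I (gtgt G g) w (src I e)" "h = gact g w"
        "(a, b) \<in> rho_walk P (gtgt G g) w" using step.IH e by auto
      have we: "walk I (src I e) [e] (tgt I e)" using e(3) link by simp
      have ww: "walk I (gtgt G g) (w @ [e]) (tgt I e)" using w(2) we unfolding walk_append by blast
      have "(b, c) \<in> rho_walk P (src I e) [e]" using e(6) rho_walk_single[OF e(3)] by blast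
      then have "(a, c) \<in> rho_walk P (gtgt G g) (w @ [e])"
        unfolding rho_walk_append[OF w(2) we] using w(4) by blast
      moreover have "gact g (w @ [e]) = ext_link h e" using w(3) by (simp add: gact_append)
      ultimately show ?case using ww ext_link(3)[OF e(4,3)] e(2,5) w(1) by auto
    qed
    from this[OF 2] show ?thesis by simp
  qed
next
  let ?R = "\<Union>x\<in>links (inc DP). rho DP x"
  assume R: "g \<in> arrows G \<and>
     (\<exists>w. walk I (gtgt G g) w (gtgt G h) \<and> h = gact g w \<and> (a, b) \<in> rho_walk P (gtgt G g) w)"
  have "((a, g), (b, gact g w)) \<in> approx DP"
    if "g \<in> arrows G" "walk I (gtgt G g) w t" "(a, b) \<in> rho_walk P (gtgt G g) w" for w t
    using that
  proof (induction w arbitrary: g a)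
    case Nil
    then show ?case unfolding approx_DP_eq by (auto simp: univ_DP_iff)
  next
    case (Cons e w)
    then obtain c where e: "e \<in> links I" "gtgt G g = src I e" "walk I (tgt I e) w t"
      "(a, c) \<in> rho P e" "(c, b) \<in> rho_walk P (tgt I e) w" by auto
    note x = ext_link[OF Cons.prems(1) e(1) e(2)[symmetric]]
    have 1: "((a, g), (c, ext_link g e)) \<in> ?R" by (rule approx_link[OF e(1) Cons.prems(1) e(2,4)])
    have "((c, ext_link g e), (b, gact (ext_link g e) w)) \<in> approx DP"
      using Cons.IH[OF x(1)] e x(3) by simp
    then have "(c, ext_link g e) = (b, gact (ext_link g e) w) \<or>
        ((c, ext_link g e), (b, gact (ext_link g e) w)) \<in> ?R\<^sup>+"
      by (rule approx_DP_cases)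
    then have "((a, g), (b, gact (ext_link g e) w)) \<in> ?R\<^sup>+"
    proof
      assume "(c, ext_link g e) = (b, gact (ext_link g e) w)"
      then show ?thesis using r_into_trancl[OF 1] by simp
    qed (rule trancl_into_trancl2[OF 1])
    then show ?case unfolding approx_DP_eq by simp
  qed
  then show "((a, g), (b, h)) \<in> approx DP" using R by blast
qed

lemma approx_univ: "((a, g), (b, h)) \<in> approx DP \<Longrightarrow>
    (a, g) \<in> univ (str DP) \<and> (b, h) \<in> univ (str DP)"
  unfolding approx_DP univ_DP_iff using gact(1) rho_walk_range by blast

lemma equiv_approx: "equiv (univ (str DP)) (approx DP)"
proof (rule equivI)
  show sub: "approx DP \<subseteq> univ (str DP) \<times> univ (str DP)" using approx_univ by auto
  show "refl_on (univ (str DP)) (approx DP)" unfolding refl_on_def approx_def by blast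
  let ?R = "(\<Union>x\<in>links (inc DP). rho DP x) \<union> (\<Union>x\<in>links (inc DP). rho DP x)\<inverse>"
  have "sym (?R\<^sup>+)" by (rule sym_trancl) (rule sym_Un_converse)
  then show "sym (approx DP)" unfolding approx_def by (intro sym_Un) (auto intro: symI)
  have "trans (?R\<^sup>+)" by (rule trans_trancl)
  then show "trans (approx DP)" unfolding approx_def trans_def by blast
qed

text \<open>A walk that leads from \<open>g\<close> back to \<open>g\<close> has value 1 and hence
  moves no element. This makes the charts of the reduced product well-defined maps.\<close>

lemma approx_unique:
  assumes "((a, g), (b, g)) \<in> approx DP"
  shows "a = b"
proof -
  obtain w where w: "g \<in> arrows G" "walk I (gtgt G g) w (gtgt G g)" "g = gact g w"
    "(a, b) \<in> rho_walk P (gtgt G g) w" using assms unfolding approx_DP by blast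
  have n: "walk I (gtgt G g) [] (gtgt G g)" using walk_sites[OF w(2)] by simp
  have "weq (gtgt G g) w []" using gact_eq_iff[OF w(1,2) n] w(3) by simp
  moreover have "(a, a) \<in> rho_walk P (gtgt G g) []" using w(4) rho_walk_range[OF w(2)] by auto
  ultimately show ?thesis using weq_coherent[OF _ w(2) n w(4)] by blast
qed

text \<open>Strong coherence makes a walk with a partial isomorphism of maximal cardinality realise \<open>\<approx>\<close>.\<close>

lemma approx_walk:
  assumes g: "g \<in> arrows G" and w0: "walk I (gtgt G g) w0 (gtgt G h)" "h = gact g w0"
  obtains w where "walk I (gtgt G g) w (gtgt G h)" "gact g w = h"
    "rho_walk P (gtgt G g) w = {(a, b). ((a, g), (b, h)) \<in> approx DP}"
proof -
  let ?ok = "\<lambda>w. walk I (gtgt G g) w (gtgt G h) \<and> gact g w = h"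
  have sub: "rho_walk P (gtgt G g) w \<subseteq> H \<times> H" if "?ok w" for w
    using rho_walk_range that univ_part by blast
  have fin: "finite (H \<times> H)" using fin by (simp add: finite_pattern_def)
  \<comment> \<open>The cardinalities are bounded since the universe is finite; \<open>w0\<close>
    provides a first candidate.\<close>
  have "\<exists>w. ?ok w \<and> (\<forall>w'. ?ok w' \<longrightarrow> card (rho_walk P (gtgt G g) w') \<le> card (rho_walk P (gtgt G g) w))"
    by (rule ex_has_greatest_nat[of _ w0 _ "Suc (card (H \<times> H))"])
      (use w0 card_mono[OF fin sub] in \<open>auto simp: less_Suc_eq_le\<close>)
  then obtain w where w: "?ok w"
    "\<And>w'. ?ok w' \<Longrightarrow> card (rho_walk P (gtgt G g) w') \<le> card (rho_walk P (gtgt G g) w)" by blast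
  have "(a, b) \<in> rho_walk P (gtgt G g) w" if ab: "((a, g), (b, h)) \<in> approx DP" for a b
  proof -
    obtain w1 where w1: "?ok w1" "(a, b) \<in> rho_walk P (gtgt G g) w1"
      using ab unfolding approx_DP by blast
    have "weq (gtgt G g) w w1"
      using gact_eq_iff[OF g, of w "gtgt G h" w1] w(1) w1(1) by simp
    then obtain v where v: "walk I (gtgt G g) v (gtgt G h)" "weq (gtgt G g) v w"
      "rho_walk P (gtgt G g) w \<subseteq> rho_walk P (gtgt G g) v" "rho_walk P (gtgt G g) w1 \<subseteq> rho_walk P (gtgt G g) v"
      using strongly_coherent_walks[of "gtgt G g" w "gtgt G h" w1] w(1) w1(1) by metis
    have ok: "?ok v" using gact_eq_iff[OF g v(1), of w] v(1,2) w(1) by simp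
    have "rho_walk P (gtgt G g) w = rho_walk P (gtgt G g) v"
      using card_seteq[OF finite_subset[OF sub[OF ok] fin] v(3) w(2)[OF ok]] .
    then show ?thesis using v(4) w1(2) by blast
  qed
  moreover have "((a, g), (b, h)) \<in> approx DP" if "(a, b) \<in> rho_walk P (gtgt G g) w" for a b
    unfolding approx_DP using g w(1) that by blast
  ultimately have "rho_walk P (gtgt G g) w = {(a, b). ((a, g), (b, h)) \<in> approx DP}" by auto
  then show thesis using that w(1) by blast
qed

lemma rho_walk_rel:
  assumes "list_all2 (\<lambda>x y. (x, y) \<in> rho_walk P s w) xs ys" "walk I s w t" "R \<in> syms \<sigma>"
  shows "xs \<in> rel (part P s) R \<longleftrightarrow> ys \<in> rel (part P t) R"
  using assms(1,2)
proof (induction w arbitrary: s xs)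
  case Nil
  have "xs = ys" using Nil(1) by (auto simp: list_all2_conv_all_nth Id_on_def intro!: nth_equalityI)
  then show ?case using Nil(2) by simp
next
  case (Cons e w)
  have e: "e \<in> links I" "src I e = s" "walk I (tgt I e) w t" using Cons.prems(2) by auto
  obtain zs where zs: "list_all2 (\<lambda>x y. (x, y) \<in> rho P e) xs zs"
    "list_all2 (\<lambda>x y. (x, y) \<in> rho_walk P (tgt I e) w) zs ys"
    using list_all2_relcomp[of "rho P e" "rho_walk P (tgt I e) w" xs ys] Cons.prems(1) by auto
  have "xs \<in> rel (part P s) R \<longleftrightarrow> zs \<in> rel (part P (tgt I e)) R"
    using rho_iso[OF e(1)] assms(3) zs(1) unfolding partial_isomorphism_iff e(2) by blast
  then show ?case using Cons.IH[OF zs(2) e(3)] by simp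
qed

section \<open>The reduced product\<close>

abbreviation "RP \<equiv> reduced_product P G"

lemma RP_simps:
  "univ (atl_str RP) = univ (str DP) // approx DP"
  "rel (atl_str RP) R = map (cls P G) ` rel (str DP) R"
  "dom_sets RP s = {red_dom P G g | g. g \<in> arrows G \<and> gtgt G g = s}"
  "charts RP u s = {red_chart P G g | g. g \<in> arrows G \<and> gtgt G g = s \<and> red_dom P G g = u}"
  by (simp_all add: reduced_product_def)

lemma cls_eq_iff:
  assumes "x \<in> univ (str DP)" "y \<in> univ (str DP)"
  shows "cls P G x = cls P G y \<longleftrightarrow> (x, y) \<in> approx DP"
  unfolding cls_def using eq_equiv_class_iff[OF equiv_approx assms] .

lemma cls_univ: "x \<in> univ (str DP) \<Longrightarrow> cls P G x \<in> univ (atl_str RP)"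
  unfolding cls_def RP_simps by (rule quotientI)

lemma univ_RP_E:
  assumes "X \<in> univ (atl_str RP)"
  obtains x where "x \<in> univ (str DP)" "X = cls P G x"
  using assms unfolding RP_simps cls_def by (rule quotientE)

lemma red_dom_univ: "g \<in> arrows G \<Longrightarrow> red_dom P G g \<subseteq> univ (atl_str RP)"
  unfolding red_dom_def using cls_univ univ_DP_iff by blast

lemma red_chart_simps:
  assumes "g \<in> arrows G"
  shows "red_dom P G g = (\<lambda>a. cls P G (a, g)) ` univ (part P (gtgt G g))"
    "red_chart P G g = (graph_on (\<lambda>a. cls P G (a, g)) (univ (part P (gtgt G g))))\<inverse>"
    "inj_on (\<lambda>a. cls P G (a, g)) (univ (part P (gtgt G g)))"
proof -
  show "red_dom P G g = (\<lambda>a. cls P G (a, g)) ` univ (part P (gtgt G g))"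
    "red_chart P G g = (graph_on (\<lambda>a. cls P G (a, g)) (univ (part P (gtgt G g))))\<inverse>"
    by (auto simp: red_dom_def red_chart_def graph_on_def)
  show "inj_on (\<lambda>a. cls P G (a, g)) (univ (part P (gtgt G g)))"
  proof (rule inj_onI)
    fix a b assume "a \<in> univ (part P (gtgt G g))" "b \<in> univ (part P (gtgt G g))"
      "cls P G (a, g) = cls P G (b, g)"
    then have "((a, g), (b, g)) \<in> approx DP" using cls_eq_iff assms by (simp add: univ_DP_iff)
    then show "a = b" by (rule approx_unique)
  qed
qed

text \<open>One walk realises all identifications between the two copies simultaneously and so
  carries the whole tuple; separate walks for its entries would say nothing about relations.\<close>

lemma rel_cls:
  assumes g: "g \<in> arrows G" and h: "h \<in> arrows G" and R: "R \<in> syms \<sigma>"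
    and xs: "set xs \<subseteq> univ (part P (gtgt G g))" and ys: "set ys \<subseteq> univ (part P (gtgt G h))"
    and eq: "map (\<lambda>a. cls P G (a, g)) xs = map (\<lambda>a. cls P G (a, h)) ys"
  shows "xs \<in> rel (part P (gtgt G g)) R \<longleftrightarrow> ys \<in> rel (part P (gtgt G h)) R"
proof (cases xs)
  \<comment> \<open>Without entries there is no walk between the copies at hand, but the empty tuple
    lies in all parts or in none.\<close>
  case Nil
  then show ?thesis using eq by (simp add: rel_part)
next
  case (Cons x xs')
  have len: "length xs = length ys" using eq by (metis length_map)
  have ap: "((xs ! i, g), (ys ! i, h)) \<in> approx DP" if "i < length xs" for i
  proof -
    have "(xs ! i, g) \<in> univ (str DP)" "(ys ! i, h) \<in> univ (str DP)"
      using that len xs ys g h nth_mem by (fastforce simp: univ_DP_iff)+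
    moreover have "cls P G (xs ! i, g) = cls P G (ys ! i, h)"
      using arg_cong[OF eq, of "\<lambda>l. l ! i"] that len by simp
    ultimately show ?thesis using cls_eq_iff by blast
  qed
  obtain w0 where "walk I (gtgt G g) w0 (gtgt G h)" "h = gact g w0"
    using ap[of 0] Cons unfolding approx_DP by auto
  then obtain w where w: "walk I (gtgt G g) w (gtgt G h)"
    "rho_walk P (gtgt G g) w = {(a, b). ((a, g), (b, h)) \<in> approx DP}" using approx_walk[OF g] by metis
  have "list_all2 (\<lambda>x y. (x, y) \<in> rho_walk P (gtgt G g) w) xs ys"
    unfolding w(2) using ap len by (auto simp: list_all2_conv_all_nth)
  then show ?thesis by (rule rho_walk_rel[OF _ w(1) R])
qed

lemma rel_DP_E:
  assumes "t \<in> rel (str DP) R"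
  obtains g u where "g \<in> arrows G" "u \<in> rel (part P (gtgt G g)) R" "t = map (\<lambda>a. (a, g)) u"
  using assms unfolding DP_simps by blast

lemma isomorphism_red_chart:
  assumes g: "g \<in> arrows G"
  shows "isomorphism \<sigma> (red_chart P G g) (induced (atl_str RP) (red_dom P G g)) (part P (gtgt G g))"
proof -
  let ?f = "\<lambda>a. cls P G (a, g)" and ?A = "part P (gtgt G g)"
  have ind: "univ (induced (atl_str RP) (red_dom P G g)) = red_dom P G g"
    "rel (induced (atl_str RP) (red_dom P G g)) R =
      {t \<in> map (cls P G) ` rel (str DP) R. set t \<subseteq> red_dom P G g}" for R
    using red_dom_univ[OF g] by (auto simp: Defs.induced_def RP_simps(2))
  have "isomorphism \<sigma> (graph_on ?f (univ ?A)) ?A (induced (atl_str RP) (red_dom P G g))"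
    unfolding isomorphism_graph_on ind
  proof (intro conjI ballI allI impI)
    show "bij_betw ?f (univ ?A) (red_dom P G g)"
      using red_chart_simps[OF g] by (simp add: bij_betw_def)
    fix R xs assume R: "R \<in> syms \<sigma>" and xs: "set xs \<subseteq> univ ?A"
    show "xs \<in> rel ?A R \<longleftrightarrow> map ?f xs \<in> {t \<in> map (cls P G) ` rel (str DP) R. set t \<subseteq> red_dom P G g}"
    proof
      assume x: "xs \<in> rel ?A R"
      then have "map (\<lambda>a. (a, g)) xs \<in> rel (str DP) R" using g unfolding DP_simps by blast
      moreover have "map ?f xs = map (cls P G) (map (\<lambda>a. (a, g)) xs)" by simp
      moreover have "set (map ?f xs) \<subseteq> red_dom P G g" using xs red_chart_simps(1)[OF g] by auto
      ultimately show "map ?f xs \<in> {t \<in> map (cls P G) ` rel (str DP) R. set t \<subseteq> red_dom P G g}" by blast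
    next
      assume "map ?f xs \<in> {t \<in> map (cls P G) ` rel (str DP) R. set t \<subseteq> red_dom P G g}"
      then obtain t where t: "t \<in> rel (str DP) R" "map ?f xs = map (cls P G) t" by blast
      \<comment> \<open>The tuple of classes may be witnessed in another copy, from which it has to
        be brought back to \<open>g\<close>.\<close>
      obtain h u where h: "h \<in> arrows G" "u \<in> rel (part P (gtgt G h)) R" "t = map (\<lambda>a. (a, h)) u"
        using rel_DP_E[OF t(1)] .
      have "set u \<subseteq> univ (part P (gtgt G h))" using part_in_str[OF h(2) R] by blast
      moreover have "map ?f xs = map (\<lambda>a. cls P G (a, h)) u" using t(2) h(3) by simp
      ultimately show "xs \<in> rel ?A R" using rel_cls[OF g h(1) R xs] h(2) by blast
    qed
  qed
  from isomorphism_converse[OF this] show ?thesis unfolding red_chart_simps(2)[OF g] .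
qed

text \<open>Translates changes of charts into the equivalence between two copies, which
  \<open>approx_walk\<close> expresses by a single walk.\<close>

lemma red_chart_overlap:
  assumes g: "g \<in> arrows G" and h: "h \<in> arrows G"
  shows "(red_chart P G g)\<inverse> O red_chart P G h = {(a, b). ((a, g), (b, h)) \<in> approx DP}"
    "red_chart P G g `` (red_dom P G g \<inter> red_dom P G h) =
      Domain {(a, b). ((a, g), (b, h)) \<in> approx DP}"
proof -
  have iff: "((a, g), (b, h)) \<in> approx DP \<longleftrightarrow> a \<in> univ (part P (gtgt G g)) \<and> b \<in> univ (part P (gtgt G h)) \<and>
      cls P G (a, g) = cls P G (b, h)" for a b
    using cls_eq_iff[of "(a, g)" "(b, h)"] approx_univ[of a g b h] g h by (auto simp: univ_DP_iff)
  show 1: "(red_chart P G g)\<inverse> O red_chart P G h = {(a, b). ((a, g), (b, h)) \<in> approx DP}"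
    unfolding iff red_chart_def by force
  have "red_chart P G g `` (red_dom P G g \<inter> red_dom P G h) = Domain ((red_chart P G g)\<inverse> O red_chart P G h)"
    unfolding red_chart_def red_dom_def by fastforce
  then show "red_chart P G g `` (red_dom P G g \<inter> red_dom P G h) =
      Domain {(a, b). ((a, g), (b, h)) \<in> approx DP}" using 1 by simp
qed

lemma atlas_RP: "is_atlas \<sigma> (sites I) (part P) RP"
  unfolding is_atlas_def
proof (intro conjI ballI)
  have DPs: "is_structure \<sigma> (str DP)" using pattern_DP by (simp add: amalgamation_pattern_def)
  show "is_structure \<sigma> (atl_str RP)"
    unfolding is_structure_def
  proof (intro ballI)
    fix R t assume R: "R \<in> syms \<sigma>" and "t \<in> rel (atl_str RP) R"
    then obtain u where u: "u \<in> rel (str DP) R" "t = map (cls P G) u" unfolding RP_simps by blast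
    have "length u = arity \<sigma> R" "set u \<subseteq> univ (str DP)"
      using DPs R u(1) unfolding is_structure_def by auto
    then show "length t = arity \<sigma> R \<and> set t \<subseteq> univ (atl_str RP)" using cls_univ u(2) by auto
  qed
  show "u \<subseteq> univ (atl_str RP)" "charts RP u s \<noteq> {}" if "u \<in> dom_sets RP s" for s u
    using that red_dom_univ unfolding RP_simps(3,4) by blast+
  show "isomorphism \<sigma> p (induced (atl_str RP) u) (part P s)" if "p \<in> charts RP u s" for s u p
    using that isomorphism_red_chart unfolding RP_simps(4) by blast
  show "\<exists>s\<in>sites I. \<exists>u\<in>dom_sets RP s. X \<in> u" if X: "X \<in> univ (atl_str RP)" for X
  proof -
    obtain x where x: "x \<in> univ (str DP)" "X = cls P G x" using univ_RP_E[OF X] .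
    obtain a g where ag: "x = (a, g)" by (metis surj_pair)
    have g: "g \<in> arrows G" "a \<in> univ (part P (gtgt G g))" using x(1) by (simp_all add: ag univ_DP_iff)
    then have "X \<in> red_dom P G g" unfolding red_dom_def x(2) ag by blast
    moreover have "red_dom P G g \<in> dom_sets RP (gtgt G g)" using g unfolding RP_simps by blast
    ultimately show ?thesis using arrow_sites[OF g(1)] by blast
  qed
  show "\<exists>s\<in>sites I. \<exists>u\<in>dom_sets RP s. set t \<subseteq> u" if R: "R \<in> syms \<sigma>" "t \<in> rel (atl_str RP) R" for R t
  proof -
    obtain t0 where t0: "t0 \<in> rel (str DP) R" "t = map (cls P G) t0" using R(2) unfolding RP_simps by blast
    obtain g u where g: "g \<in> arrows G" "u \<in> rel (part P (gtgt G g)) R" "t0 = map (\<lambda>a. (a, g)) u"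
      using rel_DP_E[OF t0(1)] .
    have "set u \<subseteq> univ (part P (gtgt G g))" using part_in_str[OF g(2) R(1)] by blast
    then have "set t \<subseteq> red_dom P G g" unfolding t0(2) g(3) red_chart_simps(1)[OF g(1)] by auto
    moreover have "red_dom P G g \<in> dom_sets RP (gtgt G g)" using g unfolding RP_simps by blast
    ultimately show ?thesis using arrow_sites[OF g(1)] by blast
  qed
qed

lemma realisation_RP: "realisation \<sigma> P RP"
  unfolding realisation_def
proof (intro conjI ballI impI)
  show "is_atlas \<sigma> (sites I) (part P) RP" by (rule atlas_RP)
  show "dom_sets RP s \<noteq> {}" if "s \<in> sites I" for s
    using gunit[OF that] unfolding RP_simps by blast
  show "\<exists>u'\<in>dom_sets RP (tgt I e). \<exists>p'\<in>charts RP u' (tgt I e).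
      Domain (rho P e) = p `` (u \<inter> u') \<and> rho P e = p\<inverse> O p'"
    if e: "e \<in> links I" and "p \<in> charts RP u (src I e)" for e u p
  proof -
    obtain g where g: "g \<in> arrows G" "gtgt G g = src I e" "u = red_dom P G g" "p = red_chart P G g"
      using \<open>p \<in> charts RP u (src I e)\<close> unfolding RP_simps by blast
    let ?h = "ext_link g e"
    note h = ext_link[OF g(1) e g(2)[symmetric]]
    have we: "walk I (gtgt G g) [e] (gtgt G ?h)" using e link h(3) g(2) by simp
    obtain w where w: "walk I (gtgt G g) w (gtgt G ?h)" "gact g w = ?h"
      "rho_walk P (gtgt G g) w = {(a, b). ((a, g), (b, ?h)) \<in> approx DP}"
      using approx_walk[OF g(1) we] by auto
    have "weq (gtgt G g) w [e]" using gact_eq_iff[OF g(1) w(1) we] w(2) by simp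
    \<comment> \<open>Simplicity: no other walk between the two copies enlarges the overlap beyond
      that of the link.\<close>
    then have "rho_walk P (gtgt G g) w \<subseteq> rho P e" using simple_walks[OF e] w(1) g(2) h(3) by simp
    moreover have "rho P e \<subseteq> {(a, b). ((a, g), (b, ?h)) \<in> approx DP}"
    proof clarify
      fix a b assume "(a, b) \<in> rho P e"
      then have "(a, b) \<in> rho_walk P (gtgt G g) [e]" using rho_walk_single[OF e] by blast
      then show "((a, g), (b, ?h)) \<in> approx DP" unfolding approx_DP using g(1) we by (intro conjI exI[of _ "[e]"]) auto
    qed
    ultimately have eq: "rho P e = {(a, b). ((a, g), (b, ?h)) \<in> approx DP}" using w(3) by blast
    have "red_dom P G ?h \<in> dom_sets RP (tgt I e)" "red_chart P G ?h \<in> charts RP (red_dom P G ?h) (tgt I e)"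
      using h unfolding RP_simps by blast+
    then show ?thesis using red_chart_overlap[OF g(1) h(1)] eq unfolding g(3,4) by metis
  qed
  show "\<exists>w. walk I s w s' \<and> Domain (rho_walk P s w) = p `` (u \<inter> u') \<and> rho_walk P s w = p\<inverse> O p'"
    if p: "p \<in> charts RP u s" "p' \<in> charts RP u' s'" "u \<inter> u' \<noteq> {}" for s s' u p u' p'
  proof -
    obtain g where g: "g \<in> arrows G" "gtgt G g = s" "u = red_dom P G g" "p = red_chart P G g"
      using p(1) unfolding RP_simps by blast
    obtain h where h: "h \<in> arrows G" "gtgt G h = s'" "u' = red_dom P G h" "p' = red_chart P G h"
      using p(2) unfolding RP_simps by blast
    obtain a b where ab: "a \<in> univ (part P s)" "b \<in> univ (part P s')" "cls P G (a, g) = cls P G (b, h)"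
      using p(3) unfolding g(3) h(3) red_dom_def g(2) h(2) by blast
    then have "((a, g), (b, h)) \<in> approx DP" using cls_eq_iff g h by (simp add: univ_DP_iff)
    then obtain w0 where "walk I (gtgt G g) w0 (gtgt G h)" "h = gact g w0" unfolding approx_DP by blast
    then obtain w where w: "walk I (gtgt G g) w (gtgt G h)"
      "rho_walk P (gtgt G g) w = {(a, b). ((a, g), (b, h)) \<in> approx DP}" using approx_walk[OF g(1)] by metis
    then show ?thesis
      using red_chart_overlap[OF g(1) h(1)] unfolding g(3,4) h(3,4) g(2) h(2) by metis
  qed
qed

lemma finite_DP: "finite (univ (str DP))"
  by (rule finite_subset[of _ "H \<times> arrows G"])
    (use fin finite_arrows in \<open>auto simp: finite_pattern_def DP_simps\<close>)

lemma finite_RP: "finite (univ (atl_str RP))"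
  unfolding RP_simps using finite_DP equiv_approx by (intro finite_quotient) (auto dest: equiv_type)

text \<open>If two copies over \<open>s\<close> have the same domain, the walk realising their
  overlap is closed and total at \<open>s\<close>. Then it acts as the identity, and the two charts
  coincide.\<close>

lemma single_charted_RP:
  assumes "total_closed_walks_trivial P"
  shows "single_charted (sites I) RP"
  unfolding single_charted_def
proof (intro ballI)
  fix s u assume s: "s \<in> sites I" and u: "u \<in> dom_sets RP s"
  have ne: "univ (part P s) \<noteq> {}" using pat s by (simp add: amalgamation_pattern_def)
  have sub: "red_chart P G g \<subseteq> red_chart P G h"
    if g: "g \<in> arrows G" "gtgt G g = s" and h: "h \<in> arrows G" "gtgt G h = s"
      and eq: "red_dom P G g = red_dom P G h" for g h
  proof -
    have ex: "\<exists>b. ((a, g), (b, h)) \<in> approx DP" if a: "a \<in> univ (part P s)" for a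
    proof -
      have "cls P G (a, g) \<in> red_dom P G h" using a g eq unfolding red_dom_def by blast
      then obtain b where "b \<in> univ (part P s)" "cls P G (a, g) = cls P G (b, h)"
        unfolding red_dom_def using h by blast
      then have "((a, g), (b, h)) \<in> approx DP" using cls_eq_iff a g h by (simp add: univ_DP_iff)
      then show ?thesis by blast
    qed
    obtain w0 where "walk I (gtgt G g) w0 (gtgt G h)" "h = gact g w0"
      using ne ex unfolding approx_DP by blast
    then obtain w where w: "walk I (gtgt G g) w (gtgt G h)"
      "rho_walk P (gtgt G g) w = {(a, b). ((a, g), (b, h)) \<in> approx DP}" using approx_walk[OF g(1)] by metis
    have "Domain (rho_walk P s w) = univ (part P s)"
      using ex w rho_walk_range[OF w(1)] unfolding g(2) by blast
    then have Id: "rho_walk P s w \<subseteq> Id"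
      using assms w(1) unfolding total_closed_walks_trivial_def g(2) h(2) by blast
    show ?thesis
    proof
      fix q assume "q \<in> red_chart P G g"
      then obtain a where a: "q = (cls P G (a, g), a)" "a \<in> univ (part P s)" using g by (auto simp: red_chart_def)
      obtain b where b: "((a, g), (b, h)) \<in> approx DP" using ex[OF a(2)] by blast
      then have "b = a" using Id w(2) g(2) by auto
      then have "cls P G (a, g) = cls P G (a, h)" using cls_eq_iff b approx_univ by blast
      then show "q \<in> red_chart P G h" using a h unfolding red_chart_def by blast
    qed
  qed
  obtain g where g: "g \<in> arrows G" "gtgt G g = s" "u = red_dom P G g" using u unfolding RP_simps by blast
  show "\<exists>!p. p \<in> charts RP u s"
  proof (rule ex1I[of _ "red_chart P G g"])
    show "red_chart P G g \<in> charts RP u s" using g unfolding RP_simps by blast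
    fix p assume "p \<in> charts RP u s"
    then obtain h where h: "h \<in> arrows G" "gtgt G h = s" "red_dom P G h = u" "p = red_chart P G h"
      unfolding RP_simps by blast
    then show "p = red_chart P G g" using sub[of g h] sub[of h g] g by blast
  qed
qed

section \<open>Symmetries of the reduced product\<close>

lemma rho_walk_symmetry:
  assumes "pattern_symmetry \<sigma> P \<pi>S \<pi>E \<pi>H" "walk I s w t" "(a, b) \<in> rho_walk P s w"
  shows "(\<pi>H a, \<pi>H b) \<in> rho_walk P (\<pi>S s) (map \<pi>E w)"
  using assms(2,3)
proof (induction w arbitrary: s a)
  case Nil
  then show ?case using symmetryD(3,8)[OF assms(1)] by (auto simp: univ_part bij_betw_def)
next
  case (Cons e w)
  then obtain c where c: "e \<in> links I" "walk I (tgt I e) w t" "(a, c) \<in> rho P e"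
    "(c, b) \<in> rho_walk P (tgt I e) w" by auto
  have "(\<pi>H c, \<pi>H b) \<in> rho_walk P (tgt I (\<pi>E e)) (map \<pi>E w)"
    using Cons.IH[OF c(2,4)] symmetryD(5)[OF assms(1) c(1)] by simp
  moreover have "(\<pi>H a, \<pi>H c) \<in> rho P (\<pi>E e)"
    using symmetryD(7)[OF assms(1) c(1)] c(3) by (metis imageI map_prod_simp)
  ultimately show ?case by auto
qed

lemma part_symmetry:
  assumes sym: "pattern_symmetry \<sigma> P \<pi>S \<pi>E \<pi>H" and s: "s \<in> sites I"
  shows "\<pi>H ` univ (part P s) = univ (part P (\<pi>S s))"
    "R \<in> syms \<sigma> \<Longrightarrow> rel (part P (\<pi>S s)) R = map \<pi>H ` rel (part P s) R"
proof -
  note D = symmetryD[OF sym]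
  have inj: "\<pi>S (delta P a) = \<pi>S s \<longleftrightarrow> delta P a = s" if "a \<in> H" for a
    using D(1) s delta_sites[OF that] by (auto simp: bij_betw_def inj_on_def)
  have img: "\<pi>H ` H = H" using D(3) by (simp add: bij_betw_def)
  have "univ (part P (\<pi>S s)) \<subseteq> \<pi>H ` univ (part P s)"
  proof
    fix b assume b: "b \<in> univ (part P (\<pi>S s))"
    then obtain a where a: "a \<in> H" "b = \<pi>H a" using img by (auto simp: univ_part)
    then show "b \<in> \<pi>H ` univ (part P s)" using b inj[OF a(1)] D(8)[OF a(1)] by (auto simp: univ_part)
  qed
  moreover have "\<pi>H ` univ (part P s) \<subseteq> univ (part P (\<pi>S s))"
    using img D(8) by (auto simp: univ_part)
  ultimately show U: "\<pi>H ` univ (part P s) = univ (part P (\<pi>S s))" by blast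
  assume R: "R \<in> syms \<sigma>"
  have mem: "t \<in> rel (part P r) R \<longleftrightarrow> t \<in> rel (str P) R \<and> set t \<subseteq> univ (part P r)" for t r
  proof
    assume t: "t \<in> rel (part P r) R"
    then show "t \<in> rel (str P) R \<and> set t \<subseteq> univ (part P r)" using part_in_str[OF t R] by (simp add: rel_part)
  next
    assume "t \<in> rel (str P) R \<and> set t \<subseteq> univ (part P r)"
    then show "t \<in> rel (part P r) R" by (auto simp: rel_part univ_part)
  qed
  show "rel (part P (\<pi>S s)) R = map \<pi>H ` rel (part P s) R"
  proof
    show "map \<pi>H ` rel (part P s) R \<subseteq> rel (part P (\<pi>S s)) R"
    proof clarify
      fix t assume "t \<in> rel (part P s) R"
      then have t: "t \<in> rel (str P) R" "set t \<subseteq> univ (part P s)" using mem by blast+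
      then have "set t \<subseteq> H" by (auto simp: univ_part)
      then have "map \<pi>H t \<in> rel (str P) R" using D(9)[OF R] t(1) by blast
      moreover have "set (map \<pi>H t) \<subseteq> univ (part P (\<pi>S s))" using t(2) U by auto
      ultimately show "map \<pi>H t \<in> rel (part P (\<pi>S s)) R" using mem by blast
    qed
    show "rel (part P (\<pi>S s)) R \<subseteq> map \<pi>H ` rel (part P s) R"
    proof
      fix t assume "t \<in> rel (part P (\<pi>S s)) R"
      then have t: "t \<in> rel (str P) R" "set t \<subseteq> \<pi>H ` univ (part P s)" using mem U by blast+
      then have "t \<in> map \<pi>H ` lists (univ (part P s))" by (auto simp: lists_image[symmetric])
      then obtain u where u: "set u \<subseteq> univ (part P s)" "t = map \<pi>H u" by auto
      then have "set u \<subseteq> H" by (auto simp: univ_part)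
      then have "u \<in> rel (str P) R" using D(9)[OF R] t(1) u(2) by blast
      then show "t \<in> map \<pi>H ` rel (part P s) R" using mem u by blast
    qed
  qed
qed

text \<open>Common to both kinds of symmetries: those induced by the pattern, which act on walks,
  and the rigid ones, which act by composition on the left. The equivalence is respected because
  \<open>\<pi>G\<close> is compatible with the links acting on the right.\<close>

lemma atlas_symmetry_lift:
  assumes sym: "pattern_symmetry \<sigma> P \<pi>S \<pi>E \<pi>H" and bij: "bij_betw \<pi>G (arrows G) (arrows G)"
    and tgt: "\<And>g. g \<in> arrows G \<Longrightarrow> gtgt G (\<pi>G g) = \<pi>S (gtgt G g)"
    and ext_sym: "\<And>g e. g \<in> arrows G \<Longrightarrow> e \<in> links I \<Longrightarrow> src I e = gtgt G g \<Longrightarrow>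
      \<pi>G (ext_link g e) = ext_link (\<pi>G g) (\<pi>E e)"
  obtains f where "atlas_symmetry \<sigma> P RP f \<pi>S \<pi>E \<pi>H"
    "\<And>g. g \<in> arrows G \<Longrightarrow> f ` red_dom P G g = red_dom P G (\<pi>G g)"
    "\<And>g. g \<in> arrows G \<Longrightarrow> map_prod f \<pi>H ` red_chart P G g = red_chart P G (\<pi>G g)"
proof -
  note D = symmetryD[OF sym]
  have arr: "\<pi>G g \<in> arrows G" if "g \<in> arrows G" for g using bij that by (auto simp: bij_betw_def)
  define F where "F = map_prod \<pi>H \<pi>G"
  define f where "f X = F ` X" for X
  let ?U = "univ (str DP)"
  have F_in: "F ` ?U \<subseteq> ?U"
  proof
    fix y assume "y \<in> F ` ?U"
    then obtain a g where ag: "y = (\<pi>H a, \<pi>G g)" "a \<in> H" "g \<in> arrows G" "delta P a = gtgt G g"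
      by (auto simp: F_def DP_simps)
    have "\<pi>H a \<in> H" using D(3) ag(2) by (auto simp: bij_betw_def)
    then show "y \<in> ?U" using ag D(8)[OF ag(2)] tgt[OF ag(3)] arr[OF ag(3)] by (simp add: DP_simps)
  qed
  have F_inj: "inj_on F ?U"
    using bij D(3) by (auto simp: F_def inj_on_def bij_betw_def DP_simps)
  have F_img: "F ` ?U = ?U" using endo_inj_surj[OF finite_DP F_in F_inj] .
  have gact_sym: "gact (\<pi>G g) (map \<pi>E w) = \<pi>G (gact g w)"
    if "g \<in> arrows G" "walk I (gtgt G g) w t" for g w t
    using that
  proof (induction w arbitrary: g)
    case (Cons e w)
    then have e: "e \<in> links I" "src I e = gtgt G g" "walk I (tgt I e) w t" by auto
    note x = ext_link[OF Cons.prems(1) e(1,2)]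
    show ?case using Cons.IH[OF x(1)] e(3) x(3) ext_sym[OF Cons.prems(1) e(1,2)] by simp
  qed simp
  have ap: "(F x, F y) \<in> approx DP" if xy: "(x, y) \<in> approx DP" for x y
  proof -
    obtain a g b h where eq: "x = (a, g)" "y = (b, h)" by (metis surj_pair)
    obtain w where w: "g \<in> arrows G" "walk I (gtgt G g) w (gtgt G h)" "h = gact g w"
      "(a, b) \<in> rho_walk P (gtgt G g) w" using xy unfolding eq approx_DP by blast
    have h: "h \<in> arrows G" using gact(1)[OF w(1,2)] w(3) by simp
    have "walk I (gtgt G (\<pi>G g)) (map \<pi>E w) (gtgt G (\<pi>G h))"
      using walk_symmetry[OF sym w(2)] tgt[OF w(1)] tgt[OF h] by simp
    moreover have "\<pi>G h = gact (\<pi>G g) (map \<pi>E w)" using gact_sym[OF w(1,2)] w(3) by simp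
    moreover have "(\<pi>H a, \<pi>H b) \<in> rho_walk P (gtgt G (\<pi>G g)) (map \<pi>E w)"
      using rho_walk_symmetry[OF sym w(2,4)] tgt[OF w(1)] by simp
    ultimately show ?thesis unfolding eq F_def map_prod_simp approx_DP using arr[OF w(1)] by blast
  qed
  have ap_iff: "(F x, F y) \<in> approx DP \<longleftrightarrow> (x, y) \<in> approx DP" if xy: "x \<in> ?U" "y \<in> ?U" for x y
  proof
    \<comment> \<open>The finite set \<open>approx DP\<close> is mapped injectively into itself,
      hence onto itself. This spares the inverse symmetry.\<close>
    have sub: "approx DP \<subseteq> ?U \<times> ?U" using equiv_type[OF equiv_approx] .
    have fin: "finite (approx DP)" using finite_subset[OF sub] finite_DP by simp
    have "inj_on (map_prod F F) (approx DP)"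
      using map_prod_inj_on[OF F_inj F_inj] sub by (rule inj_on_subset)
    moreover have "map_prod F F ` approx DP \<subseteq> approx DP" using ap by auto
    ultimately have img: "map_prod F F ` approx DP = approx DP" using endo_inj_surj[OF fin] by blast
    assume "(F x, F y) \<in> approx DP"
    then have "(F x, F y) \<in> map_prod F F ` approx DP" by (simp only: img)
    then obtain q where q: "(F x, F y) = map_prod F F q" "q \<in> approx DP" by (rule imageE)
    obtain x' y' where q_eq: "q = (x', y')" by (cases q)
    have x': "(x', y') \<in> approx DP" "F x = F x'" "F y = F y'" using q by (simp_all add: q_eq)
    have "x' \<in> ?U" "y' \<in> ?U" using x'(1) sub by blast+
    then have "x = x'" "y = y'" using x'(2,3) F_inj xy by (simp_all add: inj_on_eq_iff)
    then show "(x, y) \<in> approx DP" using x'(1) by simp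
  qed (rule ap)
  have f_cls: "f (cls P G x) = cls P G (F x)" if x: "x \<in> ?U" for x
  proof
    show "f (cls P G x) \<subseteq> cls P G (F x)" unfolding f_def cls_def using ap by blast
    show "cls P G (F x) \<subseteq> f (cls P G x)"
    proof
      fix z assume z: "z \<in> cls P G (F x)"
      then have "z \<in> ?U" using equiv_type[OF equiv_approx] unfolding cls_def by blast
      then obtain y where y: "y \<in> ?U" "z = F y" using F_img by blast
      then have "(x, y) \<in> approx DP" using z ap_iff[OF x y(1)] unfolding cls_def by blast
      then show "z \<in> f (cls P G x)" unfolding f_def cls_def y(2) by blast
    qed
  qed
  have FU: "F x \<in> ?U" if "x \<in> ?U" for x using F_img that by blast
  have f_inj: "inj_on f (univ (atl_str RP))"
  proof (rule inj_onI)
    fix X Y assume XY: "X \<in> univ (atl_str RP)" "Y \<in> univ (atl_str RP)" "f X = f Y"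
    obtain x where x: "x \<in> ?U" "X = cls P G x" using univ_RP_E[OF XY(1)] .
    obtain y where y: "y \<in> ?U" "Y = cls P G y" using univ_RP_E[OF XY(2)] .
    have "cls P G (F x) = cls P G (F y)" using XY(3) f_cls x y by simp
    then have "(x, y) \<in> approx DP" using cls_eq_iff[OF FU FU] ap_iff x(1) y(1) by blast
    then show "X = Y" using cls_eq_iff[OF x(1) y(1)] x(2) y(2) by simp
  qed
  have f_img: "f ` univ (atl_str RP) = univ (atl_str RP)"
  proof
    show "f ` univ (atl_str RP) \<subseteq> univ (atl_str RP)"
      using f_cls FU cls_univ by (metis image_subsetI univ_RP_E)
    show "univ (atl_str RP) \<subseteq> f ` univ (atl_str RP)"
    proof
      fix Z assume "Z \<in> univ (atl_str RP)"
      then obtain z where "z \<in> ?U" "Z = cls P G z" by (rule univ_RP_E)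
      moreover obtain x where "x \<in> ?U" "z = F x" using \<open>z \<in> ?U\<close> F_img by blast
      ultimately show "Z \<in> f ` univ (atl_str RP)" using f_cls cls_univ by (metis imageI)
    qed
  qed
  have sites: "gtgt G g \<in> sites I" if "g \<in> arrows G" for g using arrow_sites[OF that] by blast
  have dom: "f ` red_dom P G g = red_dom P G (\<pi>G g)"
    and chart: "map_prod f \<pi>H ` red_chart P G g = red_chart P G (\<pi>G g)" if g: "g \<in> arrows G" for g
  proof -
    have fc: "f (cls P G (a, g)) = cls P G (\<pi>H a, \<pi>G g)" if "a \<in> univ (part P (gtgt G g))" for a
      using f_cls[of "(a, g)"] that g by (simp add: univ_DP_iff F_def)
    have p: "univ (part P (gtgt G (\<pi>G g))) = \<pi>H ` univ (part P (gtgt G g))"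
      using part_symmetry(1)[OF sym sites[OF g]] tgt[OF g] by simp
    show "f ` red_dom P G g = red_dom P G (\<pi>G g)"
      unfolding red_chart_simps(1)[OF g] red_chart_simps(1)[OF arr[OF g]] p image_image using fc by simp
    have c: "red_chart P G h = (\<lambda>a. (cls P G (a, h), a)) ` univ (part P (gtgt G h))" for h
      by (auto simp: red_chart_def)
    show "map_prod f \<pi>H ` red_chart P G g = red_chart P G (\<pi>G g)"
      unfolding c p image_image using fc by simp
  qed
  have rel_F: "map F ` rel (str DP) R = rel (str DP) R" if R: "R \<in> syms \<sigma>" for R
  proof
    show "map F ` rel (str DP) R \<subseteq> rel (str DP) R"
    proof clarify
      fix t assume "t \<in> rel (str DP) R"
      then obtain g u where g: "g \<in> arrows G" "u \<in> rel (part P (gtgt G g)) R" "t = map (\<lambda>a. (a, g)) u"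
        by (rule rel_DP_E)
      have "map \<pi>H u \<in> rel (part P (gtgt G (\<pi>G g))) R"
        using part_symmetry(2)[OF sym sites[OF g(1)] R] g(2) tgt[OF g(1)] by simp
      moreover have "map F t = map (\<lambda>a. (a, \<pi>G g)) (map \<pi>H u)" by (simp add: g(3) F_def)
      ultimately show "map F t \<in> rel (str DP) R" using arr[OF g(1)] unfolding DP_simps by blast
    qed
    show "rel (str DP) R \<subseteq> map F ` rel (str DP) R"
    proof
      fix t assume "t \<in> rel (str DP) R"
      then obtain h v where h: "h \<in> arrows G" "v \<in> rel (part P (gtgt G h)) R" "t = map (\<lambda>a. (a, h)) v"
        by (rule rel_DP_E)
      obtain g where g: "g \<in> arrows G" "h = \<pi>G g" using bij h(1) by (auto simp: bij_betw_def)
      obtain u where u: "u \<in> rel (part P (gtgt G g)) R" "v = map \<pi>H u"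
        using part_symmetry(2)[OF sym sites[OF g(1)] R] h(2) tgt[OF g(1)] g(2) by auto
      have "t = map F (map (\<lambda>a. (a, g)) u)" by (simp add: h(3) g(2) u(2) F_def)
      moreover have "map (\<lambda>a. (a, g)) u \<in> rel (str DP) R" using g(1) u(1) unfolding DP_simps by blast
      ultimately show "t \<in> map F ` rel (str DP) R" by blast
    qed
  qed
  have str: "set t \<subseteq> ?U" if "t \<in> rel (str DP) R" "R \<in> syms \<sigma>" for t R
    using pattern_DP that by (simp add: amalgamation_pattern_def is_structure_def)
  have map_f: "map f (map (cls P G) t) = map (cls P G) (map F t)" if "set t \<subseteq> ?U" for t
    using f_cls that by auto
  have "isomorphism \<sigma> (graph_on f (univ (atl_str RP))) (atl_str RP) (atl_str RP)"
    unfolding isomorphism_graph_on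
  proof (intro conjI ballI allI impI)
    show "bij_betw f (univ (atl_str RP)) (univ (atl_str RP))" using f_inj f_img by (simp add: bij_betw_def)
    fix R xs assume R: "R \<in> syms \<sigma>" and xs: "set xs \<subseteq> univ (atl_str RP)"
    show "xs \<in> rel (atl_str RP) R \<longleftrightarrow> map f xs \<in> rel (atl_str RP) R"
    proof
      assume "xs \<in> rel (atl_str RP) R"
      then obtain t where t: "t \<in> rel (str DP) R" "xs = map (cls P G) t" unfolding RP_simps by blast
      have "map F t \<in> rel (str DP) R" using rel_F[OF R] t(1) by blast
      then show "map f xs \<in> rel (atl_str RP) R" unfolding t(2) map_f[OF str[OF t(1) R]] RP_simps by blast
    next
      assume "map f xs \<in> rel (atl_str RP) R"
      then obtain t' where t': "t' \<in> rel (str DP) R" "map f xs = map (cls P G) t'" unfolding RP_simps by blast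
      obtain t where t: "t \<in> rel (str DP) R" "t' = map F t" using rel_F[OF R] t'(1) by blast
      have "map f xs = map f (map (cls P G) t)" using t'(2) map_f[OF str[OF t(1) R]] t(2) by simp
      moreover have "inj_on f (set xs \<union> set (map (cls P G) t))"
      proof (rule inj_on_subset[OF f_inj])
        have "cls P G ` set t \<subseteq> univ (atl_str RP)" using str[OF t(1) R] cls_univ by blast
        then show "set xs \<union> set (map (cls P G) t) \<subseteq> univ (atl_str RP)" using xs by simp
      qed
      ultimately have "xs = map (cls P G) t" using inj_on_map_eq_map by blast
      then show "xs \<in> rel (atl_str RP) R" using t(1) unfolding RP_simps by blast
    qed
  qed
  moreover have "bij_betw ((`) f) (dom_sets RP s) (dom_sets RP (\<pi>S s)) \<and>
      (\<forall>u\<in>dom_sets RP s. charts RP (f ` u) (\<pi>S s) = (\<lambda>p. map_prod f \<pi>H ` p) ` charts RP u s)"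
    if s: "s \<in> sites I" for s
  proof -
    have tgt_iff: "gtgt G (\<pi>G g) = \<pi>S s \<longleftrightarrow> gtgt G g = s" if "g \<in> arrows G" for g
      using tgt[OF that] D(1) sites[OF that] s by (auto simp: bij_betw_def inj_on_def)
    have surj: "\<exists>g. g \<in> arrows G \<and> gtgt G g = s \<and> h = \<pi>G g" if h: "h \<in> arrows G" "gtgt G h = \<pi>S s" for h
    proof -
      obtain g where "g \<in> arrows G" "h = \<pi>G g" using bij h(1) by (auto simp: bij_betw_def)
      then show ?thesis using tgt_iff h(2) by blast
    qed
    have sub: "u \<subseteq> univ (atl_str RP)" if "u \<in> dom_sets RP s" for u s
      using that red_dom_univ unfolding RP_simps(3) by blast
    have inj: "inj_on ((`) f) (Pow (univ (atl_str RP)))" using f_inj by (rule inj_on_image_Pow)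
    have "(`) f ` dom_sets RP s = dom_sets RP (\<pi>S s)"
    proof
      show "(`) f ` dom_sets RP s \<subseteq> dom_sets RP (\<pi>S s)"
      proof clarify
        fix u assume "u \<in> dom_sets RP s"
        then obtain g where g: "g \<in> arrows G" "gtgt G g = s" "u = red_dom P G g" unfolding RP_simps by blast
        then show "f ` u \<in> dom_sets RP (\<pi>S s)" using dom arr tgt unfolding RP_simps by blast
      qed
      show "dom_sets RP (\<pi>S s) \<subseteq> (`) f ` dom_sets RP s"
      proof
        fix v assume "v \<in> dom_sets RP (\<pi>S s)"
        then obtain h where h: "h \<in> arrows G" "gtgt G h = \<pi>S s" "v = red_dom P G h" unfolding RP_simps by blast
        obtain g where g: "g \<in> arrows G" "gtgt G g = s" "h = \<pi>G g" using surj[OF h(1,2)] by blast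
        have "v = f ` red_dom P G g" using dom[OF g(1)] h(3) g(3) by simp
        moreover have "red_dom P G g \<in> dom_sets RP s" using g unfolding RP_simps by blast
        ultimately show "v \<in> (`) f ` dom_sets RP s" by blast
      qed
    qed
    moreover have "inj_on ((`) f) (dom_sets RP s)" using inj_on_subset[OF inj] sub by blast
    moreover have "charts RP (f ` u) (\<pi>S s) = (\<lambda>p. map_prod f \<pi>H ` p) ` charts RP u s"
      if u: "u \<in> dom_sets RP s" for u
    proof
      show "charts RP (f ` u) (\<pi>S s) \<subseteq> (\<lambda>p. map_prod f \<pi>H ` p) ` charts RP u s"
      proof
        fix q assume "q \<in> charts RP (f ` u) (\<pi>S s)"
        then obtain h where h: "h \<in> arrows G" "gtgt G h = \<pi>S s" "red_dom P G h = f ` u" "q = red_chart P G h"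
          unfolding RP_simps by blast
        obtain g where g: "g \<in> arrows G" "gtgt G g = s" "h = \<pi>G g" using surj[OF h(1,2)] by blast
        have "f ` red_dom P G g = f ` u" using dom[OF g(1)] h(3) g(3) by simp
        then have "red_dom P G g = u" using inj red_dom_univ[OF g(1)] sub[OF u] by (simp add: inj_on_def)
        then have "red_chart P G g \<in> charts RP u s" using g unfolding RP_simps by blast
        moreover have "q = map_prod f \<pi>H ` red_chart P G g" using chart[OF g(1)] h(4) g(3) by simp
        ultimately show "q \<in> (\<lambda>p. map_prod f \<pi>H ` p) ` charts RP u s" by blast
      qed
      show "(\<lambda>p. map_prod f \<pi>H ` p) ` charts RP u s \<subseteq> charts RP (f ` u) (\<pi>S s)"
      proof clarify
        fix p assume "p \<in> charts RP u s"
        then obtain g where g: "g \<in> arrows G" "gtgt G g = s" "red_dom P G g = u" "p = red_chart P G g"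
          unfolding RP_simps by blast
        have "map_prod f \<pi>H ` p = red_chart P G (\<pi>G g)" "red_dom P G (\<pi>G g) = f ` u"
          "gtgt G (\<pi>G g) = \<pi>S s" "\<pi>G g \<in> arrows G"
          using chart[OF g(1)] dom[OF g(1)] tgt[OF g(1)] arr[OF g(1)] g by simp_all
        then show "map_prod f \<pi>H ` p \<in> charts RP (f ` u) (\<pi>S s)" unfolding RP_simps by blast
      qed
    qed
    ultimately show ?thesis by (simp add: bij_betw_def)
  qed
  ultimately have "atlas_symmetry \<sigma> P RP f \<pi>S \<pi>E \<pi>H" unfolding atlas_symmetry_def using sym by blast
  then show thesis using that dom chart by blast
qed

text \<open>The action on walks descends to arrows by \<open>weq_symmetry\<close>. It is onto as
  walks can be pulled back, and therefore bijective by finiteness.\<close>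

lemma symmetry_lift:
  assumes sym: "pattern_symmetry \<sigma> P \<pi>S \<pi>E \<pi>H"
  shows "\<exists>f. atlas_symmetry \<sigma> P RP f \<pi>S \<pi>E \<pi>H"
proof -
  note D = symmetryD[OF sym]
  define \<pi>G where "\<pi>G g = val (\<pi>S (gsrc G g), map \<pi>E (fst (snd (rep g))), \<pi>S (gtgt G g))" for g
  have \<pi>G_val: "\<pi>G (val (s, w, t)) = val (\<pi>S s, map \<pi>E w, \<pi>S t)" if w: "walk I s w t" for s w t
  proof -
    obtain w' where w': "rep (val (s, w, t)) = (s, w', t)" "walk I s w' t" "weq s w' w"
      using rep_val[OF w] .
    have "weq (\<pi>S s) (map \<pi>E w') (map \<pi>E w)" using weq_symmetry[OF sym w'(2) w w'(3)] .
    then show ?thesis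
      unfolding \<pi>G_def using w'(1) G_val(2,3)[OF w] val_eq[OF walk_symmetry[OF sym w'(2)] walk_symmetry[OF sym w]]
      by simp
  qed
  have lift_walk: "\<exists>s w t. walk I s w t \<and> s' = \<pi>S s \<and> w' = map \<pi>E w \<and> t' = \<pi>S t"
    if "walk I s' w' t'" for s' w' t'
    using that
  proof (induction w' arbitrary: s')
    case Nil
    then obtain s where "s \<in> sites I" "s' = \<pi>S s" using D(1) by (auto simp: bij_betw_def)
    then show ?case using Nil by (intro exI[of _ s] exI[of _ "[]"]) auto
  next
    case (Cons e' w')
    then have "e' \<in> \<pi>E ` links I" using D(2) by (simp add: bij_betw_def)
    then obtain e where e: "e \<in> links I" "e' = \<pi>E e" by blast
    obtain s w t where w: "walk I s w t" "tgt I e' = \<pi>S s" "w' = map \<pi>E w" "t' = \<pi>S t"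
      using Cons.IH[of "tgt I e'"] Cons.prems by auto
    have "\<pi>S (tgt I e) = \<pi>S s" using w(2) D(5)[OF e(1)] e(2) by metis
    \<comment> \<open>Injectivity of \<pi>S joins the preimage of the first link to that of the
      remaining walk.\<close>
    then have "tgt I e = s" using D(1) link(2)[OF e(1)] walk_sites[OF w(1)] by (auto simp: bij_betw_def inj_on_def)
    then have "walk I (src I e) (e # w) t" using e(1) w(1) by simp
    moreover have "s' = \<pi>S (src I e)" using Cons.prems D(4)[OF e(1)] e(2) by simp
    ultimately show ?case using w(3,4) e(2) by (metis list.simps(9))
  qed
  have "\<pi>G ` arrows G = arrows G"
  proof
    show "\<pi>G ` arrows G \<subseteq> arrows G"
    proof clarify
      fix g assume "g \<in> arrows G"
      then obtain w where "walk I (gsrc G g) w (gtgt G g)" "g = val (gsrc G g, w, gtgt G g)" by (rule arrowE)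
      then show "\<pi>G g \<in> arrows G" using \<pi>G_val G_val(1) walk_symmetry[OF sym] by metis
    qed
    show "arrows G \<subseteq> \<pi>G ` arrows G"
    proof
      fix h assume "h \<in> arrows G"
      then obtain w' where w': "walk I (gsrc G h) w' (gtgt G h)" "h = val (gsrc G h, w', gtgt G h)"
        by (rule arrowE)
      obtain s w t where w: "walk I s w t" "gsrc G h = \<pi>S s" "w' = map \<pi>E w" "gtgt G h = \<pi>S t"
        using lift_walk[OF w'(1)] by blast
      have "h = \<pi>G (val (s, w, t))" using w'(2) w \<pi>G_val[OF w(1)] by simp
      then show "h \<in> \<pi>G ` arrows G" using G_val(1)[OF w(1)] by blast
    qed
  qed
  then have bij: "bij_betw \<pi>G (arrows G) (arrows G)"
    using eq_card_imp_inj_on[OF finite_arrows, of \<pi>G] by (simp add: bij_betw_def)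
  have tgt: "gtgt G (\<pi>G g) = \<pi>S (gtgt G g)" if g: "g \<in> arrows G" for g
  proof -
    obtain w where w: "walk I (gsrc G g) w (gtgt G g)" "g = val (gsrc G g, w, gtgt G g)" using arrowE[OF g] .
    show ?thesis using \<pi>G_val[OF w(1)] w(2) G_val(3)[OF walk_symmetry[OF sym w(1)]] by simp
  qed
  have ext_sym: "\<pi>G (ext_link g e) = ext_link (\<pi>G g) (\<pi>E e)"
    if g: "g \<in> arrows G" and e: "e \<in> links I" "src I e = gtgt G g" for g e
  proof -
    obtain w where w: "walk I (gsrc G g) w (gtgt G g)" "g = val (gsrc G g, w, gtgt G g)" using arrowE[OF g] .
    define s t where "s = gsrc G g" and "t = gtgt G g"
    have w: "walk I s w t" "g = val (s, w, t)" "src I e = t" using w e(2) by (simp_all add: s_def t_def)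
    have we: "walk I t [e] (tgt I e)" using e(1) w(3) link by simp
    have wwe: "walk I s (w @ [e]) (tgt I e)" using w(1) we unfolding walk_append by blast
    have "ext_link g e = val (s, w @ [e], tgt I e)" using gact_val[OF w(1) we] w(2) by simp
    then have "\<pi>G (ext_link g e) = val (\<pi>S s, map \<pi>E w @ [\<pi>E e], \<pi>S (tgt I e))" using \<pi>G_val[OF wwe] by simp
    also have "\<dots> = ext_link (\<pi>G g) (\<pi>E e)"
      using gact_val[OF walk_symmetry[OF sym w(1)] walk_symmetry[OF sym we]] w(2) \<pi>G_val[OF w(1)] by simp
    finally show ?thesis .
  qed
  show ?thesis by (rule atlas_symmetry_lift[OF sym bij]) (use tgt ext_sym in blast)+
qed

lemma identity_symmetry: "pattern_symmetry \<sigma> P id id id"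
  unfolding pattern_symmetry_def incidence_symmetry_def isomorphism_graph_on by (auto simp: map_prod.id)

text \<open>Composition on the left with \<open>h\<close> after the inverse of \<open>g\<close>
  makes sense only for arrows with the source of \<open>g\<close>. Exchanging them with those from
  the source of \<open>h\<close> extends it to a bijection of all arrows; for a common source the
  first clause alone is in force, and \<open>shift h g\<close> is the inverse in either
  case.\<close>

definition shift :: "nat \<Rightarrow> nat \<Rightarrow> nat \<Rightarrow> nat" where
  "shift g h k = (if gsrc G k = gsrc G g then gcomp G h (gcomp G (ginv G g) k)
     else if gsrc G k = gsrc G h then gcomp G g (gcomp G (ginv G h) k) else k)"

text \<open>Composition on the left commutes with the action of the links on the right.\<close>

lemma rigid_transitive:
  assumes g: "g \<in> arrows G" and h: "h \<in> arrows G" and gh: "gtgt G g = gtgt G h"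
  obtains f where "rigid_symmetry \<sigma> P RP f" "f ` red_dom P G g = red_dom P G h"
    "map_prod f id ` red_chart P G g = red_chart P G h"
proof -
  have comp: "gcomp G b (gcomp G (ginv G a) k) \<in> arrows G" "gsrc G (gcomp G b (gcomp G (ginv G a) k)) = gsrc G b"
    "gtgt G (gcomp G b (gcomp G (ginv G a) k)) = gtgt G k"
    if "a \<in> arrows G" "b \<in> arrows G" "gtgt G a = gtgt G b" "k \<in> arrows G" "gsrc G k = gsrc G a" for a b k
    using that ginv[of a] gcomp[of "ginv G a" k] gcomp[of b "gcomp G (ginv G a) k"] by simp_all
  have cancel: "gcomp G a (gcomp G (ginv G b) (gcomp G b (gcomp G (ginv G a) k))) = k"
    if "a \<in> arrows G" "b \<in> arrows G" "gtgt G a = gtgt G b" "k \<in> arrows G" "gsrc G k = gsrc G a" for a b k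
    using that ginv[of a] gcomp[of "ginv G a" k] gcomp_cancel'[of b "gcomp G (ginv G a) k"] gcomp_cancel[of a k]
    by simp
  have shift: "shift a b k \<in> arrows G \<and> gtgt G (shift a b k) = gtgt G k \<and> shift b a (shift a b k) = k"
    if ab: "a \<in> arrows G" "b \<in> arrows G" "gtgt G a = gtgt G b" and k: "k \<in> arrows G" for a b k
  proof -
    consider "gsrc G k = gsrc G a" | "gsrc G k \<noteq> gsrc G a" "gsrc G k = gsrc G b"
      | "gsrc G k \<noteq> gsrc G a" "gsrc G k \<noteq> gsrc G b" by blast
    then show ?thesis
    proof cases
      case 1
      then show ?thesis using comp[OF ab k] cancel[OF ab k] by (simp add: shift_def)
    next
      case 2
      then show ?thesis using comp[OF ab(2,1) ab(3)[symmetric] k] cancel[OF ab(2,1) ab(3)[symmetric] k]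
        by (simp add: shift_def)
    qed (use k in \<open>simp add: shift_def\<close>)
  qed
  have bij: "bij_betw (shift g h) (arrows G) (arrows G)"
    by (rule bij_betw_byWitness[of _ "shift h g"]) (use shift[OF g h gh] shift[OF h g gh[symmetric]] in auto)
  have ext_shift: "shift g h (ext_link k e) = ext_link (shift g h k) (id e)"
    if k: "k \<in> arrows G" and e: "e \<in> links I" "src I e = gtgt G k" for k e
  proof -
    have *: "gcomp G b (gcomp G (ginv G a) (gcomp G k (gen G e))) = gcomp G (gcomp G b (gcomp G (ginv G a) k)) (gen G e)"
      if "a \<in> arrows G" "b \<in> arrows G" "gtgt G a = gtgt G b" "gsrc G k = gsrc G a" for a b
      using that k e gen[OF e(1)] ginv[of a] gcomp[of "ginv G a" k] gassoc[of "ginv G a" k "gen G e"]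
        gassoc[of b "gcomp G (ginv G a) k" "gen G e"] by simp
    have "gsrc G (ext_link k e) = gsrc G k" using ext_link(2)[OF k e] .
    then show ?thesis
      unfolding shift_def using *[OF g h gh] *[OF h g gh[symmetric]] by (simp add: ext_link_def)
  qed
  have tgt: "gtgt G (shift g h k) = id (gtgt G k)" if "k \<in> arrows G" for k
    using shift[OF g h gh that] by simp
  have "shift g h g = h" using ginv(5)[OF g] gunit_comp(2)[OF h] gh by (simp add: shift_def)
  moreover obtain f where "atlas_symmetry \<sigma> P RP f id id id"
    "f ` red_dom P G g = red_dom P G (shift g h g)"
    "map_prod f id ` red_chart P G g = red_chart P G (shift g h g)"
    by (rule atlas_symmetry_lift[OF identity_symmetry bij]) (use tgt ext_shift g in blast)+
  ultimately show thesis using that unfolding rigid_symmetry_def by metis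
qed

lemma fully_symmetric_RP: "fully_symmetric \<sigma> P RP"
  unfolding fully_symmetric_def
proof (intro conjI allI impI ballI)
  show "\<exists>f. atlas_symmetry \<sigma> P RP f \<pi>S \<pi>E \<pi>H" if "pattern_symmetry \<sigma> P \<pi>S \<pi>E \<pi>H" for \<pi>S \<pi>E \<pi>H
    using symmetry_lift[OF that] .
  fix s u p u' p' assume p: "p \<in> charts RP u s" "p' \<in> charts RP u' s"
  obtain g where g: "g \<in> arrows G" "gtgt G g = s" "u = red_dom P G g" "p = red_chart P G g"
    using p(1) unfolding RP_simps by blast
  obtain h where h: "h \<in> arrows G" "gtgt G h = s" "u' = red_dom P G h" "p' = red_chart P G h"
    using p(2) unfolding RP_simps by blast
  show "\<exists>f. rigid_symmetry \<sigma> P RP f \<and> f ` u = u' \<and> map_prod f id ` p = p'"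
    using rigid_transitive[OF g(1) h(1)] g h by metis
qed

end

theorem theorem4p2:
  fixes \<sigma> :: "'r signature" and P :: "('h, 's, 'e, 'r) pattern" and N :: nat
  assumes "finite (syms \<sigma>)"
    and "amalgamation_pattern \<sigma> P" and "finite_pattern P"
    and "2 \<le> N"
  shows "\<exists>G :: (nat, 's, 'e) groupoid.
    is_groupoid (inc P) G \<and> finite (arrows G) \<and> compatible G P \<and>
    acyclic_up_to N (inc P) G \<and>
    covering \<sigma> (direct_product P G) P (gtgt G) fst fst \<and>
    simple_pattern (direct_product P G) \<and>
    strongly_coherent (direct_product P G) \<and>
    realisation \<sigma> P (reduced_product P G) \<and>
    finite (univ (atl_str (reduced_product P G))) \<and>
    fully_symmetric \<sigma> P (reduced_product P G) \<and>
    (total_closed_walks_trivial P \<longrightarrow>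
       single_charted (sites (inc P)) (reduced_product P G))"
proof -
  interpret pattern_cover \<sigma> P N using assms(2-4) by unfold_locales
  show ?thesis
    using is_groupoid_G finite_arrows compatible_G acyclic_G covering_DP simple_DP strongly_coherent_DP
      realisation_RP finite_RP fully_symmetric_RP single_charted_RP by blast
qed

end
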